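(* Let $\mathscr{D}$ be a triangulated category, $\mathcal{P}$ a silting collection in $\mathscr{D}$ and $\mathcal{L}$ a simple-minded collection in $\mathscr{D}$. Let $w$ be the weight structure on $\mathscr{C}=\mathrm{thick}_{\mathscr{D}}(\mathcal{P})$ defined by $\mathcal{P}$ and $t$ the t-structure on $\mathscr{D}$ defined by $\mathcal{L}$. Then the following are equivalent: (I) $w$ is left orthogonal to $t$. (II) $w$ is w-t-strictly left orthogonal to $t$. (III) $t=(\mathcal{P}^{\perp_{>0}},\mathcal{P}^{\perp_{<0}})$ is the silting t-structure associated with $\mathcal{P}$. (IV) There is a bijection $\phi\colon\mathcal{P}\to\mathcal{L}$ such that each $P\in\mathcal{P}$ is the derived projective cover of $\phi(P)$ with respect to $t$. (V) There is a bijection $\phi\colon\mathcal{P}\to\mathcal{L}$ such that for $P\in\mathcal{P}$, $L\in\mathcal{L}$ and $m\in\mathbb{Z}$ there are isomorphisms of left $\mathrm{End}_{\mathscr{D}}(L)$-modules $$\mathrm{Hom}_{\mathscr{D}}(P,L[m])\cong\begin{cases}\mathrm{End}_{\mathscr{D}}(L)&\text{if }L=\phi(P),\ m=0,\\0&\text{otherwise.}\end{cases}$$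
   Context: All categories are linear over a fixed field. t-structures $t=(\mathscr{D}^{t\le0},\mathscr{D}^{t\ge0})$ use the cohomological convention ($\mathscr{D}^{t\le0}[1]\subseteq\mathscr{D}^{t\le0}$); $\mathscr{D}^{t<0}=\mathscr{D}^{t\le0}[1]$, $\mathscr{D}^{t>0}=\mathscr{D}^{t\ge0}[-1]$, heart $\heartsuit_t=\mathscr{D}^{t\le0}\cap\mathscr{D}^{t\ge0}$, $H^0_t=t_{\ge0}t_{\le0}$. A weight structure on $\mathscr{C}$ is a pair $w=(\mathscr{C}_{w\le0},\mathscr{C}_{w\ge0})$ of Karoubi-closed full subcategories with $\mathscr{C}_{w\le0}[1]\subseteq\mathscr{C}_{w\le0}$, $\mathscr{C}_{w\ge0}[-1]\subseteq\mathscr{C}_{w\ge0}$, $\mathrm{Hom}(\mathscr{C}_{w\ge0}[-1],\mathscr{C}_{w\le0})=0$, and every $X\in\mathscr{C}$ sits in a triangle $w_{>0}X\to X\to w_{\le0}X\to w_{>0}X[1]$ with $w_{>0}X\in\mathscr{C}_{w\ge0}[-1]$, $w_{\le0}X\in\mathscr{C}_{w\le0}$. A simple-minded collection in $\mathscr{D}$ is a (not necessarily finite) set $\mathcal{L}$ of objects with $\mathrm{Hom}(L,L'[m])=0$ for all $L,L'\in\mathcal{L}$, $m<0$; $\mathrm{Hom}(L,L')=0$ for $L\ne L'$; $\mathrm{End}(L)$ a division algebra; and the triangulated subcategory generated by $\mathcal{L}$ is $\mathscr{D}$. It defines a bounded t-structure with $\mathscr{D}^{t\le0}$ (resp. $\mathscr{D}^{t\ge0}$)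 the extension closure of $\{L[m]\mid L\in\mathcal{L},m\ge0\}$ (resp. $m\le0$), whose heart is finite-length with simple objects $\mathcal{L}$. For a set $\mathcal{X}$ of objects, $\mathcal{X}^{\perp_{>0}}=\{D\in\mathscr{D}\mid\mathrm{Hom}(X,D[m])=0\ \forall m>0,X\in\mathcal{X}\}$, similarly $\mathcal{X}^{\perp_{<0}}$. A silting collection in $\mathscr{D}$ is a set $\mathcal{P}$ of indecomposable pairwise non-isomorphic objects such that the full subcategory of direct summands of finite coproducts of objects in $\mathcal{P}$ is Krull--Schmidt and $(\mathcal{P}^{\perp_{>0}},\mathcal{P}^{\perp_{<0}})$ is a t-structure on $\mathscr{D}$ (the associated silting t-structure). It defines a bounded weight structure on the thick subcategory $\mathscr{C}=\mathrm{thick}_{\mathscr{D}}(\mathcal{P})$ generated by $\mathcal{P}$, with $\mathscr{C}_{w\le0}$ (resp. $\mathscr{C}_{w\ge0}$) the Karoubi closure (closure under direct summands) of the extension closure of $\{P[m]\mid P\in\mathcal{P},m\ge0\}$ (resp. $m\le0$). For $\mathscr{C}\subseteq\mathscr{D}$: $w$ is left orthogonal to $t$ if $\mathrm{Hom}(\mathscr{C}_{w\ge0},\mathscr{D}^{t<0})=0$ and $\mathrm{Hom}(\mathscr{C}_{w\le0},\mathscr{D}^{t>0})=0$. It is w-t-strictly left orthogonal if moreover $\mathscr{C}_{w\ge0}=\{X\in\mathscr{C}\mid\mathrm{Hom}(X,\mathscr{D}^{t<0})=0\}$, $\mathscr{C}_{w\le0}=\{X\in\mathscr{C}\mid\mathrm{Hom}(X,\mathscr{D}^{t>0})=0\}$,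 $\mathscr{D}^{t<0}=\{Y\in\mathscr{D}\mid\mathrm{Hom}(\mathscr{C}_{w\ge0},Y)=0\}$ and $\mathscr{D}^{t>0}=\{Y\in\mathscr{D}\mid\mathrm{Hom}(\mathscr{C}_{w\le0},Y)=0\}$. An object $P$ is derived projective (w.r.t. $t$) if $P\in\mathscr{D}^{t\le0}$ and $\mathrm{Hom}(P,X[1])=0$ for all $X\in\mathscr{D}^{t\le0}$. A derived projective cover of $X$ is a morphism $\pi\colon P\to X$ with $P$ derived projective and $H^0_t(\pi)$ a projective cover of $H^0_t(X)$ in $\heartsuit_t$; one also calls the object $P$ the derived projective cover. *)

theory Defs
  imports "HOL-Algebra.Module"
begin

section \<open>Linear categories\<close>

text \<open>
  Each morphism space is a module record, of which the fields \<open>mult\<close> and \<open>one\<close> are never used.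
  The morphism spaces need not be disjoint: a morphism is always considered together with an
  explicitly given source and target.
\<close>

record ('k, 'o, 'm) lin_cat =
  Obj :: "'o set"
  HomMod :: "'o \<Rightarrow> 'o \<Rightarrow> ('k, 'm) module"
  ide :: "'o \<Rightarrow> 'm"
  comp :: "'m \<Rightarrow> 'm \<Rightarrow> 'm" (infixl \<open>\<cdot>\<index>\<close> 70)

definition Hom :: "('k, 'o, 'm, 'z) lin_cat_scheme \<Rightarrow> 'o \<Rightarrow> 'o \<Rightarrow> 'm set" where
  "Hom C X Y = carrier (HomMod C X Y)"

locale linear_category =
  fixes K :: "('k, 'r) ring_scheme" and C :: "('k, 'o, 'm, 'z) lin_cat_scheme" (structure)
  assumes field_K: "field K"
    and module_Hom: "\<lbrakk>X \<in> Obj C; Y \<in> Obj C\<rbrakk> \<Longrightarrow> module K (HomMod C X Y)"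
    and ide_Hom: "X \<in> Obj C \<Longrightarrow> ide C X \<in> Hom C X X"
    and comp_Hom: "\<lbrakk>X \<in> Obj C; Y \<in> Obj C; Z \<in> Obj C; f \<in> Hom C X Y; g \<in> Hom C Y Z\<rbrakk>
      \<Longrightarrow> g \<cdot> f \<in> Hom C X Z"
    and ide_left: "\<lbrakk>X \<in> Obj C; Y \<in> Obj C; f \<in> Hom C X Y\<rbrakk> \<Longrightarrow> ide C Y \<cdot> f = f"
    and ide_right: "\<lbrakk>X \<in> Obj C; Y \<in> Obj C; f \<in> Hom C X Y\<rbrakk> \<Longrightarrow> f \<cdot> ide C X = f"
    and comp_assoc:
      "\<lbrakk>W \<in> Obj C; X \<in> Obj C; Y \<in> Obj C; Z \<in> Obj C; f \<in> Hom C W X; g \<in> Hom C X Y; h \<in> Hom C Y Z\<rbrakk>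
      \<Longrightarrow> (h \<cdot> g) \<cdot> f = h \<cdot> (g \<cdot> f)"
    and comp_add_left:
      "\<lbrakk>X \<in> Obj C; Y \<in> Obj C; Z \<in> Obj C; f \<in> Hom C X Y; g \<in> Hom C Y Z; g' \<in> Hom C Y Z\<rbrakk>
      \<Longrightarrow> (g \<oplus>\<^bsub>HomMod C Y Z\<^esub> g') \<cdot> f = g \<cdot> f \<oplus>\<^bsub>HomMod C X Z\<^esub> g' \<cdot> f"
    and comp_add_right:
      "\<lbrakk>X \<in> Obj C; Y \<in> Obj C; Z \<in> Obj C; f \<in> Hom C X Y; f' \<in> Hom C X Y; g \<in> Hom C Y Z\<rbrakk>
      \<Longrightarrow> g \<cdot> (f \<oplus>\<^bsub>HomMod C X Y\<^esub> f') = g \<cdot> f \<oplus>\<^bsub>HomMod C X Z\<^esub> g \<cdot> f'"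
    and comp_smult_left:
      "\<lbrakk>X \<in> Obj C; Y \<in> Obj C; Z \<in> Obj C; f \<in> Hom C X Y; g \<in> Hom C Y Z; r \<in> carrier K\<rbrakk>
      \<Longrightarrow> (r \<odot>\<^bsub>HomMod C Y Z\<^esub> g) \<cdot> f = r \<odot>\<^bsub>HomMod C X Z\<^esub> (g \<cdot> f)"
    and comp_smult_right:
      "\<lbrakk>X \<in> Obj C; Y \<in> Obj C; Z \<in> Obj C; f \<in> Hom C X Y; g \<in> Hom C Y Z; r \<in> carrier K\<rbrakk>
      \<Longrightarrow> g \<cdot> (r \<odot>\<^bsub>HomMod C X Y\<^esub> f) = r \<odot>\<^bsub>HomMod C X Z\<^esub> (g \<cdot> f)"

context
  fixes C :: "('k, 'o, 'm, 'z) lin_cat_scheme" (structure)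
begin

definition full_subcat :: "'o set \<Rightarrow> ('k, 'o, 'm, 'z) lin_cat_scheme" where
  "full_subcat S = C\<lparr>Obj := S\<rparr>"

definition iso_mor :: "'o \<Rightarrow> 'o \<Rightarrow> 'm \<Rightarrow> bool" where
  "iso_mor X Y f \<longleftrightarrow> X \<in> Obj C \<and> Y \<in> Obj C \<and> f \<in> Hom C X Y \<and>
     (\<exists>g\<in>Hom C Y X. g \<cdot> f = ide C X \<and> f \<cdot> g = ide C Y)"

definition isomorphic :: "'o \<Rightarrow> 'o \<Rightarrow> bool" where
  "isomorphic X Y \<longleftrightarrow> (\<exists>f. iso_mor X Y f)"

definition zero_obj :: "'o \<Rightarrow> bool" where
  "zero_obj X \<longleftrightarrow> X \<in> Obj C \<and> ide C X = \<zero>\<^bsub>HomMod C X X\<^esub>"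

definition Hom_zero :: "'o \<Rightarrow> 'o \<Rightarrow> bool" where
  "Hom_zero X Y \<longleftrightarrow> Hom C X Y = {\<zero>\<^bsub>HomMod C X Y\<^esub>}"

definition orthogonal :: "'o set \<Rightarrow> 'o set \<Rightarrow> bool" where
  "orthogonal A B \<longleftrightarrow> (\<forall>X\<in>A. \<forall>Y\<in>B. Hom_zero X Y)"

definition coproduct :: "'o list \<Rightarrow> 'o \<Rightarrow> bool" where
  "coproduct Xs Y \<longleftrightarrow> set Xs \<subseteq> Obj C \<and> Y \<in> Obj C \<and>
     (\<exists>\<iota>. (\<forall>j<length Xs. \<iota> j \<in> Hom C (Xs ! j) Y) \<and>
        (\<forall>Z\<in>Obj C. \<forall>f. (\<forall>j<length Xs. f j \<in> Hom C (Xs ! j) Z) \<longrightarrow>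
           (\<exists>!g. g \<in> Hom C Y Z \<and> (\<forall>j<length Xs. g \<cdot> \<iota> j = f j))))"

definition has_finite_coproducts :: bool where
  "has_finite_coproducts \<longleftrightarrow> (\<forall>Xs. set Xs \<subseteq> Obj C \<longrightarrow> (\<exists>Y. coproduct Xs Y))"

definition direct_summand :: "'o \<Rightarrow> 'o \<Rightarrow> bool" where
  "direct_summand X Y \<longleftrightarrow> (\<exists>X'. coproduct [X, X'] Y)"

definition summand_closure :: "'o set \<Rightarrow> 'o set" where
  "summand_closure S = {X. \<exists>Y\<in>S. direct_summand X Y}"

definition summands_of_coproducts :: "'o set \<Rightarrow> 'o set" where
  "summands_of_coproducts P = summand_closure {Y. \<exists>Xs. set Xs \<subseteq> P \<and> coproduct Xs Y}"

definition indecomposable :: "'o \<Rightarrow> bool" where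
  "indecomposable X \<longleftrightarrow> X \<in> Obj C \<and> \<not> zero_obj X \<and>
     (\<forall>A B. coproduct [A, B] X \<longrightarrow> zero_obj A \<or> zero_obj B)"

definition End_ring :: "'o \<Rightarrow> 'm ring" where
  "End_ring X = \<lparr>carrier = Hom C X X, monoid.mult = (\<cdot>), one = ide C X,
     zero = \<zero>\<^bsub>HomMod C X X\<^esub>, add = add (HomMod C X X)\<rparr>"

definition epi :: "'o \<Rightarrow> 'o \<Rightarrow> 'm \<Rightarrow> bool" where
  "epi X Y f \<longleftrightarrow> f \<in> Hom C X Y \<and>
     (\<forall>Z\<in>Obj C. \<forall>g\<in>Hom C Y Z. \<forall>h\<in>Hom C Y Z. g \<cdot> f = h \<cdot> f \<longrightarrow> g = h)"

definition projective :: "'o \<Rightarrow> bool" where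
  "projective Q \<longleftrightarrow> Q \<in> Obj C \<and>
     (\<forall>X\<in>Obj C. \<forall>Y\<in>Obj C. \<forall>e f. epi X Y e \<and> f \<in> Hom C Q Y \<longrightarrow> (\<exists>g\<in>Hom C Q X. e \<cdot> g = f))"

text \<open>A projective cover is an essential (superfluous) epimorphism from a projective object.\<close>

definition projective_cover :: "'o \<Rightarrow> 'o \<Rightarrow> 'm \<Rightarrow> bool" where
  "projective_cover Q M p \<longleftrightarrow> projective Q \<and> M \<in> Obj C \<and> epi Q M p \<and>
     (\<forall>N\<in>Obj C. \<forall>g\<in>Hom C N Q. epi N M (p \<cdot> g) \<longrightarrow> epi N Q g)"

end

locale additive_category = linear_category +
  assumes finite_coproducts: "has_finite_coproducts C"

definition division_ring :: "('a, 'b) ring_scheme \<Rightarrow> bool" where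
  "division_ring R \<longleftrightarrow> ring R \<and> \<one>\<^bsub>R\<^esub> \<noteq> \<zero>\<^bsub>R\<^esub> \<and> Units R = carrier R - {\<zero>\<^bsub>R\<^esub>}"

definition local_ring :: "('a, 'b) ring_scheme \<Rightarrow> bool" where
  "local_ring R \<longleftrightarrow> ring R \<and> \<one>\<^bsub>R\<^esub> \<noteq> \<zero>\<^bsub>R\<^esub> \<and>
     (\<forall>a\<in>carrier R - Units R. \<forall>b\<in>carrier R - Units R. a \<oplus>\<^bsub>R\<^esub> b \<notin> Units R)"

definition Krull_Schmidt :: "('k, 'o, 'm, 'z) lin_cat_scheme \<Rightarrow> bool" where
  "Krull_Schmidt C \<longleftrightarrow> has_finite_coproducts C \<and>
     (\<forall>X\<in>Obj C. \<exists>Xs. (\<forall>Y\<in>set Xs. local_ring (End_ring C Y)) \<and> coproduct C Xs X)"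

text \<open>
  The library's locale \<open>module\<close> only covers commutative base rings; the following is an isomorphism
  of left modules over an arbitrary ring.
\<close>

definition left_module_iso ::
    "('r, 'c) ring_scheme \<Rightarrow> ('r, 'a) module \<Rightarrow> ('r, 'b) module \<Rightarrow> ('a \<Rightarrow> 'b) \<Rightarrow> bool" where
  "left_module_iso R M N h \<longleftrightarrow> bij_betw h (carrier M) (carrier N) \<and>
     (\<forall>x\<in>carrier M. \<forall>y\<in>carrier M. h (x \<oplus>\<^bsub>M\<^esub> y) = h x \<oplus>\<^bsub>N\<^esub> h y) \<and>
     (\<forall>r\<in>carrier R. \<forall>x\<in>carrier M. h (r \<odot>\<^bsub>M\<^esub> x) = r \<odot>\<^bsub>N\<^esub> h x)"

definition regular_left_module :: "'a ring \<Rightarrow> ('a, 'a) module" where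
  "regular_left_module R = \<lparr>carrier = carrier R, monoid.mult = monoid.mult R, one = one R,
     zero = zero R, add = add R, smult = monoid.mult R\<rparr>"


section \<open>Triangulated categories\<close>

text \<open>
  The shift is a strict action of the integers, i.e. the powers of an automorphism of the category.
  A triangle \<open>X \<rightarrow> Y \<rightarrow> Z \<rightarrow> X[1]\<close> is the tuple of its three objects and three morphisms.
\<close>

record ('k, 'o, 'm) tri_cat = "('k, 'o, 'm) lin_cat" +
  shift_obj :: "'o \<Rightarrow> int \<Rightarrow> 'o" (\<open>_\<langle>_\<rangle>\<index>\<close> [1000, 0] 1000)
  shift_mor :: "'m \<Rightarrow> int \<Rightarrow> 'm" (\<open>_\<llangle>_\<rrangle>\<index>\<close> [1000, 0] 1000)
  Tri :: "('o \<times> 'o \<times> 'o \<times> 'm \<times> 'm \<times> 'm) set"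

locale triangulated_category = additive_category K D
  for K :: "('k, 'r) ring_scheme" and D :: "('k, 'o, 'm, 'z) tri_cat_scheme" (structure) +
  assumes shift_obj_closed: "X \<in> Obj D \<Longrightarrow> X\<langle>m\<rangle> \<in> Obj D"
    and shift_obj_0: "X \<in> Obj D \<Longrightarrow> X\<langle>0\<rangle> = X"
    and shift_obj_add: "X \<in> Obj D \<Longrightarrow> X\<langle>m\<rangle>\<langle>n\<rangle> = X\<langle>m + n\<rangle>"
    and shift_mor_closed:
      "\<lbrakk>X \<in> Obj D; Y \<in> Obj D; f \<in> Hom D X Y\<rbrakk> \<Longrightarrow> f\<llangle>m\<rrangle> \<in> Hom D (X\<langle>m\<rangle>) (Y\<langle>m\<rangle>)"
    and shift_mor_0: "\<lbrakk>X \<in> Obj D; Y \<in> Obj D; f \<in> Hom D X Y\<rbrakk> \<Longrightarrow> f\<llangle>0\<rrangle> = f"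
    and shift_mor_add: "\<lbrakk>X \<in> Obj D; Y \<in> Obj D; f \<in> Hom D X Y\<rbrakk> \<Longrightarrow> f\<llangle>m\<rrangle>\<llangle>n\<rrangle> = f\<llangle>m + n\<rrangle>"
    and shift_mor_ide: "X \<in> Obj D \<Longrightarrow> (ide D X)\<llangle>m\<rrangle> = ide D (X\<langle>m\<rangle>)"
    and shift_mor_comp:
      "\<lbrakk>X \<in> Obj D; Y \<in> Obj D; Z \<in> Obj D; f \<in> Hom D X Y; g \<in> Hom D Y Z\<rbrakk>
      \<Longrightarrow> (g \<cdot> f)\<llangle>m\<rrangle> = g\<llangle>m\<rrangle> \<cdot> f\<llangle>m\<rrangle>"
    and shift_mor_plus:
      "\<lbrakk>X \<in> Obj D; Y \<in> Obj D; f \<in> Hom D X Y; g \<in> Hom D X Y\<rbrakk>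
      \<Longrightarrow> (f \<oplus>\<^bsub>HomMod D X Y\<^esub> g)\<llangle>m\<rrangle> = f\<llangle>m\<rrangle> \<oplus>\<^bsub>HomMod D (X\<langle>m\<rangle>) (Y\<langle>m\<rangle>)\<^esub> g\<llangle>m\<rrangle>"
    and shift_mor_smult:
      "\<lbrakk>X \<in> Obj D; Y \<in> Obj D; f \<in> Hom D X Y; r \<in> carrier K\<rbrakk>
      \<Longrightarrow> (r \<odot>\<^bsub>HomMod D X Y\<^esub> f)\<llangle>m\<rrangle> = r \<odot>\<^bsub>HomMod D (X\<langle>m\<rangle>) (Y\<langle>m\<rangle>)\<^esub> f\<llangle>m\<rrangle>"
    and Tri_closed: "(X, Y, Z, f, g, h) \<in> Tri D \<Longrightarrow>
      X \<in> Obj D \<and> Y \<in> Obj D \<and> Z \<in> Obj D \<and>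
      f \<in> Hom D X Y \<and> g \<in> Hom D Y Z \<and> h \<in> Hom D Z (X\<langle>1\<rangle>)"
    and Tri_iso:
      "\<lbrakk>(X, Y, Z, f, g, h) \<in> Tri D;
        iso_mor D X X' a; iso_mor D Y Y' b; iso_mor D Z Z' c;
        f' \<in> Hom D X' Y'; g' \<in> Hom D Y' Z'; h' \<in> Hom D Z' (X'\<langle>1\<rangle>);
        b \<cdot> f = f' \<cdot> a; c \<cdot> g = g' \<cdot> b; a\<llangle>1\<rrangle> \<cdot> h = h' \<cdot> c\<rbrakk>
      \<Longrightarrow> (X', Y', Z', f', g', h') \<in> Tri D"
    and Tri_ide: "\<lbrakk>X \<in> Obj D; zero_obj D Z\<rbrakk>
      \<Longrightarrow> (X, X, Z, ide D X, \<zero>\<^bsub>HomMod D X Z\<^esub>, \<zero>\<^bsub>HomMod D Z (X\<langle>1\<rangle>)\<^esub>) \<in> Tri D"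
    and Tri_cone: "\<lbrakk>X \<in> Obj D; Y \<in> Obj D; f \<in> Hom D X Y\<rbrakk> \<Longrightarrow> \<exists>Z g h. (X, Y, Z, f, g, h) \<in> Tri D"
    and Tri_rotate:
      "\<lbrakk>X \<in> Obj D; Y \<in> Obj D; Z \<in> Obj D; f \<in> Hom D X Y; g \<in> Hom D Y Z; h \<in> Hom D Z (X\<langle>1\<rangle>)\<rbrakk>
      \<Longrightarrow> (X, Y, Z, f, g, h) \<in> Tri D \<longleftrightarrow>
          (Y, Z, X\<langle>1\<rangle>, g, h, \<ominus>\<^bsub>HomMod D (X\<langle>1\<rangle>) (Y\<langle>1\<rangle>)\<^esub> f\<llangle>1\<rrangle>) \<in> Tri D"
    and Tri_morphism:
      "\<lbrakk>(X, Y, Z, f, g, h) \<in> Tri D; (X', Y', Z', f', g', h') \<in> Tri D;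
        a \<in> Hom D X X'; b \<in> Hom D Y Y'; b \<cdot> f = f' \<cdot> a\<rbrakk>
      \<Longrightarrow> \<exists>c\<in>Hom D Z Z'. c \<cdot> g = g' \<cdot> b \<and> a\<llangle>1\<rrangle> \<cdot> h = h' \<cdot> c"
    and octahedral:
      "\<lbrakk>(X, Y, Z', f, f', f'') \<in> Tri D; (Y, Z, X', g, g', g'') \<in> Tri D;
        (X, Z, Y', g \<cdot> f, h', h'') \<in> Tri D\<rbrakk>
      \<Longrightarrow> \<exists>u v. (Z', Y', X', u, v, f'\<llangle>1\<rrangle> \<cdot> g'') \<in> Tri D \<and>
          u \<cdot> f' = h' \<cdot> g \<and> h'' \<cdot> u = f'' \<and> v \<cdot> h' = g' \<and> g'' \<cdot> v = f\<llangle>1\<rrangle> \<cdot> h''"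

context
  fixes D :: "('k, 'o, 'm, 'z) tri_cat_scheme" (structure)
begin

definition shift_set :: "'o set \<Rightarrow> int \<Rightarrow> 'o set" where
  "shift_set A m = (\<lambda>X. X\<langle>m\<rangle>) ` A"

definition iso_closed :: "'o set \<Rightarrow> bool" where
  "iso_closed S \<longleftrightarrow> (\<forall>X\<in>S. \<forall>Y. isomorphic D X Y \<longrightarrow> Y \<in> S)"

definition extension_closed :: "'o set \<Rightarrow> bool" where
  "extension_closed S \<longleftrightarrow> S \<subseteq> Obj D \<and> iso_closed S \<and> {X. zero_obj D X} \<subseteq> S \<and>
     (\<forall>X Y Z f g h. (X, Y, Z, f, g, h) \<in> Tri D \<and> X \<in> S \<and> Z \<in> S \<longrightarrow> Y \<in> S)"

definition extension_closure :: "'o set \<Rightarrow> 'o set" where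
  "extension_closure A = \<Inter> {S. extension_closed S \<and> A \<subseteq> S}"

definition triangulated_subcategory :: "'o set \<Rightarrow> bool" where
  "triangulated_subcategory S \<longleftrightarrow> S \<subseteq> Obj D \<and> iso_closed S \<and> {X. zero_obj D X} \<subseteq> S \<and>
     (\<forall>X\<in>S. \<forall>m. X\<langle>m\<rangle> \<in> S) \<and>
     (\<forall>X Y Z f g h. (X, Y, Z, f, g, h) \<in> Tri D \<and> X \<in> S \<and> Y \<in> S \<longrightarrow> Z \<in> S)"

definition triangulated_closure :: "'o set \<Rightarrow> 'o set" where
  "triangulated_closure A = \<Inter> {S. triangulated_subcategory S \<and> A \<subseteq> S}"

definition thick_subcategory :: "'o set \<Rightarrow> bool" where
  "thick_subcategory S \<longleftrightarrow> triangulated_subcategory S \<and> summand_closure D S \<subseteq> S"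

definition thick :: "'o set \<Rightarrow> 'o set" where
  "thick A = \<Inter> {S. thick_subcategory S \<and> A \<subseteq> S}"


section \<open>t-structures, silting and simple-minded collections\<close>

text \<open>
  A t-structure is given by the pair \<open>t = (D\<^sup>\<le>\<^sup>0, D\<^sup>\<ge>\<^sup>0)\<close>, a weight structure by the pair
  \<open>w = (C\<^sub>\<le>\<^sub>0, C\<^sub>\<ge>\<^sub>0)\<close> of object sets of full subcategories.
\<close>

definition t_less :: "'o set \<times> 'o set \<Rightarrow> 'o set" where
  "t_less t = shift_set (fst t) 1"

definition t_greater :: "'o set \<times> 'o set \<Rightarrow> 'o set" where
  "t_greater t = shift_set (snd t) (-1)"

definition heart :: "'o set \<times> 'o set \<Rightarrow> 'o set" where
  "heart t = fst t \<inter> snd t"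

definition t_structure :: "'o set \<times> 'o set \<Rightarrow> bool" where
  "t_structure t \<longleftrightarrow> fst t \<subseteq> Obj D \<and> snd t \<subseteq> Obj D \<and> iso_closed (fst t) \<and> iso_closed (snd t) \<and>
     shift_set (fst t) 1 \<subseteq> fst t \<and> shift_set (snd t) (-1) \<subseteq> snd t \<and>
     orthogonal D (fst t) (t_greater t) \<and>
     (\<forall>X\<in>Obj D. \<exists>A\<in>fst t. \<exists>B\<in>t_greater t. \<exists>f g h. (A, X, B, f, g, h) \<in> Tri D)"

definition perp_pos :: "'o set \<Rightarrow> 'o set" where
  "perp_pos P = {Y \<in> Obj D. \<forall>X\<in>P. \<forall>m>0. Hom_zero D X (Y\<langle>m\<rangle>)}"

definition perp_neg :: "'o set \<Rightarrow> 'o set" where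
  "perp_neg P = {Y \<in> Obj D. \<forall>X\<in>P. \<forall>m<0. Hom_zero D X (Y\<langle>m\<rangle>)}"

definition silting_t_structure :: "'o set \<Rightarrow> 'o set \<times> 'o set" where
  "silting_t_structure P = (perp_pos P, perp_neg P)"

definition silting_collection :: "'o set \<Rightarrow> bool" where
  "silting_collection P \<longleftrightarrow> (\<forall>X\<in>P. indecomposable D X) \<and>
     (\<forall>X\<in>P. \<forall>Y\<in>P. X \<noteq> Y \<longrightarrow> \<not> isomorphic D X Y) \<and>
     Krull_Schmidt (full_subcat D (summands_of_coproducts D P)) \<and>
     t_structure (silting_t_structure P)"

definition silting_weight_structure :: "'o set \<Rightarrow> 'o set \<times> 'o set" where
  "silting_weight_structure P =
     (summand_closure D (extension_closure {X\<langle>m\<rangle> | X m. X \<in> P \<and> m \<ge> 0}),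
      summand_closure D (extension_closure {X\<langle>m\<rangle> | X m. X \<in> P \<and> m \<le> 0}))"

definition simple_minded_collection :: "'o set \<Rightarrow> bool" where
  "simple_minded_collection \<L> \<longleftrightarrow> \<L> \<subseteq> Obj D \<and>
     (\<forall>L\<in>\<L>. \<forall>L'\<in>\<L>. \<forall>m<0. Hom_zero D L (L'\<langle>m\<rangle>)) \<and>
     (\<forall>L\<in>\<L>. \<forall>L'\<in>\<L>. L \<noteq> L' \<longrightarrow> Hom_zero D L L') \<and>
     (\<forall>L\<in>\<L>. division_ring (End_ring D L)) \<and>
     triangulated_closure \<L> = Obj D"

definition simple_minded_t_structure :: "'o set \<Rightarrow> 'o set \<times> 'o set" where
  "simple_minded_t_structure \<L> =
     (extension_closure {L\<langle>m\<rangle> | L m. L \<in> \<L> \<and> m \<ge> 0},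
      extension_closure {L\<langle>m\<rangle> | L m. L \<in> \<L> \<and> m \<le> 0})"

definition left_orthogonal :: "'o set \<times> 'o set \<Rightarrow> 'o set \<times> 'o set \<Rightarrow> bool" where
  "left_orthogonal w t \<longleftrightarrow> orthogonal D (snd w) (t_less t) \<and> orthogonal D (fst w) (t_greater t)"

text \<open>The set \<open>C\<close> is the object set of the subcategory carrying the weight structure \<open>w\<close>.\<close>

definition strictly_left_orthogonal ::
    "'o set \<Rightarrow> 'o set \<times> 'o set \<Rightarrow> 'o set \<times> 'o set \<Rightarrow> bool" where
  "strictly_left_orthogonal C w t \<longleftrightarrow> left_orthogonal w t \<and>
     snd w = {X \<in> C. \<forall>Y\<in>t_less t. Hom_zero D X Y} \<and>
     fst w = {X \<in> C. \<forall>Y\<in>t_greater t. Hom_zero D X Y} \<and>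
     t_less t = {Y \<in> Obj D. \<forall>X\<in>snd w. Hom_zero D X Y} \<and>
     t_greater t = {Y \<in> Obj D. \<forall>X\<in>fst w. Hom_zero D X Y}"


section \<open>Truncation, cohomology and derived projective covers\<close>

text \<open>
  Truncations are chosen together with their (co)unit morphisms; the action on morphisms is the
  unique one making these natural.
\<close>

definition trunc_le :: "'o set \<times> 'o set \<Rightarrow> 'o \<Rightarrow> 'o \<times> 'm" where
  "trunc_le t X = (SOME (A, a). A \<in> fst t \<and>
     (\<exists>B\<in>t_greater t. \<exists>b c. (A, X, B, a, b, c) \<in> Tri D))"

definition trunc_le_mor :: "'o set \<times> 'o set \<Rightarrow> 'o \<Rightarrow> 'o \<Rightarrow> 'm \<Rightarrow> 'm" where
  "trunc_le_mor t X Y f = (THE g. g \<in> Hom D (fst (trunc_le t X)) (fst (trunc_le t Y)) \<and>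
     snd (trunc_le t Y) \<cdot> g = f \<cdot> snd (trunc_le t X))"

definition trunc_ge :: "'o set \<times> 'o set \<Rightarrow> 'o \<Rightarrow> 'o \<times> 'm" where
  "trunc_ge t X = (SOME (B, b). B \<in> snd t \<and>
     (\<exists>A\<in>t_less t. \<exists>a c. (A, X, B, a, b, c) \<in> Tri D))"

definition trunc_ge_mor :: "'o set \<times> 'o set \<Rightarrow> 'o \<Rightarrow> 'o \<Rightarrow> 'm \<Rightarrow> 'm" where
  "trunc_ge_mor t X Y f = (THE g. g \<in> Hom D (fst (trunc_ge t X)) (fst (trunc_ge t Y)) \<and>
     g \<cdot> snd (trunc_ge t X) = snd (trunc_ge t Y) \<cdot> f)"

definition H0 :: "'o set \<times> 'o set \<Rightarrow> 'o \<Rightarrow> 'o" where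
  "H0 t X = fst (trunc_ge t (fst (trunc_le t X)))"

definition H0_mor :: "'o set \<times> 'o set \<Rightarrow> 'o \<Rightarrow> 'o \<Rightarrow> 'm \<Rightarrow> 'm" where
  "H0_mor t X Y f =
     trunc_ge_mor t (fst (trunc_le t X)) (fst (trunc_le t Y)) (trunc_le_mor t X Y f)"

definition derived_projective :: "'o set \<times> 'o set \<Rightarrow> 'o \<Rightarrow> bool" where
  "derived_projective t P \<longleftrightarrow> P \<in> fst t \<and> (\<forall>X\<in>fst t. Hom_zero D P (X\<langle>1\<rangle>))"

definition derived_projective_cover :: "'o set \<times> 'o set \<Rightarrow> 'o \<Rightarrow> 'o \<Rightarrow> 'm \<Rightarrow> bool" where
  "derived_projective_cover t P X p \<longleftrightarrow> X \<in> Obj D \<and> p \<in> Hom D P X \<and> derived_projective t P \<and>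
     projective_cover (full_subcat D (heart t)) (H0 t P) (H0 t X) (H0_mor t P X p)"

text \<open>
  \<open>Hom(P, L[m])\<close> as a left module over \<open>End(L)\<close>: an endomorphism \<open>e\<close> acts by postcomposition with
  \<open>e[m]\<close>.
\<close>

definition Hom_left_module :: "'o \<Rightarrow> 'o \<Rightarrow> int \<Rightarrow> ('m, 'm) module" where
  "Hom_left_module P L m = \<lparr>carrier = Hom D P (L\<langle>m\<rangle>), monoid.mult = undefined, one = undefined,
     zero = \<zero>\<^bsub>HomMod D P (L\<langle>m\<rangle>)\<^esub>, add = add (HomMod D P (L\<langle>m\<rangle>)), smult = (\<lambda>e f. e\<llangle>m\<rrangle> \<cdot> f)\<rparr>"

end

end

theory Submission
  imports Defs
begin

text \<open>
  The weight structure is left orthogonal to \<open>t\<close> if and only if both halves of \<open>t\<close> are contained in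
  those of the silting t-structure, and two t-structures contained in each other are equal. Any
  derived projective covers, or the vanishing of \<open>Hom(P, L[m])\<close> for \<open>m \<noteq> 0\<close>, give these inclusions by
  devissage. Strictness follows because a member of the thick closure is a retract of an iterated
  extension of shifts of \<open>P\<close>, which has a weight decomposition.

  Conversely let \<open>t\<close> be the silting t-structure. The fibre of a nonzero morphism from an object of
  \<open>D\<^sup>\<le>\<^sup>0\<close> to a simple object \<open>L\<close> again lies in \<open>D\<^sup>\<le>\<^sup>0\<close>, so morphisms from an object of the silting
  collection lift along it. Since endomorphism rings in the silting collection are local, every \<open>P\<close>
  has nonzero morphisms to exactly one \<open>L\<close>, and these form a free \<open>End(L)\<close>-module of rank one.
  The same lifting argument shows that such a morphism induces an essential epimorphism on \<open>H\<^sup>0\<close>.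
\<close>

section \<open>Linear categories\<close>

text \<open>That \<open>t\<close> is a t-structure is itself something to prove: the shifts of
  \<open>\<L>\<close> generate all objects by extensions in no particular order, and the truncation
  triangle of an object appears when such a filtration is sorted by degree. The same sorting,
  applied to shifts of \<open>\<P>\<close>, yields weight decompositions. The heart is never treated
  as an abelian category: epimorphisms and projectivity in it are handled through cones and their
  truncations. Locality of endomorphism rings enters through one principle. If
  \<open>f \<cdot> e = f\<close> for a nonzero \<open>f\<close> out of a member of
  \<open>\<P>\<close>, then \<open>f\<close> kills \<open>1 - e\<close>, so \<open>1 - e\<close> is
  not invertible and therefore \<open>e\<close> is. This takes the place of the usual minimality
  arguments for projective covers in a finite-length abelian category. Locality has to be extracted
  first, since the Krull-Schmidt property only provides some decomposition of each object.\<close>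

lemma additive_map:
  assumes G: "abelian_group G" and H: "abelian_group H"
    and closed: "\<And>x. x \<in> carrier G \<Longrightarrow> \<phi> x \<in> carrier H"
    and add: "\<And>x y. x \<in> carrier G \<Longrightarrow> y \<in> carrier G \<Longrightarrow> \<phi> (x \<oplus>\<^bsub>G\<^esub> y) = \<phi> x \<oplus>\<^bsub>H\<^esub> \<phi> y"
  shows "\<phi> \<zero>\<^bsub>G\<^esub> = \<zero>\<^bsub>H\<^esub>"
    and "x \<in> carrier G \<Longrightarrow> \<phi> (\<ominus>\<^bsub>G\<^esub> x) = \<ominus>\<^bsub>H\<^esub> \<phi> x"
    and "x \<in> carrier G \<Longrightarrow> y \<in> carrier G \<Longrightarrow> \<phi> (x \<ominus>\<^bsub>G\<^esub> y) = \<phi> x \<ominus>\<^bsub>H\<^esub> \<phi> y"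
proof -
  interpret G: abelian_group G by fact
  interpret H: abelian_group H by fact
  have "\<phi> \<zero>\<^bsub>G\<^esub> \<oplus>\<^bsub>H\<^esub> \<phi> \<zero>\<^bsub>G\<^esub> = \<phi> \<zero>\<^bsub>G\<^esub>"
    using add[of "\<zero>\<^bsub>G\<^esub>" "\<zero>\<^bsub>G\<^esub>"] by simp
  then show z: "\<phi> \<zero>\<^bsub>G\<^esub> = \<zero>\<^bsub>H\<^esub>"
    using closed[of "\<zero>\<^bsub>G\<^esub>"] by (metis G.zero_closed H.add.l_cancel_one)
  have n: "\<phi> (\<ominus>\<^bsub>G\<^esub> x) = \<ominus>\<^bsub>H\<^esub> \<phi> x" if "x \<in> carrier G" for x
    using add[of "\<ominus>\<^bsub>G\<^esub> x" x] that z closed by (metis G.a_inv_closed G.l_neg H.minus_equality)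
  then show "x \<in> carrier G \<Longrightarrow> \<phi> (\<ominus>\<^bsub>G\<^esub> x) = \<ominus>\<^bsub>H\<^esub> \<phi> x" .
  show "x \<in> carrier G \<Longrightarrow> y \<in> carrier G \<Longrightarrow> \<phi> (x \<ominus>\<^bsub>G\<^esub> y) = \<phi> x \<ominus>\<^bsub>H\<^esub> \<phi> y"
    unfolding a_minus_def using add n by simp
qed

context linear_category
begin

text \<open>Morphism spaces may overlap, so source and target must accompany every morphism.
  Bundling them with object membership lets the axioms be chained by \<open>OF\<close> without side
  conditions.\<close>

definition arr :: "'m \<Rightarrow> 'o \<Rightarrow> 'o \<Rightarrow> bool" where
  "arr f X Y \<longleftrightarrow> X \<in> Obj C \<and> Y \<in> Obj C \<and> f \<in> Hom C X Y"

abbreviation zero_mor :: "'o \<Rightarrow> 'o \<Rightarrow> 'm" where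
  "zero_mor X Y \<equiv> \<zero>\<^bsub>HomMod C X Y\<^esub>"

abbreviation diff :: "'o \<Rightarrow> 'o \<Rightarrow> 'm \<Rightarrow> 'm \<Rightarrow> 'm" where
  "diff X Y f g \<equiv> f \<ominus>\<^bsub>HomMod C X Y\<^esub> g"

abbreviation neg :: "'o \<Rightarrow> 'o \<Rightarrow> 'm \<Rightarrow> 'm" where
  "neg X Y f \<equiv> \<ominus>\<^bsub>HomMod C X Y\<^esub> f"

abbreviation plus_mor :: "'o \<Rightarrow> 'o \<Rightarrow> 'm \<Rightarrow> 'm \<Rightarrow> 'm" where
  "plus_mor X Y f g \<equiv> f \<oplus>\<^bsub>HomMod C X Y\<^esub> g"

lemma arrD: "arr f X Y \<Longrightarrow> X \<in> Obj C" "arr f X Y \<Longrightarrow> Y \<in> Obj C" "arr f X Y \<Longrightarrow> f \<in> Hom C X Y"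
  by (auto simp: arr_def)

lemma Hom_abelian_group:
  assumes "X \<in> Obj C" "Y \<in> Obj C"
  shows "abelian_group (HomMod C X Y)"
  using module_Hom[OF assms] by (simp add: module_def)

lemma arr_comp: "arr f X Y \<Longrightarrow> arr g Y Z \<Longrightarrow> arr (g \<cdot> f) X Z"
  unfolding arr_def using comp_Hom by blast

lemma arr_ide: "X \<in> Obj C \<Longrightarrow> arr (ide C X) X X"
  unfolding arr_def using ide_Hom by blast

lemma arr_zero:
  assumes "X \<in> Obj C" "Y \<in> Obj C"
  shows "arr (zero_mor X Y) X Y"
proof -
  interpret abelian_group "HomMod C X Y" using Hom_abelian_group assms arrD by metis
  show ?thesis using assms unfolding arr_def Hom_def by simp
qed

lemma arr_neg:
  assumes "arr f X Y"
  shows "arr (neg X Y f) X Y"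
proof -
  interpret abelian_group "HomMod C X Y" using Hom_abelian_group assms arrD by metis
  show ?thesis using assms unfolding arr_def Hom_def by simp
qed

lemma arr_diff:
  assumes "arr f X Y" "arr g X Y"
  shows "arr (diff X Y f g) X Y"
proof -
  interpret abelian_group "HomMod C X Y" using Hom_abelian_group assms arrD by metis
  show ?thesis using assms unfolding arr_def Hom_def by simp
qed

lemma arr_plus:
  assumes "arr f X Y" "arr g X Y"
  shows "arr (plus_mor X Y f g) X Y"
proof -
  interpret abelian_group "HomMod C X Y" using Hom_abelian_group assms arrD by metis
  show ?thesis using assms unfolding arr_def Hom_def by simp
qed

lemma assoc: "arr f W X \<Longrightarrow> arr g X Y \<Longrightarrow> arr h Y Z \<Longrightarrow> (h \<cdot> g) \<cdot> f = h \<cdot> (g \<cdot> f)"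
  unfolding arr_def using comp_assoc by blast

lemma assoc4:
  assumes "arr f V W" "arr g W X" "arr h X Y" "arr k Y Z"
  shows "(k \<cdot> h) \<cdot> (g \<cdot> f) = k \<cdot> ((h \<cdot> g) \<cdot> f)"
  using assoc[OF arr_comp[OF assms(1,2)] assms(3,4)] assoc[OF assms(1-3)] by simp

lemma id_left: "arr f X Y \<Longrightarrow> ide C Y \<cdot> f = f"
  unfolding arr_def using ide_left by blast

lemma id_right: "arr f X Y \<Longrightarrow> f \<cdot> ide C X = f"
  unfolding arr_def using ide_right by blast

lemma diff_zero_iff:
  assumes "arr f X Y" "arr g X Y"
  shows "diff X Y f g = zero_mor X Y \<longleftrightarrow> f = g"
proof -
  interpret abelian_group "HomMod C X Y" using Hom_abelian_group assms arrD by blast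
  show ?thesis using assms unfolding arr_def Hom_def by (metis a_minus_def a_inv_closed minus_equality minus_minus r_neg)
qed

lemma plus_zero:
  assumes "arr f X Y"
  shows "plus_mor X Y f (zero_mor X Y) = f" "plus_mor X Y (zero_mor X Y) f = f"
proof -
  interpret abelian_group "HomMod C X Y" using Hom_abelian_group assms arrD by blast
  show "plus_mor X Y f (zero_mor X Y) = f" "plus_mor X Y (zero_mor X Y) f = f"
    using assms unfolding arr_def Hom_def by auto
qed

lemma diff_zero:
  assumes "arr f X Y"
  shows "diff X Y f (zero_mor X Y) = f"
proof -
  interpret abelian_group "HomMod C X Y" using Hom_abelian_group assms arrD by blast
  show ?thesis using assms unfolding arr_def Hom_def a_minus_def by auto
qed

lemma plus_diff:
  assumes "arr f X Y" "arr g X Y"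
  shows "plus_mor X Y f (diff X Y g f) = g"
proof -
  interpret abelian_group "HomMod C X Y" using Hom_abelian_group assms arrD by blast
  show ?thesis using assms unfolding arr_def Hom_def a_minus_def
    by (metis a_assoc a_comm a_inv_closed r_neg r_zero)
qed

lemma diff_diff:
  assumes "arr f X Y" "arr g X Y"
  shows "diff X Y f (diff X Y f g) = g"
proof -
  interpret abelian_group "HomMod C X Y" using Hom_abelian_group assms arrD by blast
  have *: "f \<in> carrier (HomMod C X Y)" "g \<in> carrier (HomMod C X Y)"
    using assms unfolding arr_def Hom_def by auto
  then have "diff X Y f (diff X Y f g) = plus_mor X Y f (plus_mor X Y (neg X Y f) g)"
    by (simp add: a_minus_def minus_add)
  then show ?thesis using * r_neg2 by simp
qed

lemma neg_neg:
  assumes "arr f X Y"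
  shows "neg X Y (neg X Y f) = f"
proof -
  interpret abelian_group "HomMod C X Y" using Hom_abelian_group assms arrD by metis
  show ?thesis using assms unfolding arr_def Hom_def by simp
qed

lemma neg_zero:
  assumes "X \<in> Obj C" "Y \<in> Obj C"
  shows "neg X Y (zero_mor X Y) = zero_mor X Y"
proof -
  interpret abelian_group "HomMod C X Y" using Hom_abelian_group assms arrD by metis
  show ?thesis using assms unfolding arr_def Hom_def by simp
qed

lemma plus_comp:
  "arr f X Y \<Longrightarrow> arr g Y Z \<Longrightarrow> arr g' Y Z \<Longrightarrow>
     plus_mor Y Z g g' \<cdot> f = plus_mor X Z (g \<cdot> f) (g' \<cdot> f)"
  unfolding arr_def using comp_add_left by blast

lemma
  assumes "arr f X Y" "Z \<in> Obj C"
  shows zero_comp: "zero_mor Y Z \<cdot> f = zero_mor X Z"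
    and neg_comp: "arr g Y Z \<Longrightarrow> neg Y Z g \<cdot> f = neg X Z (g \<cdot> f)"
    and diff_comp: "arr g Y Z \<Longrightarrow> arr g' Y Z \<Longrightarrow> diff Y Z g g' \<cdot> f = diff X Z (g \<cdot> f) (g' \<cdot> f)"
proof -
  have o: "X \<in> Obj C" "Y \<in> Obj C" using assms arrD by blast+
  have *: "\<And>x. x \<in> carrier (HomMod C Y Z) \<Longrightarrow> x \<cdot> f \<in> carrier (HomMod C X Z)"
    "\<And>x y. x \<in> carrier (HomMod C Y Z) \<Longrightarrow> y \<in> carrier (HomMod C Y Z) \<Longrightarrow>
      plus_mor Y Z x y \<cdot> f = plus_mor X Z (x \<cdot> f) (y \<cdot> f)"
    using comp_Hom comp_add_left assms unfolding arr_def Hom_def by blast+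
  note m = additive_map[OF Hom_abelian_group[OF o(2) assms(2)] Hom_abelian_group[OF o(1) assms(2)],
      of "\<lambda>x. x \<cdot> f", OF *]
  show "zero_mor Y Z \<cdot> f = zero_mor X Z" by (rule m(1))
  show "arr g Y Z \<Longrightarrow> neg Y Z g \<cdot> f = neg X Z (g \<cdot> f)"
    by (rule m(2)) (auto simp: arr_def Hom_def)
  show "arr g Y Z \<Longrightarrow> arr g' Y Z \<Longrightarrow> diff Y Z g g' \<cdot> f = diff X Z (g \<cdot> f) (g' \<cdot> f)"
    by (rule m(3)) (auto simp: arr_def Hom_def)
qed

lemma
  assumes "arr g Y Z" "X \<in> Obj C"
  shows comp_zero: "g \<cdot> zero_mor X Y = zero_mor X Z"
    and comp_neg: "arr f X Y \<Longrightarrow> g \<cdot> neg X Y f = neg X Z (g \<cdot> f)"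
    and comp_diff: "arr f X Y \<Longrightarrow> arr f' X Y \<Longrightarrow> g \<cdot> diff X Y f f' = diff X Z (g \<cdot> f) (g \<cdot> f')"
proof -
  have o: "Y \<in> Obj C" "Z \<in> Obj C" using assms arrD by blast+
  have *: "\<And>x. x \<in> carrier (HomMod C X Y) \<Longrightarrow> g \<cdot> x \<in> carrier (HomMod C X Z)"
    "\<And>x y. x \<in> carrier (HomMod C X Y) \<Longrightarrow> y \<in> carrier (HomMod C X Y) \<Longrightarrow>
      g \<cdot> plus_mor X Y x y = plus_mor X Z (g \<cdot> x) (g \<cdot> y)"
    using comp_Hom comp_add_right assms unfolding arr_def Hom_def by blast+
  note m = additive_map[OF Hom_abelian_group[OF assms(2) o(1)] Hom_abelian_group[OF assms(2) o(2)],
      of "\<lambda>x. g \<cdot> x", OF *]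
  show "g \<cdot> zero_mor X Y = zero_mor X Z" by (rule m(1))
  show "arr f X Y \<Longrightarrow> g \<cdot> neg X Y f = neg X Z (g \<cdot> f)"
    by (rule m(2)) (auto simp: arr_def Hom_def)
  show "arr f X Y \<Longrightarrow> arr f' X Y \<Longrightarrow> g \<cdot> diff X Y f f' = diff X Z (g \<cdot> f) (g \<cdot> f')"
    by (rule m(3)) (auto simp: arr_def Hom_def)
qed

section \<open>Zero objects, isomorphisms, and epimorphisms of full subcategories\<close>

lemma zero_obj_to: "zero_obj C Z \<Longrightarrow> arr f X Z \<Longrightarrow> f = zero_mor X Z"
  unfolding zero_obj_def using id_left zero_comp by metis

lemma zero_obj_from: "zero_obj C Z \<Longrightarrow> arr f Z X \<Longrightarrow> f = zero_mor Z X"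
  unfolding zero_obj_def using id_right comp_zero by metis

lemma zero_obj_Obj: "zero_obj C Z \<Longrightarrow> Z \<in> Obj C"
  by (simp add: zero_obj_def)

lemma Hom_zero_iff:
  assumes "X \<in> Obj C" "Y \<in> Obj C"
  shows "Hom_zero C X Y \<longleftrightarrow> (\<forall>f. arr f X Y \<longrightarrow> f = zero_mor X Y)"
  using arr_zero[OF assms] assms unfolding Hom_zero_def arr_def by blast

lemma Hom_zeroD: "Hom_zero C X Y \<Longrightarrow> arr f X Y \<Longrightarrow> f = zero_mor X Y"
  using Hom_zero_iff arrD by blast

lemma iso_mor_iff:
  "iso_mor C X Y f \<longleftrightarrow> arr f X Y \<and> (\<exists>g. arr g Y X \<and> g \<cdot> f = ide C X \<and> f \<cdot> g = ide C Y)"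
  unfolding iso_mor_def arr_def by blast

lemma iso_mor_inverse:
  assumes "iso_mor C X Y f"
  obtains g where "iso_mor C Y X g" "g \<cdot> f = ide C X" "f \<cdot> g = ide C Y"
  using assms unfolding iso_mor_iff by blast

lemma iso_mor_arr: "iso_mor C X Y f \<Longrightarrow> arr f X Y"
  by (simp add: iso_mor_iff)

lemma iso_mor_ide: "X \<in> Obj C \<Longrightarrow> iso_mor C X X (ide C X)"
  unfolding iso_mor_iff using arr_ide id_left by blast

lemma iso_mor_comp:
  assumes "iso_mor C X Y f" "iso_mor C Y Z g"
  shows "iso_mor C X Z (g \<cdot> f)"
proof -
  obtain f' where f': "iso_mor C Y X f'" "f' \<cdot> f = ide C X" "f \<cdot> f' = ide C Y"
    using assms(1) by (rule iso_mor_inverse)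
  obtain g' where g': "iso_mor C Z Y g'" "g' \<cdot> g = ide C Y" "g \<cdot> g' = ide C Z"
    using assms(2) by (rule iso_mor_inverse)
  note a = assms[THEN iso_mor_arr] f'(1)[THEN iso_mor_arr] g'(1)[THEN iso_mor_arr]
  have "(f' \<cdot> g') \<cdot> (g \<cdot> f) = ide C X" "(g \<cdot> f) \<cdot> (f' \<cdot> g') = ide C Z"
    by (simp_all add: assoc4[OF a(1,2,4,3)] assoc4[OF a(4,3,1,2)] f' g' id_left[OF a(1)] id_left[OF a(4)])
  then show ?thesis unfolding iso_mor_iff using arr_comp[OF a(1,2)] arr_comp[OF a(4,3)] by blast
qed

lemma isomorphic_sym: "isomorphic C X Y \<Longrightarrow> isomorphic C Y X"
  unfolding isomorphic_def using iso_mor_inverse by metis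

lemma isomorphic_refl: "X \<in> Obj C \<Longrightarrow> isomorphic C X X"
  unfolding isomorphic_def using iso_mor_ide by metis

lemma isomorphic_Obj: "isomorphic C X Y \<Longrightarrow> X \<in> Obj C \<and> Y \<in> Obj C"
  unfolding isomorphic_def iso_mor_def by blast

lemma zero_obj_if_retract:
  assumes "arr s X Y" "arr r Y X" "r \<cdot> s = ide C X" "zero_obj C Y"
  shows "zero_obj C X"
proof -
  have "X \<in> Obj C" using assms arrD by blast
  then show ?thesis
    using zero_obj_to[OF assms(4,1)] comp_zero[OF assms(2)] assms(3) unfolding zero_obj_def by simp
qed

lemma zero_obj_iso:
  assumes "zero_obj C X" "isomorphic C X Y"
  shows "zero_obj C Y"
proof -
  obtain f g where "arr f X Y" "arr g Y X" "f \<cdot> g = ide C Y"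
    using assms(2) unfolding isomorphic_def iso_mor_iff by blast
  then show ?thesis using zero_obj_if_retract assms(1) by blast
qed

lemma iso_mor_cancel_left:
  assumes e: "iso_mor C Y Z e" and f: "arr f X Y" and g: "arr g X Y" and eq: "e \<cdot> f = e \<cdot> g"
  shows "f = g"
proof -
  obtain e' where e': "iso_mor C Z Y e'" "e' \<cdot> e = ide C Y" using e by (rule iso_mor_inverse)
  note a = e[THEN iso_mor_arr] e'(1)[THEN iso_mor_arr]
  have "e' \<cdot> (e \<cdot> f) = f" "e' \<cdot> (e \<cdot> g) = g"
    by (simp_all add: assoc[OF f a, symmetric] assoc[OF g a, symmetric] e'(2) id_left[OF f] id_left[OF g])
  then show ?thesis unfolding eq by simp
qed

lemma iso_mor_cancel_right:
  assumes e: "iso_mor C X Y e" and f: "arr f Y Z" and g: "arr g Y Z" and eq: "f \<cdot> e = g \<cdot> e"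
  shows "f = g"
proof -
  obtain e' where e': "iso_mor C Y X e'" "e \<cdot> e' = ide C Y" using e by (rule iso_mor_inverse)
  note a = e'(1)[THEN iso_mor_arr] e[THEN iso_mor_arr]
  have "(f \<cdot> e) \<cdot> e' = f" "(g \<cdot> e) \<cdot> e' = g"
    by (simp_all add: assoc[OF a f] assoc[OF a g] e'(2) id_right[OF f] id_right[OF g])
  then show ?thesis unfolding eq by simp
qed

lemma Units_End_ring: "X \<in> Obj C \<Longrightarrow> f \<in> Units (End_ring C X) \<longleftrightarrow> iso_mor C X X f"
  unfolding iso_mor_iff Units_def End_ring_def arr_def by auto

lemma full_subcat_simps [simp]:
  "Obj (full_subcat C S) = S" "Hom (full_subcat C S) X Y = Hom C X Y"
  "comp (full_subcat C S) = comp C" "End_ring (full_subcat C S) X = End_ring C X"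
  unfolding full_subcat_def Hom_def End_ring_def by simp_all

text \<open>The left inverse obtained from \<open>b \<cdot> a\<close> and the right inverse obtained
  from \<open>a \<cdot> b\<close> must coincide.\<close>

lemma iso_mor_if_both_comp_iso:
  assumes a: "arr a X Y" and b: "arr b Y X" and ba: "iso_mor C X X (b \<cdot> a)" and ab: "iso_mor C Y Y (a \<cdot> b)"
  shows "iso_mor C X Y a"
proof -
  obtain u where u: "iso_mor C X X u" "u \<cdot> (b \<cdot> a) = ide C X" using ba by (rule iso_mor_inverse)
  obtain v where v: "iso_mor C Y Y v" "(a \<cdot> b) \<cdot> v = ide C Y" using ab by (rule iso_mor_inverse)
  note ua = iso_mor_arr[OF u(1)] and va = iso_mor_arr[OF v(1)]
  have ub: "arr (u \<cdot> b) Y X" and bv: "arr (b \<cdot> v) Y X" using arr_comp[OF b ua] arr_comp[OF va b] .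
  have l: "(u \<cdot> b) \<cdot> a = ide C X" using assoc[OF a b ua] u(2) by simp
  have r: "a \<cdot> (b \<cdot> v) = ide C Y" using assoc[OF va b a] v(2) by simp
  have "u \<cdot> b = b \<cdot> v" using assoc[OF bv a ub] l r id_left[OF bv] id_right[OF ub] by simp
  then show ?thesis unfolding iso_mor_iff using a bv l r by auto
qed

text \<open>Cancelling zero suffices: the difference of two morphisms with equal composites is again
  a test morphism with target in \<open>S\<close>.\<close>

lemma epi_full_subcatI:
  assumes "arr e X Y" "S \<subseteq> Obj C"
    and "\<And>Z g. Z \<in> S \<Longrightarrow> arr g Y Z \<Longrightarrow> g \<cdot> e = zero_mor X Z \<Longrightarrow> g = zero_mor Y Z"
  shows "epi (full_subcat C S) X Y e"
proof -
  have "g = h" if "Z \<in> S" "g \<in> Hom C Y Z" "h \<in> Hom C Y Z" "g \<cdot> e = h \<cdot> e" for Z g h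
  proof -
    have a: "arr g Y Z" "arr h Y Z" using that assms unfolding arr_def by auto
    have "diff Y Z g h \<cdot> e = zero_mor X Z"
      using diff_comp[OF assms(1) arrD(2)[OF a(1)] a] that(4)
        diff_zero_iff[OF arr_comp[OF assms(1) a(1)] arr_comp[OF assms(1) a(2)]] by simp
    then show ?thesis using assms(3)[OF that(1) arr_diff[OF a]] diff_zero_iff[OF a] by simp
  qed
  then show ?thesis using assms(1)
    unfolding epi_def full_subcat_def arr_def Hom_def by simp
qed

lemma epi_full_subcatD:
  assumes "epi (full_subcat C S) X Y e" "S \<subseteq> Obj C" "X \<in> S" "Y \<in> S"
  shows "arr e X Y" and "Z \<in> S \<Longrightarrow> arr g Y Z \<Longrightarrow> g \<cdot> e = zero_mor X Z \<Longrightarrow> g = zero_mor Y Z"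
proof -
  show e: "arr e X Y" using assms unfolding epi_def full_subcat_def arr_def Hom_def by auto
  assume *: "Z \<in> S" "arr g Y Z" "g \<cdot> e = zero_mor X Z"
  then have "zero_mor Y Z \<cdot> e = g \<cdot> e" using zero_comp[OF e] arrD(2) by simp
  moreover have "g \<in> Hom C Y Z" "zero_mor Y Z \<in> Hom C Y Z"
    using *(2) arr_zero[OF arrD(1,2)[OF *(2)]] unfolding arr_def by auto
  ultimately show "g = zero_mor Y Z"
    using assms(1) *(1) unfolding epi_def full_subcat_def Hom_def by auto
qed

end

section \<open>Triangulated categories\<close>

context triangulated_category
begin

section \<open>Compatibility of the shift with composition and addition\<close>

lemma arr_shift: "arr f X Y \<Longrightarrow> arr (f\<llangle>m\<rrangle>) (X\<langle>m\<rangle>) (Y\<langle>m\<rangle>)"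
  unfolding arr_def by (simp add: shift_obj_closed shift_mor_closed)

lemma shift_comp: "arr f X Y \<Longrightarrow> arr g Y Z \<Longrightarrow> (g \<cdot> f)\<llangle>m\<rrangle> = g\<llangle>m\<rrangle> \<cdot> f\<llangle>m\<rrangle>"
  unfolding arr_def using shift_mor_comp by blast

lemma shift_back: "arr f X Y \<Longrightarrow> f\<llangle>m\<rrangle>\<llangle>- m\<rrangle> = f" "arr f X Y \<Longrightarrow> f\<llangle>- m\<rrangle>\<llangle>m\<rrangle> = f"
  unfolding arr_def using shift_mor_add[of X Y f] shift_mor_0[of X Y f] by auto

lemma shift_obj_back: "X \<in> Obj D \<Longrightarrow> X\<langle>m\<rangle>\<langle>- m\<rangle> = X" "X \<in> Obj D \<Longrightarrow> X\<langle>- m\<rangle>\<langle>m\<rangle> = X"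
  by (simp_all add: shift_obj_add shift_obj_0)

lemma arr_unshift:
  assumes "arr f (X\<langle>m\<rangle>) (Y\<langle>m\<rangle>)" "X \<in> Obj D" "Y \<in> Obj D"
  shows "arr (f\<llangle>- m\<rrangle>) X Y"
  using arr_shift[OF assms(1), of "- m"] assms(2,3) by (simp add: shift_obj_back)

lemma
  assumes o: "X \<in> Obj D" "Y \<in> Obj D"
  shows shift_zero: "(zero_mor X Y)\<llangle>m\<rrangle> = zero_mor (X\<langle>m\<rangle>) (Y\<langle>m\<rangle>)"
    and shift_neg: "arr f X Y \<Longrightarrow> (neg X Y f)\<llangle>m\<rrangle> = neg (X\<langle>m\<rangle>) (Y\<langle>m\<rangle>) (f\<llangle>m\<rrangle>)"
proof -
  have *: "\<And>x. x \<in> carrier (HomMod D X Y) \<Longrightarrow> x\<llangle>m\<rrangle> \<in> carrier (HomMod D (X\<langle>m\<rangle>) (Y\<langle>m\<rangle>))"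
    "\<And>x y. x \<in> carrier (HomMod D X Y) \<Longrightarrow> y \<in> carrier (HomMod D X Y) \<Longrightarrow>
      (plus_mor X Y x y)\<llangle>m\<rrangle> = plus_mor (X\<langle>m\<rangle>) (Y\<langle>m\<rangle>) (x\<llangle>m\<rrangle>) (y\<llangle>m\<rrangle>)"
    using shift_mor_closed[OF o] shift_mor_plus[OF o] unfolding Hom_def by blast+
  note m = additive_map[OF Hom_abelian_group[OF o]
      Hom_abelian_group[OF o[THEN shift_obj_closed]], of "\<lambda>x. x\<llangle>m\<rrangle>", OF *]
  show "(zero_mor X Y)\<llangle>m\<rrangle> = zero_mor (X\<langle>m\<rangle>) (Y\<langle>m\<rangle>)" by (rule m(1))
  show "arr f X Y \<Longrightarrow> (neg X Y f)\<llangle>m\<rrangle> = neg (X\<langle>m\<rangle>) (Y\<langle>m\<rangle>) (f\<llangle>m\<rrangle>)"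
    by (rule m(2)) (auto simp: arr_def Hom_def)
qed

lemma shift_eq_iff: "arr f X Y \<Longrightarrow> arr g X Y \<Longrightarrow> f\<llangle>m\<rrangle> = g\<llangle>m\<rrangle> \<longleftrightarrow> f = g"
  by (metis shift_back(1))

lemma shift_zero_iff:
  assumes "arr f X Y"
  shows "f\<llangle>m\<rrangle> = zero_mor (X\<langle>m\<rangle>) (Y\<langle>m\<rangle>) \<longleftrightarrow> f = zero_mor X Y"
proof -
  have o: "X \<in> Obj D" "Y \<in> Obj D" using assms arrD by blast+
  show ?thesis using shift_eq_iff[OF assms arr_zero[OF o]] shift_zero[OF o] by simp
qed

lemma zero_obj_shift: "zero_obj D X \<Longrightarrow> zero_obj D (X\<langle>m\<rangle>)"
  unfolding zero_obj_def by (metis shift_mor_ide shift_obj_closed shift_zero)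

lemma iso_mor_shift:
  assumes "iso_mor D X Y f"
  shows "iso_mor D (X\<langle>m\<rangle>) (Y\<langle>m\<rangle>) (f\<llangle>m\<rrangle>)"
proof -
  obtain g where g: "iso_mor D Y X g" "g \<cdot> f = ide D X" "f \<cdot> g = ide D Y"
    using assms by (rule iso_mor_inverse)
  note a = assms[THEN iso_mor_arr] g(1)[THEN iso_mor_arr]
  have "g\<llangle>m\<rrangle> \<cdot> f\<llangle>m\<rrangle> = ide D (X\<langle>m\<rangle>)" "f\<llangle>m\<rrangle> \<cdot> g\<llangle>m\<rrangle> = ide D (Y\<langle>m\<rangle>)"
    using shift_comp[OF a, of m] shift_comp[OF a(2,1), of m] g shift_mor_ide arrD a(1) by metis+
  then show ?thesis unfolding iso_mor_iff using a[THEN arr_shift] by blast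
qed

lemma isomorphic_shift: "isomorphic D X Y \<Longrightarrow> isomorphic D (X\<langle>m\<rangle>) (Y\<langle>m\<rangle>)"
  unfolding isomorphic_def using iso_mor_shift by blast

lemma Hom_zero_shift:
  assumes "Hom_zero D X Y" and o: "X \<in> Obj D" "Y \<in> Obj D"
  shows "Hom_zero D (X\<langle>m\<rangle>) (Y\<langle>m\<rangle>)"
  unfolding Hom_zero_iff[OF o[THEN shift_obj_closed]]
proof (intro allI impI)
  fix f assume f: "arr f (X\<langle>m\<rangle>) (Y\<langle>m\<rangle>)"
  then have "f\<llangle>- m\<rrangle> = zero_mor X Y" using arr_unshift o Hom_zeroD assms(1) by blast
  then show "f = zero_mor (X\<langle>m\<rangle>) (Y\<langle>m\<rangle>)" using shift_back(2)[OF f, of m] shift_zero[OF o] by simp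
qed

lemma Hom_zero_shift_iff:
  assumes o: "X \<in> Obj D" "Y \<in> Obj D"
  shows "Hom_zero D (X\<langle>m\<rangle>) (Y\<langle>n\<rangle>) \<longleftrightarrow> Hom_zero D X (Y\<langle>n - m\<rangle>)"
  using Hom_zero_shift[of "X\<langle>m\<rangle>" "Y\<langle>n\<rangle>" "- m"] Hom_zero_shift[of X "Y\<langle>n - m\<rangle>" m] o
  by (auto simp: shift_obj_add shift_obj_0 shift_obj_closed)

text \<open>The empty coproduct has exactly one endomorphism, so its identity is zero.\<close>

lemma ex_zero_obj: obtains Z where "zero_obj D Z"
proof -
  obtain Y where Y: "coproduct D [] Y"
    using finite_coproducts unfolding has_finite_coproducts_def by force
  then have "Y \<in> Obj D" "\<exists>!g. g \<in> Hom D Y Y" unfolding coproduct_def by auto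
  then have "zero_obj D Y"
    unfolding zero_obj_def using arr_zero arr_ide arrD(3) by metis
  then show ?thesis by (rule that)
qed

section \<open>Exactness properties of triangles\<close>

lemma Tri_arr:
  assumes "(X, Y, Z, f, g, h) \<in> Tri D"
  shows "arr f X Y" "arr g Y Z" "arr h Z (X\<langle>1\<rangle>)"
  using Tri_closed[OF assms] shift_obj_closed unfolding arr_def by auto

lemma Tri_rotate_right:
  "(X, Y, Z, f, g, h) \<in> Tri D \<Longrightarrow> (Y, Z, X\<langle>1\<rangle>, g, h, neg (X\<langle>1\<rangle>) (Y\<langle>1\<rangle>) (f\<llangle>1\<rrangle>)) \<in> Tri D"
  using Tri_rotate Tri_closed by blast

text \<open>The sign on the shifted connecting morphism cancels the one that
  \<open>Tri_rotate\<close> introduces when rotating forward again.\<close>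

lemma Tri_rotate_left:
  assumes T: "(X, Y, Z, f, g, h) \<in> Tri D"
  shows "(Z\<langle>-1\<rangle>, X, Y, neg (Z\<langle>-1\<rangle>) X (h\<llangle>-1\<rrangle>), f, g) \<in> Tri D"
proof -
  note a = Tri_arr[OF T]
  have o: "X \<in> Obj D" "Y \<in> Obj D" "Z \<in> Obj D" using Tri_closed[OF T] by auto
  have h': "arr (h\<llangle>-1\<rrangle>) (Z\<langle>-1\<rangle>) X" using arr_shift[OF a(3), of "-1"] o shift_obj_back[of X 1] by simp
  have Z1: "Z\<langle>-1\<rangle>\<langle>1\<rangle> = Z" using o shift_obj_back(2)[of Z 1] by simp
  have "(neg (Z\<langle>-1\<rangle>) X (h\<llangle>-1\<rrangle>))\<llangle>1\<rrangle> = neg Z (X\<langle>1\<rangle>) h"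
    using shift_neg[OF arrD(1,2)[OF h'] h', of 1] shift_back(2)[OF a(3), of 1] Z1 by simp
  then have "neg Z (X\<langle>1\<rangle>) ((neg (Z\<langle>-1\<rangle>) X (h\<llangle>-1\<rrangle>))\<llangle>1\<rrangle>) = h"
    using neg_neg[OF a(3)] by simp
  then show ?thesis
    using Tri_rotate[of "Z\<langle>-1\<rangle>" X Y "neg (Z\<langle>-1\<rangle>) X (h\<llangle>-1\<rrangle>)" f g] T Z1 o a arr_neg[OF h']
    unfolding arr_def by simp
qed

text \<open>A morphism from the triangle on \<open>ide D X\<close>, whose third object is zero,
  makes \<open>g \<cdot> f\<close> factor through that zero object.\<close>

lemma Tri_comp_zero:
  assumes T: "(X, Y, Z, f, g, h) \<in> Tri D"
  shows "g \<cdot> f = zero_mor X Z"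
proof -
  obtain O' where O: "zero_obj D O'" by (rule ex_zero_obj)
  note a = Tri_arr[OF T]
  have X: "X \<in> Obj D" using a arrD by blast
  have "f \<cdot> ide D X = f \<cdot> ide D X" ..
  then obtain c where "c \<in> Hom D O' Z" "c \<cdot> zero_mor X O' = g \<cdot> f"
    using Tri_morphism[OF Tri_ide[OF X O] T, of "ide D X" f] a(1) ide_Hom[OF X] unfolding arr_def by blast
  moreover from this have "arr c O' Z" using a(2) O zero_obj_Obj unfolding arr_def by blast
  ultimately show ?thesis using comp_zero X by metis
qed

lemma Tri_comp_zero2: "(X, Y, Z, f, g, h) \<in> Tri D \<Longrightarrow> h \<cdot> g = zero_mor Y (X\<langle>1\<rangle>)"
  using Tri_comp_zero Tri_rotate_right by blast

lemma Tri_comp_zero3: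
  assumes T: "(X, Y, Z, f, g, h) \<in> Tri D"
  shows "f\<llangle>1\<rrangle> \<cdot> h = zero_mor Z (Y\<langle>1\<rangle>)"
proof -
  note a = Tri_arr[OF T]
  have o: "Z \<in> Obj D" "Y \<langle>1\<rangle> \<in> Obj D" using a arrD shift_obj_closed by blast+
  have "neg (X\<langle>1\<rangle>) (Y\<langle>1\<rangle>) (f\<llangle>1\<rrangle>) \<cdot> h = zero_mor Z (Y\<langle>1\<rangle>)"
    using Tri_comp_zero2[OF Tri_rotate_right[OF T]] .
  then have "neg Z (Y\<langle>1\<rangle>) (f\<llangle>1\<rrangle> \<cdot> h) = zero_mor Z (Y\<langle>1\<rangle>)"
    using neg_comp[OF a(3) o(2)] arr_shift[OF a(1)] by simp
  then show ?thesis
    using neg_neg[OF arr_comp[OF a(3) arr_shift[OF a(1)]]] neg_zero[OF o] by simp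
qed

text \<open>A morphism of triangles into one with objects zero, \<open>W\<close>, \<open>W\<close>
  has the desired factorization as its third component.\<close>

lemma Tri_colift:
  assumes T: "(X, Y, Z, f, g, h) \<in> Tri D" and v: "arr v Y W" and z: "v \<cdot> f = zero_mor X W"
  obtains c where "arr c Z W" "c \<cdot> g = v"
proof -
  obtain O' where O: "zero_obj D O'" by (rule ex_zero_obj)
  note a = Tri_arr[OF T]
  have o: "X \<in> Obj D" "W \<in> Obj D" "O' \<in> Obj D" using a v O zero_obj_Obj arrD by blast+
  \<comment> \<open>The zero object is taken as a shift so that rotating backwards ends exactly at
    \<open>O'\<close>.\<close>
  have "(W, W, O'\<langle>1\<rangle>, ide D W, zero_mor W (O'\<langle>1\<rangle>), zero_mor (O'\<langle>1\<rangle>) (W\<langle>1\<rangle>)) \<in> Tri D"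
    using Tri_ide o(2) O zero_obj_shift by blast
  moreover have "neg (O'\<langle>1\<rangle>) (W\<langle>1\<rangle>) ((zero_mor O' W)\<llangle>1\<rrangle>) = zero_mor (O'\<langle>1\<rangle>) (W\<langle>1\<rangle>)"
    using shift_zero neg_zero o shift_obj_closed by simp
  ultimately have "(O', W, W, zero_mor O' W, ide D W, zero_mor W (O'\<langle>1\<rangle>)) \<in> Tri D"
    using Tri_rotate[of O' W W "zero_mor O' W" "ide D W" "zero_mor W (O'\<langle>1\<rangle>)"] o
      arr_zero[OF o(3,2)] arr_ide[OF o(2)] arr_zero[OF o(2) shift_obj_closed[OF o(3)]]
    unfolding arr_def by simp
  moreover have "v \<cdot> f = zero_mor O' W \<cdot> zero_mor X O'"
    using z comp_zero[OF arr_zero[OF o(3,2)] o(1)] by simp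
  ultimately obtain c where c: "c \<in> Hom D Z W" "c \<cdot> g = ide D W \<cdot> v"
    using Tri_morphism[OF T, of O' W W _ _ _ "zero_mor X O'" v] v arr_zero[OF o(1,3)] unfolding arr_def by blast
  then show ?thesis using that[of c] id_left[OF v] a(2) o unfolding arr_def by simp
qed

text \<open>Here the comparison starts from a triangle with objects \<open>W\<close>, zero,
  \<open>W[1]\<close>. The third component is the wanted lift shifted by one; the signs of the two
  rotations cancel.\<close>

lemma Tri_lift:
  assumes T: "(X, Y, Z, f, g, h) \<in> Tri D" and u: "arr u W Y" and z: "g \<cdot> u = zero_mor W Z"
  obtains c where "arr c W X" "f \<cdot> c = u"
proof -
  obtain O' where O: "zero_obj D O'" by (rule ex_zero_obj)
  note a = Tri_arr[OF T]
  have o: "X \<in> Obj D" "Y \<in> Obj D" "Z \<in> Obj D" "W \<in> Obj D" "O' \<in> Obj D"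
    using a u O zero_obj_Obj arrD by blast+
  have T': "(W, O', W\<langle>1\<rangle>, zero_mor W O', zero_mor O' (W\<langle>1\<rangle>), neg (W\<langle>1\<rangle>) (W\<langle>1\<rangle>) ((ide D W)\<llangle>1\<rrangle>)) \<in> Tri D"
    using Tri_rotate_right[OF Tri_ide[OF o(4) O]] .
  have "zero_mor O' Z \<cdot> zero_mor W O' = g \<cdot> u"
    using z comp_zero[OF arr_zero[OF o(5,3)] o(4)] by simp
  then obtain c where c: "c \<in> Hom D (W\<langle>1\<rangle>) (X\<langle>1\<rangle>)"
    "u\<llangle>1\<rrangle> \<cdot> neg (W\<langle>1\<rangle>) (W\<langle>1\<rangle>) ((ide D W)\<llangle>1\<rrangle>) = neg (X\<langle>1\<rangle>) (Y\<langle>1\<rangle>) (f\<llangle>1\<rrangle>) \<cdot> c"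
    using Tri_morphism[OF T' Tri_rotate_right[OF T], of u "zero_mor O' Z"] u arr_zero[OF o(5,3)]
    unfolding arr_def by blast
  then have ac: "arr c (W\<langle>1\<rangle>) (X\<langle>1\<rangle>)" using o shift_obj_closed unfolding arr_def by blast
  have u1: "arr (u\<llangle>1\<rrangle>) (W\<langle>1\<rangle>) (Y\<langle>1\<rangle>)" and f1: "arr (f\<llangle>1\<rrangle>) (X\<langle>1\<rangle>) (Y\<langle>1\<rangle>)"
    using arr_shift u a by blast+
  have "u\<llangle>1\<rrangle> \<cdot> neg (W\<langle>1\<rangle>) (W\<langle>1\<rangle>) ((ide D W)\<llangle>1\<rrangle>) = neg (W\<langle>1\<rangle>) (Y\<langle>1\<rangle>) (u\<llangle>1\<rrangle>)"
    using comp_neg[OF u1 arrD(1)[OF u1] arr_ide[OF arrD(1)[OF u1]]] id_right[OF u1] shift_mor_ide[OF o(4)] by simp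
  moreover have "neg (X\<langle>1\<rangle>) (Y\<langle>1\<rangle>) (f\<llangle>1\<rrangle>) \<cdot> c = neg (W\<langle>1\<rangle>) (Y\<langle>1\<rangle>) (f\<llangle>1\<rrangle> \<cdot> c)"
    using neg_comp[OF ac arrD(2)[OF f1] f1] .
  ultimately have "u\<llangle>1\<rrangle> = f\<llangle>1\<rrangle> \<cdot> c"
    using c(2) neg_neg[OF u1] neg_neg[OF arr_comp[OF ac f1]] by simp
  then have "u = (f\<llangle>1\<rrangle> \<cdot> c)\<llangle>-1\<rrangle>" using shift_back(1)[OF u, of 1] by simp
  also have "\<dots> = f \<cdot> c\<llangle>-1\<rrangle>" using shift_comp[OF ac f1, of "-1"] shift_back(1)[OF a(1), of 1] by simp
  finally have "f \<cdot> c\<llangle>-1\<rrangle> = u" by simp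
  moreover have "arr (c\<llangle>-1\<rrangle>) W X" using arr_unshift[OF ac o(4,1)] by simp
  ultimately show ?thesis using that by blast
qed

lemma Tri_lift2:
  assumes T: "(X, Y, Z, f, g, h) \<in> Tri D" and u: "arr u W Z" and z: "h \<cdot> u = zero_mor W (X\<langle>1\<rangle>)"
  obtains c where "arr c W Y" "g \<cdot> c = u"
  using Tri_lift[OF Tri_rotate_right[OF T] u z] that by blast

lemma Tri_colift2:
  assumes T: "(X, Y, Z, f, g, h) \<in> Tri D" and v: "arr v Z W" and z: "v \<cdot> g = zero_mor Y W"
  obtains c where "arr c (X\<langle>1\<rangle>) W" "c \<cdot> h = v"
  using Tri_colift[OF Tri_rotate_right[OF T] v z] that by blast

text \<open>The difference \<open>d = c - 1\<close> kills \<open>g\<close>, so it factors through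
  \<open>h\<close>, and \<open>h\<close> kills \<open>d\<close>. Hence \<open>d\<close> squares to
  zero and \<open>1 - d\<close> is inverse to \<open>c\<close>.\<close>

lemma Tri_endo_iso:
  assumes T: "(X, Y, Z, f, g, h) \<in> Tri D" and c: "arr c Z Z" and cg: "c \<cdot> g = g" and hc: "h \<cdot> c = h"
  shows "iso_mor D Z Z c"
proof -
  note a = Tri_arr[OF T]
  have Z: "Z \<in> Obj D" using a arrD by blast
  define d where "d = diff Z Z c (ide D Z)"
  have d: "arr d Z Z" unfolding d_def using arr_diff c arr_ide Z by blast
  have "d \<cdot> g = zero_mor Y Z"
    unfolding d_def using diff_comp[OF a(2) Z c arr_ide[OF Z]] id_left[OF a(2)] cg diff_zero_iff[OF a(2) a(2)] by simp
  then obtain k where k: "arr k (X\<langle>1\<rangle>) Z" "k \<cdot> h = d" using Tri_colift2[OF T d] by blast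
  have "h \<cdot> d = zero_mor Z (X\<langle>1\<rangle>)"
    unfolding d_def using comp_diff[OF a(3) Z c arr_ide[OF Z]] id_right[OF a(3)] hc diff_zero_iff[OF a(3) a(3)] by simp
  then have dd: "d \<cdot> d = zero_mor Z Z"
    using assoc[OF d a(3) k(1)] k(2) comp_zero[OF k(1) Z] by simp
  have "d \<cdot> d = diff Z Z (c \<cdot> d) d"
    using diff_comp[OF d Z c arr_ide[OF Z]] id_left[OF d] d_def by simp
  then have cd: "c \<cdot> d = d" using dd diff_zero_iff[OF arr_comp[OF d c] d] by simp
  have "d \<cdot> d = diff Z Z (d \<cdot> c) d"
    using comp_diff[OF d Z c arr_ide[OF Z]] id_right[OF d] d_def by simp
  then have dc: "d \<cdot> c = d" using dd diff_zero_iff[OF arr_comp[OF c d] d] by simp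
  define e where "e = diff Z Z (ide D Z) d"
  have e: "arr e Z Z" unfolding e_def using arr_diff d arr_ide Z by blast
  have "c \<cdot> e = diff Z Z c d" "e \<cdot> c = diff Z Z c d"
    unfolding e_def using comp_diff[OF c Z arr_ide[OF Z] d] diff_comp[OF c Z arr_ide[OF Z] d]
      id_right[OF c] id_left[OF c] cd dc by simp_all
  moreover have "diff Z Z c d = ide D Z" unfolding d_def using diff_diff[OF c arr_ide[OF Z]] .
  ultimately show ?thesis unfolding iso_mor_iff using c e by auto
qed

text \<open>Since \<open>g = 0\<close>, the identity of \<open>Y\<close> lifts to a section
  \<open>c\<close> of \<open>f\<close>. The morphism \<open>c \<cdot> f - 1\<close> is killed by
  \<open>f\<close>, hence factors through \<open>Z[-1]\<close>, which is zero.\<close>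

lemma Tri_iso_if_zero:
  assumes T: "(X, Y, Z, f, g, h) \<in> Tri D" and Z: "zero_obj D Z"
  shows "iso_mor D X Y f"
proof -
  note a = Tri_arr[OF T]
  have o: "X \<in> Obj D" "Y \<in> Obj D" "Z \<in> Obj D" using a arrD by blast+
  have "g \<cdot> ide D Y = zero_mor Y Z" using zero_obj_to[OF Z arr_comp[OF arr_ide[OF o(2)] a(2)]] .
  then obtain c where c: "arr c Y X" "f \<cdot> c = ide D Y" using Tri_lift[OF T arr_ide[OF o(2)]] by blast
  have cf: "arr (c \<cdot> f) X X" using arr_comp[OF a(1) c(1)] .
  define u where "u = diff X X (c \<cdot> f) (ide D X)"
  have u: "arr u X X" unfolding u_def using arr_diff[OF cf arr_ide[OF o(1)]] .
  have "f \<cdot> u = zero_mor X Y"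
    unfolding u_def using comp_diff[OF a(1) o(1) cf arr_ide[OF o(1)]] assoc[OF a(1) c(1) a(1), symmetric] c(2)
      id_left[OF a(1)] id_right[OF a(1)] diff_zero_iff[OF a(1) a(1)] by simp
  then obtain v where v: "arr v X (Z\<langle>-1\<rangle>)" "neg (Z\<langle>-1\<rangle>) X (h\<llangle>-1\<rrangle>) \<cdot> v = u"
    using Tri_lift[OF Tri_rotate_left[OF T] u] by blast
  have "v = zero_mor X (Z\<langle>-1\<rangle>)" using zero_obj_to zero_obj_shift Z v(1) by blast
  then have "u = zero_mor X X" using v(2) comp_zero[OF Tri_arr(1)[OF Tri_rotate_left[OF T]] o(1)] by simp
  then have "c \<cdot> f = ide D X" unfolding u_def using diff_zero_iff[OF cf arr_ide[OF o(1)]] by simp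
  then show ?thesis unfolding iso_mor_iff using a c by blast
qed

section \<open>Triangles up to the choice of their morphisms\<close>

definition tri :: "'o \<Rightarrow> 'o \<Rightarrow> 'o \<Rightarrow> bool" where
  "tri X Y Z \<longleftrightarrow> (\<exists>f g h. (X, Y, Z, f, g, h) \<in> Tri D)"

lemma tri_Obj: "tri X Y Z \<Longrightarrow> X \<in> Obj D \<and> Y \<in> Obj D \<and> Z \<in> Obj D"
  unfolding tri_def using Tri_closed by blast

lemma tri_rotate: "tri X Y Z \<Longrightarrow> tri Y Z (X\<langle>1\<rangle>)" "tri X Y Z \<Longrightarrow> tri (Z\<langle>-1\<rangle>) X Y"
  unfolding tri_def using Tri_rotate_left Tri_rotate_right by blast+

lemma tri_shift1:
  assumes "tri X Y Z"
  shows "tri (X\<langle>1\<rangle>) (Y\<langle>1\<rangle>) (Z\<langle>1\<rangle>)" "tri (X\<langle>-1\<rangle>) (Y\<langle>-1\<rangle>) (Z\<langle>-1\<rangle>)"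
  using assms tri_rotate by blast+

text \<open>Three rotations shift a triangle by one; the signs that they introduce are invisible at
  the level of objects.\<close>

lemma tri_shift:
  assumes "tri X Y Z"
  shows "tri (X\<langle>m\<rangle>) (Y\<langle>m\<rangle>) (Z\<langle>m\<rangle>)"
proof -
  have o: "X \<in> Obj D" "Y \<in> Obj D" "Z \<in> Obj D" using tri_Obj assms by auto
  show ?thesis
  proof (induction m rule: int_induct[where k = 0])
    case base
    then show ?case using assms o by (simp add: shift_obj_0)
  next
    case (step1 i)
    then show ?case using tri_shift1(1)[OF step1(2)] o by (simp add: shift_obj_add)
  next
    case (step2 i)
    then show ?case using tri_shift1(2)[OF step2(2)] o by (simp add: shift_obj_add)
  qed
qed

lemma tri_iso:
  assumes T: "tri X Y Z" and i: "isomorphic D X X'" "isomorphic D Y Y'" "isomorphic D Z Z'"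
  shows "tri X' Y' Z'"
proof -
  obtain f g h where T: "(X, Y, Z, f, g, h) \<in> Tri D" using T unfolding tri_def by blast
  obtain a b c where abc: "iso_mor D X X' a" "iso_mor D Y Y' b" "iso_mor D Z Z' c"
    using i unfolding isomorphic_def by blast
  obtain a' where a': "iso_mor D X' X a'" "a' \<cdot> a = ide D X" using abc(1) by (rule iso_mor_inverse)
  obtain b' where b': "iso_mor D Y' Y b'" "b' \<cdot> b = ide D Y" using abc(2) by (rule iso_mor_inverse)
  obtain c' where c': "iso_mor D Z' Z c'" "c' \<cdot> c = ide D Z" using abc(3) by (rule iso_mor_inverse)
  note A = abc[THEN iso_mor_arr] a'(1)[THEN iso_mor_arr] b'(1)[THEN iso_mor_arr] c'(1)[THEN iso_mor_arr]
  note t = Tri_arr[OF T]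
  have f': "arr (b \<cdot> (f \<cdot> a')) X' Y'" using arr_comp[OF arr_comp[OF A(4) t(1)] A(2)] .
  have g': "arr (c \<cdot> (g \<cdot> b')) Y' Z'" using arr_comp[OF arr_comp[OF A(5) t(2)] A(3)] .
  have a1: "arr (a\<llangle>1\<rrangle>) (X\<langle>1\<rangle>) (X'\<langle>1\<rangle>)" using arr_shift[OF A(1)] .
  have h': "arr (a\<llangle>1\<rrangle> \<cdot> (h \<cdot> c')) Z' (X'\<langle>1\<rangle>)" using arr_comp[OF arr_comp[OF A(6) t(3)] a1] .
  have "(b \<cdot> (f \<cdot> a')) \<cdot> a = b \<cdot> f"
    using assoc[OF A(1) arr_comp[OF A(4) t(1)] A(2)] assoc[OF A(1) A(4) t(1)] a'(2) id_right[OF t(1)] by simp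
  moreover have "(c \<cdot> (g \<cdot> b')) \<cdot> b = c \<cdot> g"
    using assoc[OF A(2) arr_comp[OF A(5) t(2)] A(3)] assoc[OF A(2) A(5) t(2)] b'(2) id_right[OF t(2)] by simp
  moreover have "(a\<llangle>1\<rrangle> \<cdot> (h \<cdot> c')) \<cdot> c = a\<llangle>1\<rrangle> \<cdot> h"
    using assoc[OF A(3) arr_comp[OF A(6) t(3)] a1] assoc[OF A(3) A(6) t(3)] c'(2) id_right[OF t(3)] by simp
  ultimately have "(X', Y', Z', b \<cdot> (f \<cdot> a'), c \<cdot> (g \<cdot> b'), a\<llangle>1\<rrangle> \<cdot> (h \<cdot> c')) \<in> Tri D"
    using Tri_iso[OF T abc] f' g' h' unfolding arr_def by simp
  then show ?thesis unfolding tri_def by blast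
qed

lemma tri_iso_mid: "tri X Y Z \<Longrightarrow> isomorphic D Y Y' \<Longrightarrow> tri X Y' Z"
  using tri_iso isomorphic_refl tri_Obj by blast

lemma tri_zero_right: "X \<in> Obj D \<Longrightarrow> zero_obj D Z \<Longrightarrow> tri X X Z"
  unfolding tri_def using Tri_ide by blast

lemma tri_zero_left:
  assumes "X \<in> Obj D" "zero_obj D Z"
  shows "tri Z X X"
  using tri_rotate(2)[OF tri_zero_right[OF assms(1) zero_obj_shift[OF assms(2), of 1]]]
    shift_obj_back(1)[of Z 1] zero_obj_Obj[OF assms(2)] by simp

lemma tri_iso_left: "tri X Y Z \<Longrightarrow> zero_obj D Z \<Longrightarrow> isomorphic D X Y"
  unfolding tri_def isomorphic_def using Tri_iso_if_zero by blast

lemma tri_iso_right: "tri X Y Z \<Longrightarrow> zero_obj D X \<Longrightarrow> isomorphic D Y Z"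
  using tri_iso_left tri_rotate(1) zero_obj_shift by blast

text \<open>The octahedral axiom, read as regrouping a filtration with successive factors
  \<open>A\<close>, \<open>B\<close>, \<open>C\<close>: instead of the first two, the last two are
  merged.\<close>

lemma tri_assoc_right:
  assumes "tri A E B" "tri E Y C"
  obtains E' where "tri A Y E'" "tri B E' C"
proof -
  obtain f f' f'' where F: "(A, E, B, f, f', f'') \<in> Tri D" using assms(1) unfolding tri_def by blast
  obtain g g' g'' where G: "(E, Y, C, g, g', g'') \<in> Tri D" using assms(2) unfolding tri_def by blast
  have "arr (g \<cdot> f) A Y" using arr_comp[OF Tri_arr(1)[OF F] Tri_arr(1)[OF G]] .
  then obtain E' h' h'' where H: "(A, Y, E', g \<cdot> f, h', h'') \<in> Tri D"
    using Tri_cone unfolding arr_def by blast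
  show ?thesis using octahedral[OF F G H] H that unfolding tri_def by blast
qed

text \<open>The opposite regrouping, obtained from \<open>tri_assoc_right\<close> for the rotated
  triangles and a shift back by one.\<close>

lemma tri_assoc_left:
  assumes "tri A Y E" "tri B E C"
  obtains E' where "tri A E' B" "tri E' Y C"
proof -
  have o: "A \<in> Obj D" "B \<in> Obj D" "Y \<in> Obj D" using assms tri_Obj by auto
  obtain E'' where E: "tri Y C E''" "tri (A\<langle>1\<rangle>) E'' (B\<langle>1\<rangle>)"
    using tri_assoc_right[OF tri_rotate(1)[OF assms(1)] tri_rotate(1)[OF assms(2)]] by blast
  show ?thesis
    using tri_shift[OF E(2), of "-1"] tri_rotate(2)[OF E(1)] o that
    by (simp add: shift_obj_add shift_obj_0)
qed

text \<open>When the connecting morphism vanishes, \<open>g\<close> has a section \<open>s\<close>.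
  The octahedron on \<open>g \<cdot> s = ide D Z\<close> shows that the cone of \<open>s\<close> is
  isomorphic to \<open>X\<close>, so the two factors may change places.\<close>

lemma tri_swap:
  assumes T: "(X, Y, Z, f, g, h) \<in> Tri D" and h0: "h = zero_mor Z (X\<langle>1\<rangle>)"
  shows "tri Z Y X"
proof -
  note a = Tri_arr[OF T]
  have o: "X \<in> Obj D" "Y \<in> Obj D" "Z \<in> Obj D" using a arrD by blast+
  have "h \<cdot> ide D Z = zero_mor Z (X\<langle>1\<rangle>)" using id_right[OF a(3)] h0 by simp
  then obtain s where s: "arr s Z Y" "g \<cdot> s = ide D Z" using Tri_lift2[OF T arr_ide[OF o(3)]] by blast
  obtain W p q where W: "(Z, Y, W, s, p, q) \<in> Tri D" using Tri_cone s(1) unfolding arr_def by blast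
  obtain O' where O: "zero_obj D O'" by (rule ex_zero_obj)
  obtain u v w where U: "(W, O', X\<langle>1\<rangle>, u, v, w) \<in> Tri D"
    using octahedral[OF W Tri_rotate_right[OF T]] Tri_ide[OF o(3) O] s(2) by metis
  have "isomorphic D (X\<langle>1\<rangle>) (W\<langle>1\<rangle>)"
    using tri_iso_left[of "X\<langle>1\<rangle>" "W\<langle>1\<rangle>" "O'\<langle>1\<rangle>"] tri_rotate(1)[OF tri_rotate(1)] U zero_obj_shift[OF O]
    unfolding tri_def by blast
  then have "isomorphic D X W"
    using isomorphic_shift[of "X\<langle>1\<rangle>" "W\<langle>1\<rangle>" "-1"] o tri_Obj[of Z Y W] W shift_obj_back(1)[of _ 1]
    unfolding tri_def by (metis Tri_closed)
  then show ?thesis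
    using tri_iso[of Z Y W Z Y X] W isomorphic_refl o isomorphic_sym unfolding tri_def by blast
qed

text \<open>Cancelling the invertible \<open>h\<close> from \<open>h \<cdot> g = 0\<close> and from
  \<open>f[1] \<cdot> h = 0\<close> gives \<open>g = 0\<close> and \<open>f = 0\<close>. The first
  makes the identity of \<open>Y\<close> factor through \<open>f\<close>, which is zero.\<close>

lemma tri_cancel:
  assumes T: "(X, Y, Z, f, g, h) \<in> Tri D" and h: "iso_mor D Z (X\<langle>1\<rangle>) h"
  shows "zero_obj D Y"
proof -
  note a = Tri_arr[OF T]
  have o: "X \<in> Obj D" "Y \<in> Obj D" "Z \<in> Obj D" using a arrD by blast+
  have "h \<cdot> g = h \<cdot> zero_mor Y Z"
    using Tri_comp_zero2[OF T] comp_zero[OF a(3) o(2)] by simp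
  then have "g = zero_mor Y Z" by (rule iso_mor_cancel_left[OF h a(2) arr_zero[OF o(2,3)]])
  then have "g \<cdot> ide D Y = zero_mor Y Z" using id_right[OF a(2)] by simp
  then obtain c where c: "arr c Y X" "f \<cdot> c = ide D Y" using Tri_lift[OF T arr_ide[OF o(2)]] by blast
  have f1: "arr (f\<llangle>1\<rrangle>) (X\<langle>1\<rangle>) (Y\<langle>1\<rangle>)" using arr_shift[OF a(1)] .
  have "f\<llangle>1\<rrangle> \<cdot> h = zero_mor (X\<langle>1\<rangle>) (Y\<langle>1\<rangle>) \<cdot> h"
    using Tri_comp_zero3[OF T] zero_comp[OF a(3) arrD(2)[OF f1]] by simp
  then have "f\<llangle>1\<rrangle> = zero_mor (X\<langle>1\<rangle>) (Y\<langle>1\<rangle>)"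
    by (rule iso_mor_cancel_right[OF h f1 arr_zero[OF arrD(1,2)[OF f1]]])
  then have "f = zero_mor X Y" using shift_zero_iff[OF a(1)] by simp
  then have "ide D Y = zero_mor Y Y" using c(2) zero_comp[OF c(1) o(2)] by simp
  then show ?thesis unfolding zero_obj_def using o by blast
qed

subsection \<open>Retracts\<close>

text \<open>Being given by two morphisms, retracts compose and shift easily;
  \<open>direct_summand_iff\<close> identifies them with direct summands.\<close>

definition retract :: "'o \<Rightarrow> 'o \<Rightarrow> bool" where
  "retract X Y \<longleftrightarrow> (\<exists>s r. arr s X Y \<and> arr r Y X \<and> r \<cdot> s = ide D X)"

lemma retract_Obj: "retract X Y \<Longrightarrow> X \<in> Obj D \<and> Y \<in> Obj D"
  unfolding retract_def arr_def by blast

lemma retract_refl: "X \<in> Obj D \<Longrightarrow> retract X X"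
  unfolding retract_def using arr_ide id_left by blast

lemma retract_iso: "isomorphic D X Y \<Longrightarrow> retract X Y"
  unfolding isomorphic_def retract_def iso_mor_iff by blast

lemma retract_trans:
  assumes "retract X Y" "retract Y Z"
  shows "retract X Z"
proof -
  obtain s r where 1: "arr s X Y" "arr r Y X" "r \<cdot> s = ide D X" using assms unfolding retract_def by blast
  obtain s' r' where 2: "arr s' Y Z" "arr r' Z Y" "r' \<cdot> s' = ide D Y" using assms unfolding retract_def by blast
  have "(r \<cdot> r') \<cdot> (s' \<cdot> s) = ide D X"
    using assoc4[OF 1(1) 2(1) 2(2) 1(2)] 1(3) 2(3) id_left[OF 1(1)] by simp
  then show ?thesis unfolding retract_def using arr_comp 1 2 by blast
qed

lemma retract_shift:
  assumes "retract X Y"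
  shows "retract (X\<langle>m\<rangle>) (Y\<langle>m\<rangle>)"
proof -
  obtain s r where 1: "arr s X Y" "arr r Y X" "r \<cdot> s = ide D X" using assms unfolding retract_def by blast
  have "r\<llangle>m\<rrangle> \<cdot> s\<llangle>m\<rrangle> = ide D (X\<langle>m\<rangle>)"
    using shift_comp[OF 1(1,2), of m] 1(3) shift_mor_ide[OF arrD(1)[OF 1(1)]] by simp
  then show ?thesis unfolding retract_def using arr_shift 1 by blast
qed

text \<open>The complement is the cone of \<open>s\<close>, whose connecting morphism vanishes
  because \<open>s\<close> is split. The second conclusion lets indecomposability turn a retraction
  into an isomorphism.\<close>

lemma coproduct_complement:
  assumes s: "arr s X Y" and r: "arr r Y X" and rs: "r \<cdot> s = ide D X"
  obtains X' where "coproduct D [X, X'] Y" "zero_obj D X' \<Longrightarrow> s \<cdot> r = ide D Y"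
proof -
  obtain X' g h where T: "(X, Y, X', s, g, h) \<in> Tri D" using Tri_cone s unfolding arr_def by blast
  note a = Tri_arr[OF T]
  have o: "X \<in> Obj D" "Y \<in> Obj D" "X' \<in> Obj D" using a arrD by blast+
  have r1: "arr (r\<llangle>1\<rrangle>) (Y\<langle>1\<rangle>) (X\<langle>1\<rangle>)" and s1: "arr (s\<llangle>1\<rrangle>) (X\<langle>1\<rangle>) (Y\<langle>1\<rangle>)" using arr_shift r s by auto
  have "r\<llangle>1\<rrangle> \<cdot> s\<llangle>1\<rrangle> = ide D (X\<langle>1\<rangle>)"
    using shift_comp[OF s r, of 1] rs shift_mor_ide[OF o(1)] by simp
  then have "h = zero_mor X' (X\<langle>1\<rangle>)"
    using assoc[OF a(3) s1 r1] Tri_comp_zero3[OF T] id_left[OF a(3)] comp_zero[OF r1 o(3)] by simp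
  then have "h \<cdot> ide D X' = zero_mor X' (X\<langle>1\<rangle>)" using id_right[OF a(3)] by simp
  then obtain j0 where j0: "arr j0 X' Y" "g \<cdot> j0 = ide D X'" using Tri_lift2[OF T arr_ide[OF o(3)]] by blast
  \<comment> \<open>Subtracting the component along \<open>s\<close> makes
    \<open>r \<cdot> j\<close> vanish while \<open>j\<close> remains a section of
    \<open>g\<close>.\<close>
  define j where "j = diff X' Y j0 (s \<cdot> (r \<cdot> j0))"
  have rj0: "arr (r \<cdot> j0) X' X" and srj0: "arr (s \<cdot> (r \<cdot> j0)) X' Y" using arr_comp j0 r s by blast+
  have j: "arr j X' Y" unfolding j_def using arr_diff[OF j0(1) srj0] .
  have gs: "g \<cdot> s = zero_mor X X'" using Tri_comp_zero[OF T] .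
  have "g \<cdot> (s \<cdot> (r \<cdot> j0)) = zero_mor X' X'"
    using assoc[OF rj0 s a(2)] gs zero_comp[OF rj0 o(3)] by simp
  then have gj: "g \<cdot> j = ide D X'"
    unfolding j_def using comp_diff[OF a(2) o(3) j0(1) srj0] j0(2) diff_zero[OF arr_ide[OF o(3)]] by simp
  have "r \<cdot> (s \<cdot> (r \<cdot> j0)) = r \<cdot> j0" using assoc[OF rj0 s r] rs id_left[OF rj0] by simp
  then have rj: "r \<cdot> j = zero_mor X' X"
    unfolding j_def using comp_diff[OF r o(3) j0(1) srj0] diff_zero_iff[OF rj0 rj0] by simp
  let ?\<iota> = "\<lambda>i::nat. if i = 0 then s else j"
  have univ: "\<exists>!m. m \<in> Hom D Y Z \<and> (\<forall>i<length [X, X']. m \<cdot> ?\<iota> i = F i)"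
    if Z: "Z \<in> Obj D" and F: "\<forall>i<length [X, X']. F i \<in> Hom D ([X, X'] ! i) Z" for Z F
  proof -
    have "F 0 \<in> Hom D X Z" "F 1 \<in> Hom D X' Z" using F by force+
    then have f: "arr (F 0) X Z" "arr (F 1) X' Z" using Z o unfolding arr_def by auto
    have c: "arr (F 0 \<cdot> r) Y Z" "arr (F 1 \<cdot> g) Y Z" using arr_comp r a f by blast+
    define m where "m = plus_mor Y Z (F 0 \<cdot> r) (F 1 \<cdot> g)"
    have m: "arr m Y Z" unfolding m_def using arr_plus[OF c] .
    have "m \<cdot> s = plus_mor X Z (F 0) (zero_mor X Z)"
      unfolding m_def using plus_comp[OF s c] assoc[OF s r f(1)] assoc[OF s a(2) f(2)] rs gs
        id_right[OF f(1)] comp_zero[OF f(2) o(1)] by simp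
    then have ms: "m \<cdot> s = F 0" using plus_zero[OF f(1)] by simp
    have "m \<cdot> j = plus_mor X' Z (zero_mor X' Z) (F 1)"
      unfolding m_def using plus_comp[OF j c] assoc[OF j r f(1)] assoc[OF j a(2) f(2)] rj gj
        id_right[OF f(2)] comp_zero[OF f(1) o(3)] by simp
    then have mj: "m \<cdot> j = F 1" using plus_zero[OF f(2)] by simp
    \<comment> \<open>The difference vanishes on \<open>s\<close>, so it factors through
      \<open>g\<close>; the factor is recovered by composing with \<open>j\<close>, where the
      difference vanishes too.\<close>
    have uniq: "n = m" if n: "arr n Y Z" and ns: "n \<cdot> s = F 0" and nj: "n \<cdot> j = F 1" for n
    proof -
      define e where "e = diff Y Z n m"
      have e: "arr e Y Z" unfolding e_def using arr_diff[OF n m] .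
      have "e \<cdot> s = zero_mor X Z"
        unfolding e_def using diff_comp[OF s Z n m] ns ms diff_zero_iff[OF f(1) f(1)] by simp
      then obtain k where k: "arr k X' Z" "k \<cdot> g = e" using Tri_colift[OF T e] by blast
      have "k = e \<cdot> j" using assoc[OF j a(2) k(1)] k(2) gj id_right[OF k(1)] by simp
      also have "\<dots> = zero_mor X' Z"
        unfolding e_def using diff_comp[OF j Z n m] nj mj diff_zero_iff[OF f(2) f(2)] by simp
      finally have "e = zero_mor Y Z" using k(2) zero_comp[OF a(2) Z] by simp
      then show ?thesis unfolding e_def using diff_zero_iff[OF n m] by simp
    qed
    show ?thesis
    proof (rule ex1I[of _ m])
      show "m \<in> Hom D Y Z \<and> (\<forall>i<length [X, X']. m \<cdot> ?\<iota> i = F i)"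
        using arrD(3)[OF m] ms mj by (auto simp: less_Suc_eq)
    next
      fix n assume *: "n \<in> Hom D Y Z \<and> (\<forall>i<length [X, X']. n \<cdot> ?\<iota> i = F i)"
      then have "n \<cdot> s = F 0" "n \<cdot> j = F 1" by force+
      then show "n = m" using uniq * o Z unfolding arr_def by blast
    qed
  qed
  have "coproduct D [X, X'] Y"
    unfolding coproduct_def
  proof (intro conjI exI[of _ ?\<iota>] ballI allI impI)
    show "set [X, X'] \<subseteq> Obj D" "Y \<in> Obj D" using o by auto
    show "?\<iota> i \<in> Hom D ([X, X'] ! i) Y" if "i < length [X, X']" for i
      using that arrD(3)[OF s] arrD(3)[OF j] by (auto simp: less_Suc_eq)
  qed (rule univ)
  moreover have "s \<cdot> r = ide D Y" if z: "zero_obj D X'"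
  proof -
    have "iso_mor D X Y s" using Tri_iso_if_zero[OF T z] .
    then obtain s' where s': "iso_mor D Y X s'" "s' \<cdot> s = ide D X" "s \<cdot> s' = ide D Y" by (rule iso_mor_inverse)
    have "r \<cdot> s = s' \<cdot> s" using s' rs by simp
    then have "r = s'" using iso_mor_cancel_right[OF \<open>iso_mor D X Y s\<close> r iso_mor_arr[OF s'(1)]] by blast
    then show ?thesis using s' by simp
  qed
  ultimately show ?thesis by (rule that)
qed

lemma direct_summand_iff: "direct_summand D X Y \<longleftrightarrow> retract X Y"
proof
  assume "direct_summand D X Y"
  then obtain X' where "coproduct D [X, X'] Y" unfolding direct_summand_def by blast
  then obtain i where o: "X \<in> Obj D" "X' \<in> Obj D" "Y \<in> Obj D"
    and i: "\<forall>j<2. i j \<in> Hom D ([X, X'] ! j) Y"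
    and u: "\<And>Z F. Z \<in> Obj D \<Longrightarrow> \<forall>j<2. F j \<in> Hom D ([X, X'] ! j) Z \<Longrightarrow>
      \<exists>!g. g \<in> Hom D Y Z \<and> (\<forall>j<2. g \<cdot> i j = F j)"
    unfolding coproduct_def by (auto simp: numeral_2_eq_2)
  let ?F = "\<lambda>j::nat. if j = 0 then ide D X else zero_mor X' X"
  have "\<forall>j<2. ?F j \<in> Hom D ([X, X'] ! j) X"
    using arrD(3)[OF arr_ide[OF o(1)]] arrD(3)[OF arr_zero[OF o(2,1)]] by (auto simp: less_2_cases_iff)
  from u[OF o(1) this] obtain r where r: "r \<in> Hom D Y X" "\<forall>j<2. r \<cdot> i j = ?F j" by blast
  have "r \<cdot> i 0 = ide D X" "i 0 \<in> Hom D X Y" using r i by force+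
  then show "retract X Y" unfolding retract_def arr_def using r o by blast
next
  assume "retract X Y"
  then show "direct_summand D X Y"
    unfolding retract_def direct_summand_def using coproduct_complement by metis
qed

lemma summand_closure_eq: "summand_closure D S = {X. \<exists>Y\<in>S. retract X Y}"
  unfolding summand_closure_def direct_summand_iff ..

end

section \<open>Extension closures and truncation\<close>

context triangulated_category
begin

text \<open>The extension closure in a form suited to induction: a filtration is built by adding one
  generator at a time as its first factor. Agreement with the closure is
  \<open>extension_closure_eq\<close>.\<close>

inductive_set filt :: "'o set \<Rightarrow> 'o set" for A where
  zero: "zero_obj D Z \<Longrightarrow> Z \<in> filt A"
| step: "X \<in> A \<Longrightarrow> Z \<in> filt A \<Longrightarrow> tri X Y Z \<Longrightarrow> Y \<in> filt A"

lemma filt_Obj: "X \<in> filt A \<Longrightarrow> X \<in> Obj D"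
  by (induction rule: filt.induct) (auto dest: zero_obj_Obj tri_Obj)

lemma filt_iso: "X \<in> filt A \<Longrightarrow> isomorphic D X Y \<Longrightarrow> Y \<in> filt A"
  by (induction rule: filt.induct) (blast intro: filt.intros zero_obj_iso tri_iso_mid)+

lemma filt_incl: "A \<subseteq> Obj D \<Longrightarrow> A \<subseteq> filt A"
  using ex_zero_obj filt.intros tri_zero_right by (metis subset_iff)

text \<open>Filtrations are concatenated: regrouping leaves the first generator in front and passes
  the rest to the induction.\<close>

lemma filt_ext: "X \<in> filt A \<Longrightarrow> Z \<in> filt A \<Longrightarrow> tri X Y Z \<Longrightarrow> Y \<in> filt A"
proof (induction arbitrary: Y rule: filt.induct)
  case (zero W)
  then show ?case using tri_iso_right isomorphic_sym filt_iso by blast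
next
  case (step X Z' W)
  then obtain E where "tri X Y E" "tri Z' E Z" using tri_assoc_right by blast
  then show ?case using step filt.step by blast
qed

lemma extension_closed_iff:
  "extension_closed D S \<longleftrightarrow> S \<subseteq> Obj D \<and> iso_closed D S \<and> {X. zero_obj D X} \<subseteq> S \<and>
     (\<forall>X Y Z. tri X Y Z \<and> X \<in> S \<and> Z \<in> S \<longrightarrow> Y \<in> S)"
  unfolding extension_closed_def tri_def by blast

lemma filt_subset:
  assumes S: "extension_closed D S" "A \<subseteq> S" and X: "X \<in> filt A"
  shows "X \<in> S"
  using X
proof (induction rule: filt.induct)
  case (zero Z)
  then show ?case using S unfolding extension_closed_iff by blast
next
  case (step X Z Y)
  then show ?case using S unfolding extension_closed_iff by blast
qed

lemma extension_closed_filt: "extension_closed D (filt A)"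
  unfolding extension_closed_iff iso_closed_def using filt_Obj filt_iso filt.zero filt_ext by blast

lemma extension_closure_eq: "A \<subseteq> Obj D \<Longrightarrow> extension_closure D A = filt A"
  unfolding extension_closure_def using filt_subset[of _ A] extension_closed_filt[of A] filt_incl[of A] by blast

text \<open>An arbitrary set of degrees covers the two halves of a t-structure or weight structure,
  their shifts, and the whole triangulated closure at once.\<close>

definition shifts :: "'o set \<Rightarrow> int set \<Rightarrow> 'o set" where
  "shifts A M = {X\<langle>m\<rangle> | X m. X \<in> A \<and> m \<in> M}"

abbreviation filt_shifts :: "'o set \<Rightarrow> int set \<Rightarrow> 'o set" where
  "filt_shifts A M \<equiv> filt (shifts A M)"

lemma shifts_Obj: "A \<subseteq> Obj D \<Longrightarrow> shifts A M \<subseteq> Obj D"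
  unfolding shifts_def using shift_obj_closed by blast

lemma shifts_Un: "shifts A (M \<union> N) = shifts A M \<union> shifts A N"
  unfolding shifts_def by blast

lemma filt_mono: "A \<subseteq> B \<Longrightarrow> X \<in> filt A \<Longrightarrow> X \<in> filt B"
  by (rotate_tac 1, induction rule: filt.induct) (auto intro: filt.intros)

lemma filt_shifts_mono: "X \<in> filt_shifts A M \<Longrightarrow> M \<subseteq> N \<Longrightarrow> X \<in> filt_shifts A N"
  by (rule filt_mono[of "shifts A M"]) (auto simp: shifts_def)

lemma filt_shifts_incl: "A \<subseteq> Obj D \<Longrightarrow> X \<in> A \<Longrightarrow> m \<in> M \<Longrightarrow> X\<langle>m\<rangle> \<in> filt_shifts A M"
  using filt_incl[OF shifts_Obj[of A M]] unfolding shifts_def by blast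

lemma filt_shifts_incl0: "A \<subseteq> Obj D \<Longrightarrow> X \<in> A \<Longrightarrow> 0 \<in> M \<Longrightarrow> X \<in> filt_shifts A M"
  using filt_shifts_incl[of A X 0 M] shift_obj_0[of X] by auto

lemma filt_shifts_shift:
  assumes "A \<subseteq> Obj D"
  shows "X \<in> filt_shifts A M \<Longrightarrow> X\<langle>n\<rangle> \<in> filt_shifts A ((+) n ` M)"
proof (induction rule: filt.induct)
  case (zero Z)
  then show ?case using zero_obj_shift filt.zero by blast
next
  case (step X Z Y)
  have "X\<langle>n\<rangle> \<in> shifts A ((+) n ` M)"
    using step(1) assms unfolding shifts_def by (force simp: shift_obj_add add.commute)
  then show ?case using step tri_shift filt.step by blast
qed

lemma shift_set_filt_shifts:
  assumes "A \<subseteq> Obj D"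
  shows "shift_set D (filt_shifts A M) n = filt_shifts A ((+) n ` M)"
proof (intro equalityI subsetI)
  fix X assume "X \<in> shift_set D (filt_shifts A M) n"
  then show "X \<in> filt_shifts A ((+) n ` M)" unfolding shift_set_def using filt_shifts_shift[OF assms] by auto
next
  fix X assume X: "X \<in> filt_shifts A ((+) n ` M)"
  then have "X\<langle>- n\<rangle> \<in> filt_shifts A M"
    using filt_shifts_shift[OF assms X, of "- n"] by (simp add: image_image)
  moreover have "X = X\<langle>- n\<rangle>\<langle>n\<rangle>" using shift_obj_back filt_Obj[OF X] by simp
  ultimately show "X \<in> shift_set D (filt_shifts A M) n" unfolding shift_set_def by blast
qed

text \<open>The insertion step of a sort: one generator \<open>x\<close> from \<open>V\<close> moves
  to the right past the factors from \<open>U\<close>. If it meets a factor with invertible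
  connecting morphism, both disappear and the insertion stops.\<close>

lemma filt_insert_sort:
  assumes cond: "\<And>u x h. u \<in> U \<Longrightarrow> x \<in> V \<Longrightarrow> arr h u (x\<langle>1\<rangle>) \<Longrightarrow>
      h = zero_mor u (x\<langle>1\<rangle>) \<or> iso_mor D u (x\<langle>1\<rangle>) h"
    and V: "V \<subseteq> Obj D" and x: "x \<in> V"
  shows "W \<in> filt U \<Longrightarrow> tri x Y W \<Longrightarrow> \<exists>A\<in>filt U. \<exists>B\<in>filt V. tri A Y B"
proof (induction arbitrary: Y rule: filt.induct)
  case (zero W)
  then have "Y \<in> filt V" using tri_iso_left filt_iso filt_incl[OF V] x by blast
  moreover have "tri W Y Y" using zero tri_zero_left tri_Obj by blast
  ultimately show ?case using zero filt.zero by blast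
next
  case (step u W' W)
  obtain E where E: "tri x E u" "tri E Y W'" using tri_assoc_left[OF step.prems step.hyps(3)] by blast
  then obtain f g h where T: "(x, E, u, f, g, h) \<in> Tri D" unfolding tri_def by blast
  from cond[OF step.hyps(1) x Tri_arr(3)[OF T]] show ?case
  proof
    assume "iso_mor D u (x\<langle>1\<rangle>) h"
    then have "zero_obj D E" using tri_cancel[OF T] by blast
    then have "Y \<in> filt U" using E(2) tri_iso_right isomorphic_sym filt_iso step.hyps(2) by blast
    moreover obtain O' where "zero_obj D O'" by (rule ex_zero_obj)
    ultimately show ?thesis using filt.zero tri_zero_right filt_Obj by blast
  next
    assume "h = zero_mor u (x\<langle>1\<rangle>)"
    then have "tri u E x" using tri_swap[OF T] by blast
    then obtain Y' where Y': "tri u Y Y'" "tri x Y' W'" using tri_assoc_right E(2) by blast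
    then obtain A B where AB: "A \<in> filt U" "B \<in> filt V" "tri A Y' B" using step.IH by blast
    then obtain E2 where "tri u E2 A" "tri E2 Y B" using tri_assoc_left[OF Y'(1) AB(3)] by blast
    then show ?thesis using AB filt.step[OF step.hyps(1)] by blast
  qed
qed

text \<open>
  Generators in the wrong order can be exchanged or cancelled because the connecting morphism
  between them is zero or invertible.
\<close>

lemma filt_sort:
  assumes cond: "\<And>u x h. u \<in> U \<Longrightarrow> x \<in> V \<Longrightarrow> arr h u (x\<langle>1\<rangle>) \<Longrightarrow>
      h = zero_mor u (x\<langle>1\<rangle>) \<or> iso_mor D u (x\<langle>1\<rangle>) h"
    and V: "V \<subseteq> Obj D"
  shows "Y \<in> filt (U \<union> V) \<Longrightarrow> \<exists>A\<in>filt U. \<exists>B\<in>filt V. tri A Y B"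
proof (induction rule: filt.induct)
  case (zero Z)
  then show ?case using filt.zero tri_zero_right zero_obj_Obj by blast
next
  case (step x Y' Y)
  then obtain A B where AB: "A \<in> filt U" "B \<in> filt V" "tri A Y' B" by blast
  then obtain E where E: "tri x E A" "tri E Y B" using tri_assoc_left[OF step.hyps(3)] by blast
  from step.hyps(1) show ?case
  proof
    assume "x \<in> U"
    then show ?thesis using filt.step AB E by blast
  next
    assume x: "x \<in> V"
    then obtain A' B' where A': "A' \<in> filt U" "B' \<in> filt V" "tri A' E B'"
      using filt_insert_sort[OF cond V x AB(1) E(1)] by blast
    then obtain Y'' where "tri A' Y Y''" "tri B' Y'' B" using tri_assoc_right E(2) by blast
    then show ?thesis using A' AB filt_ext by blast
  qed
qed

section \<open>Triangulated closures as iterated extensions\<close>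

lemma triangulated_subcategory_iff:
  "triangulated_subcategory D S \<longleftrightarrow> S \<subseteq> Obj D \<and> iso_closed D S \<and> {X. zero_obj D X} \<subseteq> S \<and>
     (\<forall>X\<in>S. \<forall>m. X\<langle>m\<rangle> \<in> S) \<and> (\<forall>X Y Z. tri X Y Z \<and> X \<in> S \<and> Y \<in> S \<longrightarrow> Z \<in> S)"
  unfolding triangulated_subcategory_def tri_def by blast

text \<open>With all shifts available, cones are extensions: the cone of a morphism from
  \<open>X\<close> to \<open>Y\<close> is an extension with factors \<open>Y\<close> and
  \<open>X[1]\<close>.\<close>

lemma triangulated_filt_shifts:
  assumes A: "A \<subseteq> Obj D"
  shows "triangulated_subcategory D (filt_shifts A UNIV)"
proof -
  have sh: "X\<langle>m\<rangle> \<in> filt_shifts A UNIV" if "X \<in> filt_shifts A UNIV" for X m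
    using filt_shifts_shift[OF A that, of m] by simp
  moreover have "Z \<in> filt_shifts A UNIV"
    if "tri X Y Z" "X \<in> filt_shifts A UNIV" "Y \<in> filt_shifts A UNIV" for X Y Z
    using that tri_rotate(1) sh filt_ext by blast
  ultimately show ?thesis
    unfolding triangulated_subcategory_iff iso_closed_def using filt_Obj filt_iso filt.zero by blast
qed

lemma triangulated_closure_subset:
  assumes "A \<subseteq> Obj D"
  shows "triangulated_closure D A \<subseteq> filt_shifts A UNIV"
  unfolding triangulated_closure_def
  using triangulated_filt_shifts[OF assms] filt_shifts_incl0[OF assms, of _ UNIV] by blast

subsection \<open>Vanishing of morphisms\<close>

lemma Hom_zero_zero_obj: "zero_obj D X \<Longrightarrow> Y \<in> Obj D \<Longrightarrow> Hom_zero D X Y"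
  "zero_obj D X \<Longrightarrow> Y \<in> Obj D \<Longrightarrow> Hom_zero D Y X"
  using Hom_zero_iff zero_obj_Obj zero_obj_from zero_obj_to by blast+

lemma Hom_zero_self: "X \<in> Obj D \<Longrightarrow> Hom_zero D X X \<Longrightarrow> zero_obj D X"
  unfolding zero_obj_def using Hom_zeroD arr_ide by blast

lemma Hom_zero_retract_left:
  assumes "Hom_zero D X Y" "retract X' X" "Y \<in> Obj D"
  shows "Hom_zero D X' Y"
proof -
  obtain s r where s: "arr s X' X" "arr r X X'" "r \<cdot> s = ide D X'" using assms unfolding retract_def by blast
  have "f = zero_mor X' Y" if f: "arr f X' Y" for f
  proof -
    have "f \<cdot> r = zero_mor X Y" using Hom_zeroD[OF assms(1) arr_comp[OF s(2) f]] .
    then show ?thesis using assoc[OF s(1,2) f] s(3) id_right[OF f] zero_comp[OF s(1) assms(3)] by simp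
  qed
  then show ?thesis using Hom_zero_iff arrD(1)[OF s(1)] assms(3) by blast
qed

lemma Hom_zero_retract_right:
  assumes "Hom_zero D X Y" "retract Y' Y" "X \<in> Obj D"
  shows "Hom_zero D X Y'"
proof -
  obtain s r where s: "arr s Y' Y" "arr r Y Y'" "r \<cdot> s = ide D Y'" using assms unfolding retract_def by blast
  have "f = zero_mor X Y'" if f: "arr f X Y'" for f
  proof -
    have "s \<cdot> f = zero_mor X Y" using Hom_zeroD[OF assms(1) arr_comp[OF f s(1)]] .
    then show ?thesis using assoc[OF f s(1,2)] s(3) id_left[OF f] comp_zero[OF s(2) assms(3)] by simp
  qed
  then show ?thesis using Hom_zero_iff arrD(1)[OF s(1)] assms(3) by blast
qed

text \<open>A morphism out of \<open>Y\<close> that vanishes on \<open>X\<close> factors through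
  \<open>Z\<close>. Together with \<open>filt_subset\<close> this is the devissage in the first
  variable.\<close>

lemma extension_closed_left_perp:
  assumes S: "S \<subseteq> Obj D"
  shows "extension_closed D {X \<in> Obj D. \<forall>Y\<in>S. Hom_zero D X Y}"
  unfolding extension_closed_iff iso_closed_def
proof (intro conjI allI impI ballI subsetI)
  fix X assume "X \<in> {X. zero_obj D X}"
  then show "X \<in> {X \<in> Obj D. \<forall>Y\<in>S. Hom_zero D X Y}" using Hom_zero_zero_obj zero_obj_Obj S by blast
next
  fix X Y assume "X \<in> {X \<in> Obj D. \<forall>Y\<in>S. Hom_zero D X Y}" "isomorphic D X Y"
  then show "Y \<in> {X \<in> Obj D. \<forall>Y\<in>S. Hom_zero D X Y}"
    using Hom_zero_retract_left retract_iso isomorphic_sym isomorphic_Obj S by blast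
next
  fix X Y Z assume *: "tri X Y Z \<and> X \<in> {X \<in> Obj D. \<forall>Y\<in>S. Hom_zero D X Y}
    \<and> Z \<in> {X \<in> Obj D. \<forall>Y\<in>S. Hom_zero D X Y}"
  then obtain f g h where T: "(X, Y, Z, f, g, h) \<in> Tri D" unfolding tri_def by blast
  note a = Tri_arr[OF T]
  have "v = zero_mor Y W" if W: "W \<in> S" and v: "arr v Y W" for v W
  proof -
    have "v \<cdot> f = zero_mor X W" using * W Hom_zeroD arr_comp[OF a(1) v] by blast
    then obtain c where c: "arr c Z W" "c \<cdot> g = v" using Tri_colift[OF T v] by blast
    then have "c = zero_mor Z W" using * W Hom_zeroD by blast
    then show ?thesis using c zero_comp[OF a(2) arrD(2)[OF v]] by simp
  qed
  then show "Y \<in> {X \<in> Obj D. \<forall>Y\<in>S. Hom_zero D X Y}"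
    using S Hom_zero_iff arrD(1)[OF a(2)] by blast
qed auto

lemma extension_closed_right_perp:
  assumes S: "S \<subseteq> Obj D"
  shows "extension_closed D {Y \<in> Obj D. \<forall>X\<in>S. Hom_zero D X Y}"
  unfolding extension_closed_iff iso_closed_def
proof (intro conjI allI impI ballI subsetI)
  fix X assume "X \<in> {X. zero_obj D X}"
  then show "X \<in> {Y \<in> Obj D. \<forall>X\<in>S. Hom_zero D X Y}" using Hom_zero_zero_obj zero_obj_Obj S by blast
next
  fix X Y assume "X \<in> {Y \<in> Obj D. \<forall>X\<in>S. Hom_zero D X Y}" "isomorphic D X Y"
  then show "Y \<in> {Y \<in> Obj D. \<forall>X\<in>S. Hom_zero D X Y}"
    using Hom_zero_retract_right retract_iso isomorphic_sym isomorphic_Obj S by blast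
next
  fix X Y Z assume *: "tri X Y Z \<and> X \<in> {Y \<in> Obj D. \<forall>X\<in>S. Hom_zero D X Y}
    \<and> Z \<in> {Y \<in> Obj D. \<forall>X\<in>S. Hom_zero D X Y}"
  then obtain f g h where T: "(X, Y, Z, f, g, h) \<in> Tri D" unfolding tri_def by blast
  note a = Tri_arr[OF T]
  have "v = zero_mor W Y" if W: "W \<in> S" and v: "arr v W Y" for v W
  proof -
    have "g \<cdot> v = zero_mor W Z" using * W Hom_zeroD arr_comp[OF v a(2)] by blast
    then obtain c where c: "arr c W X" "f \<cdot> c = v" using Tri_lift[OF T v] by blast
    then have "c = zero_mor W X" using * W Hom_zeroD by blast
    then show ?thesis using c comp_zero[OF a(1) arrD(1)[OF v]] by simp
  qed
  then show "Y \<in> {Y \<in> Obj D. \<forall>X\<in>S. Hom_zero D X Y}"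
    using S Hom_zero_iff arrD(1)[OF a(2)] by blast
qed auto

lemma Hom_zero_filt_left:
  assumes "X \<in> filt_shifts A M" "A \<subseteq> Obj D" "Y \<in> Obj D"
    and "\<And>P m. P \<in> A \<Longrightarrow> m \<in> M \<Longrightarrow> Hom_zero D P (Y\<langle>- m\<rangle>)"
  shows "Hom_zero D X Y"
proof -
  have "Hom_zero D (P\<langle>m\<rangle>) Y" if "P \<in> A" "m \<in> M" for P m
    using Hom_zero_shift_iff[of P Y m 0] assms(2-4) that by (auto simp: shift_obj_0)
  then have "shifts A M \<subseteq> {X \<in> Obj D. \<forall>Y\<in>{Y}. Hom_zero D X Y}"
    using assms(2) shift_obj_closed unfolding shifts_def by blast
  then show ?thesis using filt_subset[OF extension_closed_left_perp _ assms(1)] assms(3) by blast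
qed

lemma Hom_zero_filt_right:
  assumes "Y \<in> filt_shifts A M" "A \<subseteq> Obj D" "X \<in> Obj D"
    and "\<And>L m. L \<in> A \<Longrightarrow> m \<in> M \<Longrightarrow> Hom_zero D X (L\<langle>m\<rangle>)"
  shows "Hom_zero D X Y"
proof -
  have "shifts A M \<subseteq> {Y \<in> Obj D. \<forall>X\<in>{X}. Hom_zero D X Y}"
    using assms(2,4) shift_obj_closed unfolding shifts_def by blast
  then show ?thesis using filt_subset[OF extension_closed_right_perp _ assms(1)] assms(3) by blast
qed

lemma Hom_zero_filt:
  assumes X: "X \<in> filt_shifts A M" and Y: "Y \<in> filt_shifts B N" and o: "A \<subseteq> Obj D" "B \<subseteq> Obj D"
    and "\<And>P m L n. P \<in> A \<Longrightarrow> m \<in> M \<Longrightarrow> L \<in> B \<Longrightarrow> n \<in> N \<Longrightarrow> Hom_zero D P (L\<langle>n - m\<rangle>)"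
  shows "Hom_zero D X Y"
proof (rule Hom_zero_filt_right[OF Y o(2) filt_Obj[OF X]])
  fix L n assume L: "L \<in> B" "n \<in> N"
  then have "L \<in> Obj D" using o by blast
  then show "Hom_zero D X (L\<langle>n\<rangle>)"
    using Hom_zero_filt_left[OF X o(1), of "L\<langle>n\<rangle>"] assms(5) L by (simp add: shift_obj_add shift_obj_closed)
qed

subsection \<open>t-structures\<close>

lemma t_structureD:
  assumes "t_structure D t"
  shows "X \<in> fst t \<Longrightarrow> X \<in> Obj D" "X \<in> snd t \<Longrightarrow> X \<in> Obj D"
    "X \<in> fst t \<Longrightarrow> X\<langle>1\<rangle> \<in> fst t" "X \<in> snd t \<Longrightarrow> X\<langle>-1\<rangle> \<in> snd t"
    "X \<in> fst t \<Longrightarrow> isomorphic D X Y \<Longrightarrow> Y \<in> fst t"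
    "X \<in> snd t \<Longrightarrow> isomorphic D X Y \<Longrightarrow> Y \<in> snd t"
    "X \<in> fst t \<Longrightarrow> Y \<in> t_greater D t \<Longrightarrow> Hom_zero D X Y"
    "X \<in> Obj D \<Longrightarrow> \<exists>A\<in>fst t. \<exists>B\<in>t_greater D t. tri A X B"
proof -
  have *: "fst t \<subseteq> Obj D" "snd t \<subseteq> Obj D" "iso_closed D (fst t)" "iso_closed D (snd t)"
    "shift_set D (fst t) 1 \<subseteq> fst t" "shift_set D (snd t) (-1) \<subseteq> snd t"
    "orthogonal D (fst t) (t_greater D t)"
    "\<forall>X\<in>Obj D. \<exists>A\<in>fst t. \<exists>B\<in>t_greater D t. tri A X B"
    using assms unfolding t_structure_def tri_def by simp_all
  show "X \<in> fst t \<Longrightarrow> X \<in> Obj D" "X \<in> snd t \<Longrightarrow> X \<in> Obj D" using *(1,2) by blast+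
  show "X \<in> fst t \<Longrightarrow> X\<langle>1\<rangle> \<in> fst t" "X \<in> snd t \<Longrightarrow> X\<langle>-1\<rangle> \<in> snd t"
    using *(5,6) unfolding shift_set_def by blast+
  show "X \<in> fst t \<Longrightarrow> isomorphic D X Y \<Longrightarrow> Y \<in> fst t" "X \<in> snd t \<Longrightarrow> isomorphic D X Y \<Longrightarrow> Y \<in> snd t"
    using *(3,4) unfolding iso_closed_def by blast+
  show "X \<in> fst t \<Longrightarrow> Y \<in> t_greater D t \<Longrightarrow> Hom_zero D X Y"
    using *(7) unfolding orthogonal_def by blast
  show "X \<in> Obj D \<Longrightarrow> \<exists>A\<in>fst t. \<exists>B\<in>t_greater D t. tri A X B" using *(8) by blast
qed

lemma t_greater_iff:
  assumes "t_structure D t" "X \<in> Obj D"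
  shows "X \<in> t_greater D t \<longleftrightarrow> X\<langle>1\<rangle> \<in> snd t"
proof
  assume "X \<in> t_greater D t"
  then show "X\<langle>1\<rangle> \<in> snd t"
    unfolding t_greater_def shift_set_def using shift_obj_back(2)[of _ 1] t_structureD(2)[OF assms(1)] by auto
next
  assume "X\<langle>1\<rangle> \<in> snd t"
  moreover have "X = X\<langle>1\<rangle>\<langle>-1\<rangle>" using shift_obj_back(1)[OF assms(2), of 1] by simp
  ultimately show "X \<in> t_greater D t" unfolding t_greater_def shift_set_def by blast
qed

lemma t_less_iff:
  assumes "t_structure D t" "X \<in> Obj D"
  shows "X \<in> t_less D t \<longleftrightarrow> X\<langle>-1\<rangle> \<in> fst t"
proof
  assume "X \<in> t_less D t"
  then show "X\<langle>-1\<rangle> \<in> fst t"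
    unfolding t_less_def shift_set_def using shift_obj_back(1)[of _ 1] t_structureD(1)[OF assms(1)] by auto
next
  assume "X\<langle>-1\<rangle> \<in> fst t"
  moreover have "X = X\<langle>-1\<rangle>\<langle>1\<rangle>" using shift_obj_back(2)[OF assms(2), of 1] by simp
  ultimately show "X \<in> t_less D t" unfolding t_less_def shift_set_def by blast
qed

lemma t_greater_Obj: "t_structure D t \<Longrightarrow> X \<in> t_greater D t \<Longrightarrow> X \<in> Obj D"
  unfolding t_greater_def shift_set_def using t_structureD(2) shift_obj_closed by blast

lemma t_less_Obj: "t_structure D t \<Longrightarrow> X \<in> t_less D t \<Longrightarrow> X \<in> Obj D"
  unfolding t_less_def shift_set_def using t_structureD(1) shift_obj_closed by blast

lemma t_less_le: "t_structure D t \<Longrightarrow> X \<in> t_less D t \<Longrightarrow> X \<in> fst t"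
  unfolding t_less_def shift_set_def using t_structureD(3) by blast

lemma t_less_Hom_zero:
  assumes t: "t_structure D t" and X: "X \<in> t_less D t" and Y: "Y \<in> snd t"
  shows "Hom_zero D X Y"
proof -
  have o: "X \<in> Obj D" "Y \<in> Obj D" using t_less_Obj t_structureD(2) assms by blast+
  have "X\<langle>-1\<rangle> \<in> fst t" using t_less_iff[OF t o(1)] X by simp
  moreover have "Y\<langle>-1\<rangle> \<in> t_greater D t" unfolding t_greater_def shift_set_def using Y by blast
  ultimately have "Hom_zero D (X\<langle>-1\<rangle>) (Y\<langle>-1\<rangle>)" using t_structureD(7)[OF t] by blast
  then show ?thesis using Hom_zero_shift_iff[OF o, of "-1" "-1"] o by (simp add: shift_obj_0)
qed

text \<open>Since \<open>g\<close> vanishes, the identity of \<open>B\<close> factors through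
  \<open>A[1]\<close>; but morphisms from \<open>A[1]\<close> to \<open>B\<close> are zero, so
  \<open>B\<close> is zero.\<close>

lemma t_triangle_iso_left:
  assumes t: "t_structure D t" and T: "(A, X, B, f, g, h) \<in> Tri D"
    and A: "A \<in> fst t" and B: "B \<in> t_greater D t" and g0: "Hom_zero D X B"
  shows "iso_mor D A X f"
proof -
  note a = Tri_arr[OF T]
  have Bo: "B \<in> Obj D" using a arrD by blast
  have "ide D B \<cdot> g = zero_mor X B" using id_left[OF a(2)] Hom_zeroD[OF g0 a(2)] by simp
  then obtain c where c: "arr c (A\<langle>1\<rangle>) B" "c \<cdot> h = ide D B" using Tri_colift2[OF T arr_ide[OF Bo]] by blast
  then have "c = zero_mor (A\<langle>1\<rangle>) B" using t_structureD(3,7)[OF t] A B Hom_zeroD by blast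
  then have "zero_obj D B" using c(2) zero_comp[OF a(3) Bo] Bo unfolding zero_obj_def by simp
  then show ?thesis using Tri_iso_if_zero[OF T] by blast
qed

lemma t_structure_left_perp:
  assumes t: "t_structure D t" and X: "X \<in> Obj D"
    and perp: "\<And>Y. Y \<in> t_greater D t \<Longrightarrow> Hom_zero D X Y"
  shows "X \<in> fst t"
proof -
  obtain A B f g h where "A \<in> fst t" "B \<in> t_greater D t" "(A, X, B, f, g, h) \<in> Tri D"
    using t_structureD(8)[OF t X] unfolding tri_def by blast
  then show ?thesis
    using t_triangle_iso_left[OF t] perp t_structureD(5)[OF t] unfolding isomorphic_def by blast
qed

text \<open>Dually to the aisle: \<open>f\<close> vanishes, so the identity of \<open>A\<close>
  factors through \<open>B[-1]\<close>, which still lies in \<open>t_greater D t\<close>. Hence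
  \<open>A\<close> is zero.\<close>

lemma t_structure_right_perp:
  assumes t: "t_structure D t" and Y: "Y \<in> Obj D"
    and perp: "\<And>X. X \<in> fst t \<Longrightarrow> Hom_zero D X Y"
  shows "Y \<in> t_greater D t"
proof -
  obtain A B f g h where AB: "A \<in> fst t" "B \<in> t_greater D t" and T: "(A, Y, B, f, g, h) \<in> Tri D"
    using t_structureD(8)[OF t Y] unfolding tri_def by blast
  note a = Tri_arr[OF T]
  note T' = Tri_rotate_left[OF T]
  have o: "A \<in> Obj D" "B \<in> Obj D" using a arrD by blast+
  have "f \<cdot> ide D A = zero_mor A Y" using id_right[OF a(1)] Hom_zeroD[OF perp[OF AB(1)] a(1)] by simp
  then obtain c where c: "arr c A (B\<langle>-1\<rangle>)" "neg (B\<langle>-1\<rangle>) A (h\<llangle>-1\<rrangle>) \<cdot> c = ide D A"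
    using Tri_lift[OF T' arr_ide[OF o(1)]] by blast
  have "B\<langle>1\<rangle> \<in> snd t" using t_greater_iff[OF t o(2)] AB by blast
  then have "B\<langle>-1\<rangle> \<in> t_greater D t"
    using t_structureD(4)[OF t, of "B\<langle>1\<rangle>"] t_greater_iff[OF t shift_obj_closed[OF o(2)], of "-1"] o
    by (simp add: shift_obj_add)
  then have "c = zero_mor A (B\<langle>-1\<rangle>)" using t_structureD(7)[OF t AB(1)] Hom_zeroD c(1) by blast
  then have "zero_obj D A" using c(2) comp_zero[OF Tri_arr(1)[OF T'] o(1)] o unfolding zero_obj_def by simp
  then have "isomorphic D B Y" using tri_iso_right T isomorphic_sym unfolding tri_def by blast
  then have "isomorphic D (B\<langle>1\<rangle>) (Y\<langle>1\<rangle>)" using isomorphic_shift by blast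
  then show ?thesis using t_structureD(6)[OF t \<open>B\<langle>1\<rangle> \<in> snd t\<close>] t_greater_iff[OF t Y] by blast
qed

text \<open>Each half determines the other as an orthogonal, so enlarging one half would force the
  other to shrink.\<close>

lemma t_structure_eqI:
  assumes t: "t_structure D t" and t': "t_structure D t'" and "fst t \<subseteq> fst t'" "snd t \<subseteq> snd t'"
  shows "t = t'"
proof -
  have g: "t_greater D t \<subseteq> t_greater D t'" using assms(4) unfolding t_greater_def shift_set_def by blast
  have "fst t' \<subseteq> fst t"
  proof
    fix X assume "X \<in> fst t'"
    then show "X \<in> fst t" using t_structure_left_perp[OF t] t_structureD(1,7)[OF t'] g by blast
  qed
  moreover have "snd t' \<subseteq> snd t"
  proof
    fix Y assume Y: "Y \<in> snd t'"
    have o: "Y \<in> Obj D" using Y t_structureD(2)[OF t'] by blast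
    have "Y\<langle>-1\<rangle> \<in> t_greater D t'" unfolding t_greater_def shift_set_def using Y by blast
    then have "Y\<langle>-1\<rangle> \<in> t_greater D t"
      using t_structure_right_perp[OF t shift_obj_closed[OF o]] t_structureD(7)[OF t'] assms(3) by blast
    then show "Y \<in> snd t"
      using t_greater_iff[OF t shift_obj_closed[OF o], of "-1"] shift_obj_back(2)[OF o, of 1] by simp
  qed
  ultimately show ?thesis using assms(3,4) by (simp add: prod_eq_iff subset_antisym)
qed

end

section \<open>Simple-minded and silting collections\<close>

context triangulated_category
begin

section \<open>The t-structure of a simple-minded collection\<close>

lemma simple_minded_Obj: "simple_minded_collection D \<L> \<Longrightarrow> \<L> \<subseteq> Obj D"
  by (simp add: simple_minded_collection_def)

lemma simple_minded_Hom_zero: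
  assumes "simple_minded_collection D \<L>" "L \<in> \<L>" "L' \<in> \<L>"
  shows "m < 0 \<Longrightarrow> Hom_zero D L (L'\<langle>m\<rangle>)" "L \<noteq> L' \<Longrightarrow> Hom_zero D L L'"
  using assms unfolding simple_minded_collection_def by blast+

lemma simple_minded_endo:
  assumes "simple_minded_collection D \<L>" "L \<in> \<L>"
  shows "arr f L L \<Longrightarrow> f \<noteq> zero_mor L L \<Longrightarrow> iso_mor D L L f" and "\<not> zero_obj D L"
proof -
  have d: "division_ring (End_ring D L)" and L: "L \<in> Obj D"
    using assms unfolding simple_minded_collection_def by blast+
  show "\<not> zero_obj D L" using d unfolding division_ring_def zero_obj_def End_ring_def by simp
  assume f: "arr f L L" "f \<noteq> zero_mor L L"
  then have "f \<in> Units (End_ring D L)" using d unfolding division_ring_def End_ring_def arr_def by simp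
  then show "iso_mor D L L f" using Units_End_ring[OF L] by blast
qed

lemma simple_minded_t_structure_eq:
  assumes "\<L> \<subseteq> Obj D"
  shows "simple_minded_t_structure D \<L> = (filt_shifts \<L> {0..}, filt_shifts \<L> {..0})"
  unfolding simple_minded_t_structure_def
  using extension_closure_eq[OF shifts_Obj[OF assms, of "{0..}"]] extension_closure_eq[OF shifts_Obj[OF assms, of "{..0}"]]
  by (simp add: shifts_def)

lemma t_greater_simple_minded:
  assumes "\<L> \<subseteq> Obj D"
  shows "t_greater D (simple_minded_t_structure D \<L>) = filt_shifts \<L> {..-1}"
  unfolding t_greater_def simple_minded_t_structure_eq[OF assms] snd_conv
    shift_set_filt_shifts[OF assms] image_add_atMost by simp

lemma simple_minded_generates:
  assumes "simple_minded_collection D \<L>" "X \<in> Obj D"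
  shows "X \<in> filt_shifts \<L> UNIV"
  using triangulated_closure_subset[OF simple_minded_Obj[OF assms(1)]] assms
  unfolding simple_minded_collection_def by blast

text \<open>Filter \<open>X\<close> by shifts of \<open>\<L>\<close> and move the nonnegative shifts
  to the front. A connecting morphism goes from \<open>L[m]\<close> to \<open>L'[n + 1]\<close> with
  \<open>n + 1 \<le> 0 \<le> m\<close>. It vanishes unless the degrees and the simple objects agree,
  and then it is zero or invertible because \<open>End(L)\<close> is a division ring.\<close>

lemma simple_minded_truncation:
  assumes sm: "simple_minded_collection D \<L>" and X: "X \<in> Obj D"
  shows "\<exists>A\<in>filt_shifts \<L> {0..}. \<exists>B\<in>filt_shifts \<L> {..-1}. tri A X B"
proof (rule filt_sort)
  have o: "\<L> \<subseteq> Obj D" using simple_minded_Obj[OF sm] .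
  show "shifts \<L> {..-1} \<subseteq> Obj D" using shifts_Obj[OF o] .
  have "(UNIV :: int set) = {0..} \<union> {..-1}" by auto
  then show "X \<in> filt (shifts \<L> {0..} \<union> shifts \<L> {..-1})"
    using simple_minded_generates[OF sm X] shifts_Un by metis
  fix u x h assume u: "u \<in> shifts \<L> {0..}" and x: "x \<in> shifts \<L> {..-1}" and h: "arr h u (x\<langle>1\<rangle>)"
  obtain L m where L: "u = L\<langle>m\<rangle>" "L \<in> \<L>" "m \<ge> 0" using u unfolding shifts_def by auto
  obtain L' n where L': "x = L'\<langle>n\<rangle>" "L' \<in> \<L>" "n \<le> -1" using x unfolding shifts_def by auto
  have LO: "L \<in> Obj D" "L' \<in> Obj D" using L L' o by auto
  have x1: "x\<langle>1\<rangle> = L'\<langle>n + 1\<rangle>" using LO L' by (simp add: shift_obj_add)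
  show "h = zero_mor u (x\<langle>1\<rangle>) \<or> iso_mor D u (x\<langle>1\<rangle>) h"
  proof (cases "n + 1 = m")
    case False
    then have "Hom_zero D L (L'\<langle>n + 1 - m\<rangle>)" using simple_minded_Hom_zero(1)[OF sm L(2) L'(2)] L L' by simp
    then have "Hom_zero D u (x\<langle>1\<rangle>)" unfolding x1 L(1) using Hom_zero_shift_iff[OF LO] by blast
    then show ?thesis using Hom_zeroD h by blast
  next
    case True
    have h': "arr h (L\<langle>m\<rangle>) (L'\<langle>m\<rangle>)" using h unfolding x1 L(1) True .
    show ?thesis
    proof (cases "L = L'")
      case False
      then have "Hom_zero D (L\<langle>m\<rangle>) (L'\<langle>m\<rangle>)"
        using simple_minded_Hom_zero(2)[OF sm L(2) L'(2)] Hom_zero_shift LO by blast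
      then show ?thesis unfolding x1 L(1) True using Hom_zeroD h' by blast
    next
      case eq: True
      have a: "arr (h\<llangle>- m\<rrangle>) L L" using arr_unshift[OF h' LO] eq by simp
      have hb: "h\<llangle>- m\<rrangle>\<llangle>m\<rrangle> = h" using shift_back(2)[OF h'] .
      show ?thesis
      proof (cases "h\<llangle>- m\<rrangle> = zero_mor L L")
        case z: True
        then have "h = zero_mor (L\<langle>m\<rangle>) (L\<langle>m\<rangle>)" using hb shift_zero[OF LO(1,1), of m] by simp
        then show ?thesis unfolding x1 L(1) True eq by simp
      next
        case False
        then have "iso_mor D L L (h\<llangle>- m\<rrangle>)" using simple_minded_endo(1)[OF sm L(2) a] by blast
        then have "iso_mor D (L\<langle>m\<rangle>) (L\<langle>m\<rangle>) h" using iso_mor_shift[of L L "h\<llangle>- m\<rrangle>" m] hb by simp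
        then show ?thesis unfolding x1 L(1) True eq by simp
      qed
    qed
  qed
qed

lemma t_structure_simple_minded:
  assumes sm: "simple_minded_collection D \<L>"
  shows "t_structure D (simple_minded_t_structure D \<L>)"
proof -
  have o: "\<L> \<subseteq> Obj D" using simple_minded_Obj[OF sm] .
  have orth: "orthogonal D (filt_shifts \<L> {0..}) (filt_shifts \<L> {..-1})"
    unfolding orthogonal_def
  proof (intro ballI)
    fix X Y assume X: "X \<in> filt_shifts \<L> {0..}" and Y: "Y \<in> filt_shifts \<L> {..-1}"
    show "Hom_zero D X Y"
      by (rule Hom_zero_filt[OF X Y o o]) (auto intro: simple_minded_Hom_zero(1)[OF sm])
  qed
  have "shift_set D (filt_shifts \<L> {0..}) 1 \<subseteq> filt_shifts \<L> {0..}"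
    "shift_set D (filt_shifts \<L> {..0}) (-1) \<subseteq> filt_shifts \<L> {..0}"
    unfolding shift_set_filt_shifts[OF o] by (auto elim!: filt_shifts_mono)
  then show ?thesis
    unfolding t_structure_def t_greater_simple_minded[OF o]
    using orth simple_minded_truncation[OF sm] filt_Obj filt_iso
    unfolding simple_minded_t_structure_eq[OF o] iso_closed_def tri_def by auto
qed

section \<open>Silting collections and the criterion for left orthogonality\<close>

lemma silting_Obj: "silting_collection D \<P> \<Longrightarrow> \<P> \<subseteq> Obj D"
  unfolding silting_collection_def indecomposable_def by blast

text \<open>This vanishing is not part of the definition. It holds because members of
  \<open>\<P>\<close> have no morphisms to the coaisle shifted by \<open>-1\<close>, by the
  definition of \<open>perp_neg\<close>, and hence lie in their own aisle
  \<open>perp_pos D \<P>\<close>.\<close>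

lemma silting_Hom_zero:
  assumes s: "silting_collection D \<P>" and X: "X \<in> \<P>" and X': "X' \<in> \<P>" and m: "m > 0"
  shows "Hom_zero D X (X'\<langle>m\<rangle>)"
proof -
  have t: "t_structure D (silting_t_structure D \<P>)" using s unfolding silting_collection_def by blast
  have "X' \<in> fst (silting_t_structure D \<P>)"
  proof (rule t_structure_left_perp[OF t])
    show "X' \<in> Obj D" using silting_Obj[OF s] X' by blast
    fix Y assume Y: "Y \<in> t_greater D (silting_t_structure D \<P>)"
    then have Yo: "Y \<in> Obj D" using t_greater_Obj[OF t] by blast
    then have "Y\<langle>1\<rangle> \<in> perp_neg D \<P>" using t_greater_iff[OF t] Y unfolding silting_t_structure_def by simp
    then have "Hom_zero D X' (Y\<langle>1\<rangle>\<langle>-1\<rangle>)" using X' unfolding perp_neg_def by fastforce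
    then show "Hom_zero D X' Y" using shift_obj_back(1)[OF Yo, of 1] by simp
  qed
  then show ?thesis using X m unfolding silting_t_structure_def perp_pos_def by simp
qed

lemma silting_weight_structure_eq:
  assumes "\<P> \<subseteq> Obj D"
  shows "silting_weight_structure D \<P> =
    (summand_closure D (filt_shifts \<P> {0..}), summand_closure D (filt_shifts \<P> {..0}))"
  unfolding silting_weight_structure_def
  using extension_closure_eq[OF shifts_Obj[OF assms, of "{0..}"]] extension_closure_eq[OF shifts_Obj[OF assms, of "{..0}"]]
  by (simp add: shifts_def)

lemma summand_closure_incl: "S \<subseteq> Obj D \<Longrightarrow> X \<in> S \<Longrightarrow> X \<in> summand_closure D S"
  unfolding summand_closure_eq using retract_refl by blast

lemma silting_weight_shift:
  assumes P: "\<P> \<subseteq> Obj D" and X: "X \<in> \<P>"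
  shows "m \<ge> 0 \<Longrightarrow> X\<langle>m\<rangle> \<in> fst (silting_weight_structure D \<P>)"
    "m \<le> 0 \<Longrightarrow> X\<langle>m\<rangle> \<in> snd (silting_weight_structure D \<P>)"
proof -
  have f: "filt_shifts \<P> M \<subseteq> Obj D" for M using filt_Obj by blast
  show "m \<ge> 0 \<Longrightarrow> X\<langle>m\<rangle> \<in> fst (silting_weight_structure D \<P>)"
    "m \<le> 0 \<Longrightarrow> X\<langle>m\<rangle> \<in> snd (silting_weight_structure D \<P>)"
    unfolding silting_weight_structure_eq[OF P] fst_conv snd_conv
    by (rule summand_closure_incl[OF f], rule filt_shifts_incl[OF P X], simp)+
qed

lemma left_orthogonal_iff:
  assumes P: "\<P> \<subseteq> Obj D" and t: "t_structure D t"
  shows "left_orthogonal D (silting_weight_structure D \<P>) t \<longleftrightarrow>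
    fst t \<subseteq> perp_pos D \<P> \<and> snd t \<subseteq> perp_neg D \<P>"
proof
  let ?w = "silting_weight_structure D \<P>"
  assume I: "left_orthogonal D ?w t"
  have "Hom_zero D X (Y\<langle>m\<rangle>)" if X: "X \<in> \<P>" and Y: "Y \<in> fst t" and m: "m > 0" for X Y m
  proof -
    have o: "X \<in> Obj D" "Y \<in> Obj D" using X P Y t_structureD(1)[OF t] by auto
    \<comment> \<open>Shifting by \<open>m - 1\<close> turns \<open>Hom(X[1 - m], Y[1])\<close> into
      \<open>Hom(X, Y[m])\<close>, and \<open>m > 0\<close> is exactly what puts
      \<open>X[1 - m]\<close> into the half generated by nonpositive shifts. The negative case is
      symmetric.\<close>
    have "X\<langle>1 - m\<rangle> \<in> snd ?w" using silting_weight_shift(2)[OF P X] m by simp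
    moreover have "Y\<langle>1\<rangle> \<in> t_less D t" unfolding t_less_def shift_set_def using Y by blast
    ultimately have "Hom_zero D (X\<langle>1 - m\<rangle>) (Y\<langle>1\<rangle>)"
      using I unfolding left_orthogonal_def orthogonal_def by blast
    then show ?thesis using Hom_zero_shift_iff[OF o] by simp
  qed
  moreover have "Hom_zero D X (Y\<langle>m\<rangle>)" if X: "X \<in> \<P>" and Y: "Y \<in> snd t" and m: "m < 0" for X Y m
  proof -
    have o: "X \<in> Obj D" "Y \<in> Obj D" using X P Y t_structureD(2)[OF t] by auto
    have "X\<langle>-1 - m\<rangle> \<in> fst ?w" using silting_weight_shift(1)[OF P X] m by simp
    moreover have "Y\<langle>-1\<rangle> \<in> t_greater D t" unfolding t_greater_def shift_set_def using Y by blast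
    ultimately have "Hom_zero D (X\<langle>-1 - m\<rangle>) (Y\<langle>-1\<rangle>)"
      using I unfolding left_orthogonal_def orthogonal_def by blast
    then show ?thesis using Hom_zero_shift_iff[OF o] by simp
  qed
  ultimately show "fst t \<subseteq> perp_pos D \<P> \<and> snd t \<subseteq> perp_neg D \<P>"
    unfolding perp_pos_def perp_neg_def using t_structureD(1,2)[OF t] by blast
next
  assume *: "fst t \<subseteq> perp_pos D \<P> \<and> snd t \<subseteq> perp_neg D \<P>"
  have "Hom_zero D X Y" if X: "X \<in> summand_closure D (filt_shifts \<P> {..0})" and Y: "Y \<in> t_less D t" for X Y
  proof -
    obtain Z where Z: "Z \<in> filt_shifts \<P> {..0}" "retract X Z" using X unfolding summand_closure_eq by blast
    obtain Y' where Y': "Y' \<in> fst t" "Y = Y'\<langle>1\<rangle>" using Y unfolding t_less_def shift_set_def by blast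
    have Yo: "Y' \<in> Obj D" "Y \<in> Obj D" using Y' Y t_structureD(1)[OF t] t_less_Obj[OF t] by auto
    have "Hom_zero D Z Y"
    proof (rule Hom_zero_filt_left[OF Z(1) P Yo(2)])
      fix X m assume "X \<in> \<P>" "m \<in> {..0::int}"
      then have "Hom_zero D X (Y'\<langle>1 - m\<rangle>)" using * Y'(1) unfolding perp_pos_def by auto
      then show "Hom_zero D X (Y\<langle>- m\<rangle>)" using Y' Yo by (simp add: shift_obj_add)
    qed
    then show ?thesis using Hom_zero_retract_left Z Yo by blast
  qed
  moreover have "Hom_zero D X Y" if X: "X \<in> summand_closure D (filt_shifts \<P> {0..})" and Y: "Y \<in> t_greater D t" for X Y
  proof -
    obtain Z where Z: "Z \<in> filt_shifts \<P> {0..}" "retract X Z" using X unfolding summand_closure_eq by blast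
    obtain Y' where Y': "Y' \<in> snd t" "Y = Y'\<langle>-1\<rangle>" using Y unfolding t_greater_def shift_set_def by blast
    have Yo: "Y' \<in> Obj D" "Y \<in> Obj D" using Y' Y t_structureD(2)[OF t] t_greater_Obj[OF t] by auto
    have "Hom_zero D Z Y"
    proof (rule Hom_zero_filt_left[OF Z(1) P Yo(2)])
      fix X m assume "X \<in> \<P>" "m \<in> {0::int..}"
      then have "Hom_zero D X (Y'\<langle>-1 - m\<rangle>)" using * Y'(1) unfolding perp_neg_def by auto
      then show "Hom_zero D X (Y\<langle>- m\<rangle>)" using Y' Yo by (simp add: shift_obj_add)
    qed
    then show ?thesis using Hom_zero_retract_left Z Yo by blast
  qed
  ultimately show "left_orthogonal D (silting_weight_structure D \<P>) t"
    unfolding left_orthogonal_def orthogonal_def silting_weight_structure_eq[OF P] by simp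
qed

lemma left_orthogonal_iff_silting:
  assumes s: "silting_collection D \<P>" and t: "t_structure D t"
  shows "left_orthogonal D (silting_weight_structure D \<P>) t \<longleftrightarrow> t = silting_t_structure D \<P>"
proof -
  have "t_structure D (silting_t_structure D \<P>)" using s unfolding silting_collection_def by blast
  from t_structure_eqI[OF t this] show ?thesis
    unfolding left_orthogonal_iff[OF silting_Obj[OF s] t] silting_t_structure_def by auto
qed

lemma left_orthogonal_if_Hom_zero:
  assumes s: "silting_collection D \<P>" and sm: "simple_minded_collection D \<L>"
    and H: "\<And>P L m. P \<in> \<P> \<Longrightarrow> L \<in> \<L> \<Longrightarrow> m \<noteq> 0 \<Longrightarrow> Hom_zero D P (L\<langle>m\<rangle>)"
  shows "left_orthogonal D (silting_weight_structure D \<P>) (simple_minded_t_structure D \<L>)"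
proof -
  note P = silting_Obj[OF s] and L = simple_minded_Obj[OF sm]
  \<comment> \<open>The condition says that degree zero does not occur among the simple factors of
    \<open>Y[m]\<close>; it serves the aisle with \<open>m > 0\<close> and the coaisle with
    \<open>m < 0\<close>.\<close>
  have *: "Hom_zero D X (Y\<langle>m\<rangle>)" if X: "X \<in> \<P>" and Y: "Y \<in> filt_shifts \<L> M" and m: "0 \<notin> (+) m ` M" for X Y m M
  proof (rule Hom_zero_filt_right[OF filt_shifts_shift[OF L Y] L])
    show "X \<in> Obj D" using X P by blast
    fix L n assume "L \<in> \<L>" "n \<in> (+) m ` M"
    then show "Hom_zero D X (L\<langle>n\<rangle>)" using H[OF X] m by metis
  qed
  show ?thesis
    unfolding left_orthogonal_iff[OF P t_structure_simple_minded[OF sm]]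
    unfolding simple_minded_t_structure_eq[OF L] perp_pos_def perp_neg_def
    using *[of _ _ "{0..}"] *[of _ _ "{..0}"] filt_Obj by auto
qed

lemma t_le_shift:
  assumes t: "t_structure D t" and X: "X \<in> fst t" and m: "m \<ge> 0"
  shows "X\<langle>m\<rangle> \<in> fst t"
  using m
proof (induction m rule: int_ge_induct)
  case base
  then show ?case using X t_structureD(1)[OF t X] by (simp add: shift_obj_0)
next
  case (step i)
  then show ?case using t_structureD(3)[OF t step(2)] t_structureD(1)[OF t X] by (simp add: shift_obj_add)
qed

lemma t_ge_shift:
  assumes t: "t_structure D t" and X: "X \<in> snd t" and m: "m \<le> 0"
  shows "X\<langle>m\<rangle> \<in> snd t"
  using m
proof (induction m rule: int_le_induct)
  case base
  then show ?case using X t_structureD(2)[OF t X] by (simp add: shift_obj_0)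
next
  case (step i)
  then show ?case using t_structureD(4)[OF t step(2)] t_structureD(2)[OF t X] by (simp add: shift_obj_add)
qed

text \<open>Each half of derived projectivity gives one inclusion: vanishing on \<open>X[1]\<close>
  controls the positive shifts of the aisle, and membership in the aisle controls the negative
  shifts of the coaisle.\<close>

lemma left_orthogonal_if_derived_projective:
  assumes P: "\<P> \<subseteq> Obj D" and t: "t_structure D t"
    and dp: "\<And>P. P \<in> \<P> \<Longrightarrow> derived_projective D t P"
  shows "left_orthogonal D (silting_weight_structure D \<P>) t"
proof -
  have "Hom_zero D X (Y\<langle>m\<rangle>)" if X: "X \<in> \<P>" and Y: "Y \<in> fst t" and m: "m > 0" for X Y m
  proof -
    have "Y\<langle>m - 1\<rangle> \<in> fst t" using t_le_shift[OF t Y] m by simp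
    then have "Hom_zero D X (Y\<langle>m - 1\<rangle>\<langle>1\<rangle>)" using dp[OF X] unfolding derived_projective_def by blast
    then show ?thesis using t_structureD(1)[OF t Y] by (simp add: shift_obj_add)
  qed
  moreover have "Hom_zero D X (Y\<langle>m\<rangle>)" if X: "X \<in> \<P>" and Y: "Y \<in> snd t" and m: "m < 0" for X Y m
  proof -
    have Yo: "Y \<in> Obj D" using t_structureD(2)[OF t Y] .
    have "Y\<langle>m + 1\<rangle> \<in> snd t" using t_ge_shift[OF t Y] m by simp
    then have "Y\<langle>m\<rangle> \<in> t_greater D t" using t_greater_iff[OF t shift_obj_closed[OF Yo]] Yo by (simp add: shift_obj_add)
    moreover have "X \<in> fst t" using dp[OF X] unfolding derived_projective_def by blast
    ultimately show ?thesis using t_structureD(7)[OF t] by blast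
  qed
  ultimately show ?thesis
    unfolding left_orthogonal_iff[OF P t] perp_pos_def perp_neg_def using t_structureD(1,2)[OF t] by blast
qed

subsection \<open>The weight structure\<close>

text \<open>The cone taken is that of \<open>j \<cdot> f \<cdot> p\<close>. The maps induced between
  the two cones need not compose to the identity, but their composite is compatible with
  \<open>g\<close> and \<open>h\<close>, so \<open>Tri_endo_iso\<close> makes it invertible and one
  map can be corrected.\<close>

lemma retract_cone:
  assumes T: "(X, Y, Z, f, g, h) \<in> Tri D" and X: "retract X X'" and Y: "retract Y Y'"
  obtains Z' where "tri X' Y' Z'" "retract Z Z'"
proof -
  note a = Tri_arr[OF T]
  obtain i p where i: "arr i X X'" "arr p X' X" "p \<cdot> i = ide D X" using X unfolding retract_def by blast
  obtain j q where j: "arr j Y Y'" "arr q Y' Y" "q \<cdot> j = ide D Y" using Y unfolding retract_def by blast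
  have fp: "arr (f \<cdot> p) X' Y" using arr_comp[OF i(2) a(1)] .
  define f' where "f' = j \<cdot> (f \<cdot> p)"
  have f': "arr f' X' Y'" unfolding f'_def using arr_comp[OF fp j(1)] .
  obtain Z' g' h' where T': "(X', Y', Z', f', g', h') \<in> Tri D" using Tri_cone f' unfolding arr_def by blast
  note a' = Tri_arr[OF T']
  have "f' \<cdot> i = j \<cdot> f"
    unfolding f'_def using assoc[OF i(1) fp j(1)] assoc[OF i(1,2) a(1)] i(3) id_right[OF a(1)] by simp
  then obtain c where c: "c \<in> Hom D Z Z'" "c \<cdot> g = g' \<cdot> j" "i\<llangle>1\<rrangle> \<cdot> h = h' \<cdot> c"
    using Tri_morphism[OF T T' arrD(3)[OF i(1)] arrD(3)[OF j(1)]] by auto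
  have "q \<cdot> f' = f \<cdot> p"
    unfolding f'_def using assoc[OF fp j(1,2), symmetric] j(3) id_left[OF fp] by simp
  then obtain d where d: "d \<in> Hom D Z' Z" "d \<cdot> g' = g \<cdot> q" "p\<llangle>1\<rrangle> \<cdot> h' = h \<cdot> d"
    using Tri_morphism[OF T' T arrD(3)[OF i(2)] arrD(3)[OF j(2)]] by auto
  have ca: "arr c Z Z'" and da: "arr d Z' Z" using c(1) d(1) a a' unfolding arr_def by auto
  have i1: "arr (i\<llangle>1\<rrangle>) (X\<langle>1\<rangle>) (X'\<langle>1\<rangle>)" and p1: "arr (p\<llangle>1\<rrangle>) (X'\<langle>1\<rangle>) (X\<langle>1\<rangle>)" using arr_shift i by auto
  have pi: "p\<llangle>1\<rrangle> \<cdot> i\<llangle>1\<rrangle> = ide D (X\<langle>1\<rangle>)"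
    using shift_comp[OF i(1,2), of 1] i(3) shift_mor_ide[OF arrD(1)[OF i(1)]] by simp
  have "(d \<cdot> c) \<cdot> g = d \<cdot> (g' \<cdot> j)" using assoc[OF a(2) ca da] c(2) by simp
  also have "\<dots> = g \<cdot> (q \<cdot> j)" using assoc[OF j(1) a'(2) da] assoc[OF j(1,2) a(2)] d(2) by simp
  finally have 1: "(d \<cdot> c) \<cdot> g = g" using j(3) id_right[OF a(2)] by simp
  have "h \<cdot> (d \<cdot> c) = p\<llangle>1\<rrangle> \<cdot> (i\<llangle>1\<rrangle> \<cdot> h)"
    using assoc[OF ca da a(3)] assoc[OF ca a'(3) p1] d(3) c(3) by simp
  also have "\<dots> = h" using assoc[OF a(3) i1 p1] pi id_left[OF a(3)] by simp
  finally have 2: "h \<cdot> (d \<cdot> c) = h" .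
  have dc: "arr (d \<cdot> c) Z Z" using arr_comp[OF ca da] .
  obtain e where e: "iso_mor D Z Z e" "e \<cdot> (d \<cdot> c) = ide D Z"
    using Tri_endo_iso[OF T dc 1 2] by (rule iso_mor_inverse)
  have ea: "arr e Z Z" using iso_mor_arr[OF e(1)] .
  have "(e \<cdot> d) \<cdot> c = ide D Z" using assoc[OF ca da ea] e(2) by simp
  then have "retract Z Z'" unfolding retract_def using ca arr_comp[OF da ea] by blast
  moreover have "tri X' Y' Z'" unfolding tri_def using T' by blast
  ultimately show ?thesis using that by blast
qed

text \<open>The retracts of iterated extensions already form a thick subcategory; closure under
  cones is the nontrivial point and comes from \<open>retract_cone\<close>.\<close>

lemma thick_retract:
  assumes P: "\<P> \<subseteq> Obj D" and X: "X \<in> thick D \<P>"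
  shows "\<exists>Z\<in>filt_shifts \<P> UNIV. retract X Z"
proof -
  let ?S = "{X. \<exists>Z\<in>filt_shifts \<P> UNIV. retract X Z}"
  note F = triangulated_filt_shifts[OF P, unfolded triangulated_subcategory_iff]
  have "Z \<in> ?S" if T: "tri X Y Z" and XY: "X \<in> ?S" "Y \<in> ?S" for X Y Z
  proof -
    obtain X' Y' where "X' \<in> filt_shifts \<P> UNIV" "retract X X'" "Y' \<in> filt_shifts \<P> UNIV" "retract Y Y'"
      using XY by blast
    moreover from this obtain Z' where "tri X' Y' Z'" "retract Z Z'"
      using T retract_cone unfolding tri_def by metis
    ultimately show ?thesis using F by blast
  qed
  moreover have "?S \<subseteq> Obj D" using retract_Obj by blast
  moreover have "iso_closed D ?S"
    unfolding iso_closed_def using retract_trans retract_iso isomorphic_sym by blast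
  moreover have "{X. zero_obj D X} \<subseteq> ?S" using retract_refl zero_obj_Obj filt.zero by blast
  moreover have "X\<langle>m\<rangle> \<in> ?S" if "X \<in> ?S" for X m using that retract_shift F by blast
  ultimately have "triangulated_subcategory D ?S" unfolding triangulated_subcategory_iff by blast
  moreover have "summand_closure D ?S \<subseteq> ?S" unfolding summand_closure_eq using retract_trans by blast
  moreover have "\<P> \<subseteq> ?S" using retract_refl filt_shifts_incl0[OF P, of _ UNIV] P by blast
  ultimately have "thick D \<P> \<subseteq> ?S" unfolding thick_def thick_subcategory_def by blast
  then show ?thesis using X by blast
qed

lemma retract_filt_in_thick:
  assumes Z: "Z \<in> filt_shifts \<P> M" and r: "retract X Z"
  shows "X \<in> thick D \<P>"
  unfolding thick_def
proof (rule InterI, elim CollectE conjE)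
  fix S assume S: "thick_subcategory D S" "\<P> \<subseteq> S"
  then have t: "triangulated_subcategory D S" and c: "summand_closure D S \<subseteq> S"
    unfolding thick_subcategory_def by blast+
  have "extension_closed D S"
    using t tri_rotate(2) unfolding triangulated_subcategory_iff extension_closed_iff by blast
  moreover have "shifts \<P> M \<subseteq> S" using t S(2) unfolding triangulated_subcategory_iff shifts_def by blast
  ultimately have "Z \<in> S" using filt_subset Z by blast
  then show "X \<in> S" using c r unfolding summand_closure_eq by blast
qed

text \<open>Sorting again, now with the low shifts in front. The connecting morphisms have positive
  degree \<open>n + 1 - m\<close> and vanish, so nothing cancels. The cut \<open>k\<close> is left
  free because the two halves of the weight structure need different cuts.\<close>

lemma silting_weight_decomposition:
  assumes s: "silting_collection D \<P>" and X: "X \<in> filt_shifts \<P> UNIV"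
  shows "\<exists>A\<in>filt_shifts \<P> {..k}. \<exists>B\<in>filt_shifts \<P> {k + 1..}. tri A X B"
proof (rule filt_sort)
  note P = silting_Obj[OF s]
  show "shifts \<P> {k + 1..} \<subseteq> Obj D" using shifts_Obj[OF P] .
  have "(UNIV :: int set) = {..k} \<union> {k + 1..}" by auto
  then show "X \<in> filt (shifts \<P> {..k} \<union> shifts \<P> {k + 1..})" using shifts_Un X by metis
  fix u x h assume u: "u \<in> shifts \<P> {..k}" and x: "x \<in> shifts \<P> {k + 1..}" and h: "arr h u (x\<langle>1\<rangle>)"
  obtain L m where L: "u = L\<langle>m\<rangle>" "L \<in> \<P>" "m \<le> k" using u unfolding shifts_def by auto
  obtain L' n where L': "x = L'\<langle>n\<rangle>" "L' \<in> \<P>" "n \<ge> k + 1" using x unfolding shifts_def by auto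
  have LO: "L \<in> Obj D" "L' \<in> Obj D" using L L' P by auto
  have "Hom_zero D L (L'\<langle>n + 1 - m\<rangle>)" using silting_Hom_zero[OF s L(2) L'(2)] L L' by simp
  then have "Hom_zero D u (x\<langle>1\<rangle>)"
    using Hom_zero_shift_iff[OF LO, of m "n + 1"] L(1) L'(1) LO by (simp add: shift_obj_add)
  then show "h = zero_mor u (x\<langle>1\<rangle>) \<or> iso_mor D u (x\<langle>1\<rangle>) h" using Hom_zeroD h by blast
qed

lemma silting_strictly_left_orthogonal:
  assumes s: "silting_collection D \<P>" and t: "t_structure D t" and eq: "t = silting_t_structure D \<P>"
  shows "strictly_left_orthogonal D (thick D \<P>) (silting_weight_structure D \<P>) t"
proof -
  note P = silting_Obj[OF s]
  let ?w = "silting_weight_structure D \<P>"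
  have lo: "left_orthogonal D ?w t" using left_orthogonal_iff_silting[OF s t] eq by simp
  have w: "fst ?w = {X. \<exists>Z\<in>filt_shifts \<P> {0..}. retract X Z}" "snd ?w = {X. \<exists>Z\<in>filt_shifts \<P> {..0}. retract X Z}"
    unfolding silting_weight_structure_eq[OF P] summand_closure_eq by simp_all
  have lo1: "X \<in> snd ?w \<Longrightarrow> Y \<in> t_less D t \<Longrightarrow> Hom_zero D X Y"
    and lo2: "X \<in> fst ?w \<Longrightarrow> Y \<in> t_greater D t \<Longrightarrow> Hom_zero D X Y" for X Y
    using lo unfolding left_orthogonal_def orthogonal_def by blast+
  have wC: "snd ?w \<subseteq> thick D \<P>" "fst ?w \<subseteq> thick D \<P>" unfolding w using retract_filt_in_thick by blast+
  have "snd ?w = {X \<in> thick D \<P>. \<forall>Y\<in>t_less D t. Hom_zero D X Y}"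
  proof (intro equalityI subsetI)
    fix X assume "X \<in> snd ?w"
    then show "X \<in> {X \<in> thick D \<P>. \<forall>Y\<in>t_less D t. Hom_zero D X Y}" using wC lo1 by blast
  next
    fix X assume "X \<in> {X \<in> thick D \<P>. \<forall>Y\<in>t_less D t. Hom_zero D X Y}"
    then have X: "X \<in> thick D \<P>" and H: "\<And>Y. Y \<in> t_less D t \<Longrightarrow> Hom_zero D X Y" by auto
    obtain Z i r where Z: "Z \<in> filt_shifts \<P> UNIV" and ir: "arr i X Z" "arr r Z X" "r \<cdot> i = ide D X"
      using thick_retract[OF P X] unfolding retract_def by blast
    obtain A B f g h where A: "A \<in> filt_shifts \<P> {..0}" and B: "B \<in> filt_shifts \<P> {0 + 1..}"
      and T: "(A, Z, B, f, g, h) \<in> Tri D"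
      using silting_weight_decomposition[OF s Z, of 0] unfolding tri_def by blast
    note a = Tri_arr[OF T]
    have Bo: "B \<in> Obj D" using a arrD by blast
    \<comment> \<open>The high part \<open>B\<close> is shown to lie in \<open>t_less D t\<close>,
      so that \<open>X\<close> has no morphisms to it and its inclusion into \<open>Z\<close> lifts
      to the low part \<open>A\<close>.\<close>
    have "B\<langle>-1\<rangle> \<in> filt_shifts \<P> {0..}" using filt_shifts_shift[OF P B, of "-1"] unfolding image_add_atLeast by simp
    then have "B\<langle>-1\<rangle> \<in> fst ?w" using retract_refl shift_obj_closed[OF Bo] unfolding w by blast
    then have "B\<langle>-1\<rangle> \<in> fst t" using t_structure_left_perp[OF t shift_obj_closed[OF Bo]] lo2 by blast
    then have "B \<in> t_less D t" using t_less_iff[OF t Bo] by simp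
    then have "g \<cdot> i = zero_mor X B" using H Hom_zeroD arr_comp[OF ir(1) a(2)] by blast
    then obtain c where c: "arr c X A" "f \<cdot> c = i" using Tri_lift[OF T ir(1)] by blast
    have "(r \<cdot> f) \<cdot> c = ide D X" using assoc[OF c(1) a(1) ir(2)] c(2) ir(3) by simp
    then have "retract X A" unfolding retract_def using c(1) arr_comp[OF a(1) ir(2)] by blast
    then show "X \<in> snd ?w" unfolding w using A by blast
  qed
  moreover have "fst ?w = {X \<in> thick D \<P>. \<forall>Y\<in>t_greater D t. Hom_zero D X Y}"
  proof (intro equalityI subsetI)
    fix X assume "X \<in> fst ?w"
    then show "X \<in> {X \<in> thick D \<P>. \<forall>Y\<in>t_greater D t. Hom_zero D X Y}" using wC lo2 by blast
  next
    fix X assume "X \<in> {X \<in> thick D \<P>. \<forall>Y\<in>t_greater D t. Hom_zero D X Y}"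
    then have X: "X \<in> thick D \<P>" and H: "\<And>Y. Y \<in> t_greater D t \<Longrightarrow> Hom_zero D X Y" by auto
    obtain Z i r where Z: "Z \<in> filt_shifts \<P> UNIV" and ir: "arr i X Z" "arr r Z X" "r \<cdot> i = ide D X"
      using thick_retract[OF P X] unfolding retract_def by blast
    have Xo: "X \<in> Obj D" using ir arrD by blast
    \<comment> \<open>Cutting one degree lower leaves only negative shifts in \<open>A\<close>.
      These have no morphisms to \<open>X\<close>, which lies in \<open>perp_pos D \<P>\<close>, so
      the retraction onto \<open>X\<close> factors through \<open>B\<close>.\<close>
    obtain A B f g h where A: "A \<in> filt_shifts \<P> {..-1}" and B: "B \<in> filt_shifts \<P> {-1 + 1..}"
      and T: "(A, Z, B, f, g, h) \<in> Tri D"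
      using silting_weight_decomposition[OF s Z, of "-1"] unfolding tri_def by blast
    note a = Tri_arr[OF T]
    have "X \<in> perp_pos D \<P>"
      using t_structure_left_perp[OF t Xo H] unfolding eq silting_t_structure_def by simp
    then have "Hom_zero D A X"
      by (intro Hom_zero_filt_left[OF A P Xo]) (auto simp: perp_pos_def)
    then have "r \<cdot> f = zero_mor A X" using Hom_zeroD arr_comp[OF a(1) ir(2)] by blast
    then obtain c where c: "arr c B X" "c \<cdot> g = r" using Tri_colift[OF T ir(2)] by blast
    have "c \<cdot> (g \<cdot> i) = ide D X" using assoc[OF ir(1) a(2) c(1)] c(2) ir(3) by simp
    then have "retract X B" unfolding retract_def using c(1) arr_comp[OF ir(1) a(2)] by blast
    then show "X \<in> fst ?w" unfolding w using B by auto
  qed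
  moreover have "t_less D t = {Y \<in> Obj D. \<forall>X\<in>snd ?w. Hom_zero D X Y}"
  proof (intro equalityI subsetI)
    fix Y assume "Y \<in> t_less D t"
    then show "Y \<in> {Y \<in> Obj D. \<forall>X\<in>snd ?w. Hom_zero D X Y}" using t_less_Obj[OF t] lo1 by blast
  next
    fix Y assume "Y \<in> {Y \<in> Obj D. \<forall>X\<in>snd ?w. Hom_zero D X Y}"
    then have Y: "Y \<in> Obj D" and H: "\<And>X. X \<in> snd ?w \<Longrightarrow> Hom_zero D X Y" by auto
    have "Hom_zero D X (Y\<langle>-1\<rangle>\<langle>m\<rangle>)" if X: "X \<in> \<P>" and m: "m > 0" for X m
    proof -
      have Xo: "X \<in> Obj D" using X P by blast
      \<comment> \<open>The test object \<open>X[1 - m]\<close> turns a vanishing on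
        \<open>Y\<close> into the one required of \<open>Y[-1]\<close> in degree \<open>m\<close>;
        writing \<open>Y\<close> as its zeroth shift fits \<open>Hom_zero_shift_iff\<close>.\<close>
      have "Hom_zero D (X\<langle>1 - m\<rangle>) (Y\<langle>0\<rangle>)"
        using H silting_weight_shift(2)[OF P X, of "1 - m"] m Y by (simp add: shift_obj_0)
      then show ?thesis using Hom_zero_shift_iff[OF Xo Y, of "1 - m" 0] Y by (simp add: shift_obj_add)
    qed
    then have "Y\<langle>-1\<rangle> \<in> fst t"
      unfolding eq silting_t_structure_def perp_pos_def using shift_obj_closed[OF Y] by simp
    then show "Y \<in> t_less D t" using t_less_iff[OF t Y] by simp
  qed
  moreover have "t_greater D t = {Y \<in> Obj D. \<forall>X\<in>fst ?w. Hom_zero D X Y}"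
  proof (intro equalityI subsetI)
    fix Y assume "Y \<in> t_greater D t"
    then show "Y \<in> {Y \<in> Obj D. \<forall>X\<in>fst ?w. Hom_zero D X Y}" using t_greater_Obj[OF t] lo2 by blast
  next
    fix Y assume "Y \<in> {Y \<in> Obj D. \<forall>X\<in>fst ?w. Hom_zero D X Y}"
    then have Y: "Y \<in> Obj D" and H: "\<And>X. X \<in> fst ?w \<Longrightarrow> Hom_zero D X Y" by auto
    have "Hom_zero D X (Y\<langle>1\<rangle>\<langle>m\<rangle>)" if X: "X \<in> \<P>" and m: "m < 0" for X m
    proof -
      have Xo: "X \<in> Obj D" using X P by blast
      have "Hom_zero D (X\<langle>-1 - m\<rangle>) (Y\<langle>0\<rangle>)"
        using H silting_weight_shift(1)[OF P X, of "-1 - m"] m Y by (simp add: shift_obj_0)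
      then show ?thesis using Hom_zero_shift_iff[OF Xo Y, of "-1 - m" 0] Y by (simp add: shift_obj_add add.commute)
    qed
    then have "Y\<langle>1\<rangle> \<in> snd t"
      unfolding eq silting_t_structure_def perp_neg_def using shift_obj_closed[OF Y] by simp
    then show "Y \<in> t_greater D t" using t_greater_iff[OF t Y] by simp
  qed
  ultimately show ?thesis unfolding strictly_left_orthogonal_def using lo by simp
qed

section \<open>Local endomorphism rings in a silting collection\<close>

lemma coproduct_singleton:
  assumes X: "X \<in> Obj D"
  shows "coproduct D [X] X"
  unfolding coproduct_def
proof (intro conjI exI[of _ "\<lambda>_. ide D X"] allI impI ballI)
  fix Z f assume Z: "Z \<in> Obj D" and "\<forall>j<length [X]. f j \<in> Hom D ([X] ! j) Z"
  then have f: "arr (f 0) X Z" using X unfolding arr_def by simp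
  show "\<exists>!g. g \<in> Hom D X Z \<and> (\<forall>j<length [X]. g \<cdot> ide D X = f j)"
  proof (rule ex1I[of _ "f 0"])
    show "f 0 \<in> Hom D X Z \<and> (\<forall>j<length [X]. f 0 \<cdot> ide D X = f j)"
      using arrD(3)[OF f] id_right[OF f] by simp
    fix g assume "g \<in> Hom D X Z \<and> (\<forall>j<length [X]. g \<cdot> ide D X = f j)"
    then show "g = f 0" using id_right[of g X Z] X Z unfolding arr_def by simp
  qed
qed (use X ide_Hom in auto)

lemma silting_not_zero: "silting_collection D \<P> \<Longrightarrow> X \<in> \<P> \<Longrightarrow> \<not> zero_obj D X"
  unfolding silting_collection_def indecomposable_def by blast

text \<open>Krull-Schmidt decomposes \<open>X\<close> into objects with local endomorphism rings
  inside the additive closure \<open>S\<close> only. The first summand \<open>Y\<close> is therefore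
  extracted as a retract, its complement is rebuilt in \<open>D\<close>, and indecomposability makes
  \<open>X\<close> isomorphic to \<open>Y\<close>. Locality is then applied to the sum of
  \<open>e\<close> and \<open>1 - e\<close>, transported to \<open>Y\<close>.\<close>

lemma silting_End_local:
  assumes s: "silting_collection D \<P>" and X: "X \<in> \<P>" and e: "arr e X X"
  shows "iso_mor D X X e \<or> iso_mor D X X (diff X X (ide D X) e)"
proof -
  have Xo: "X \<in> Obj D" using silting_Obj[OF s] X by blast
  define S where "S = summands_of_coproducts D \<P>"
  have SO: "S \<subseteq> Obj D"
    unfolding S_def summands_of_coproducts_def summand_closure_eq using retract_Obj by blast
  have "set [X] \<subseteq> \<P> \<and> coproduct D [X] X" using coproduct_singleton[OF Xo] X by simp
  then have "X \<in> S"
    unfolding S_def summands_of_coproducts_def summand_closure_eq using retract_refl[OF Xo] by blast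
  moreover have "Krull_Schmidt (full_subcat D S)" using s unfolding silting_collection_def S_def by blast
  ultimately obtain Xs where loc: "\<forall>Y\<in>set Xs. local_ring (End_ring D Y)"
    and cop: "coproduct (full_subcat D S) Xs X"
    unfolding Krull_Schmidt_def by auto
  obtain \<iota> where XsS: "set Xs \<subseteq> S" and XS: "X \<in> S" and \<iota>: "\<forall>j<length Xs. \<iota> j \<in> Hom D (Xs ! j) X"
    and univ: "\<And>Z f. Z \<in> S \<Longrightarrow> \<forall>j<length Xs. f j \<in> Hom D (Xs ! j) Z \<Longrightarrow>
      \<exists>!g. g \<in> Hom D X Z \<and> (\<forall>j<length Xs. g \<cdot> \<iota> j = f j)"
    using cop unfolding coproduct_def full_subcat_simps by auto
  \<comment> \<open>An empty decomposition would make \<open>X\<close> a zero object, which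
    indecomposability excludes.\<close>
  have "Xs \<noteq> []"
  proof
    assume "Xs = []"
    then have "\<exists>!g. g \<in> Hom D X X" using univ[OF XS, of "\<lambda>_. undefined"] by simp
    then have "zero_obj D X"
      unfolding zero_obj_def using Xo arrD(3)[OF arr_zero[OF Xo Xo]] arrD(3)[OF arr_ide[OF Xo]] by blast
    then show False using silting_not_zero[OF s X] by blast
  qed
  then have Y0: "0 < length Xs" "Xs ! 0 \<in> set Xs" by auto
  define Y where "Y = Xs ! 0"
  have Y: "Y \<in> S" "Y \<in> Obj D" "local_ring (End_ring D Y)" using Y0(2) XsS SO loc unfolding Y_def by blast+
  \<comment> \<open>The family whose induced morphism is the projection onto the first
    summand.\<close>
  let ?F = "\<lambda>j. if j = 0 then ide D Y else zero_mor (Xs ! j) Y"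
  have "\<forall>j<length Xs. ?F j \<in> Hom D (Xs ! j) Y"
  proof (intro allI impI)
    fix j assume "j < length Xs"
    then have "Xs ! j \<in> Obj D" using XsS SO nth_mem by blast
    then show "?F j \<in> Hom D (Xs ! j) Y"
      using arrD(3)[OF arr_ide[OF Y(2)]] arrD(3)[OF arr_zero[OF _ Y(2)]] unfolding Y_def by simp
  qed
  from ex1_implies_ex[OF univ[OF Y(1) this]] obtain r
    where r': "r \<in> Hom D X Y" "\<forall>j<length Xs. r \<cdot> \<iota> j = ?F j" by (elim exE conjE)
  have r: "r \<in> Hom D X Y" "r \<cdot> \<iota> 0 = ide D Y" using r'(1) r'(2)[rule_format, OF Y0(1)] by simp_all
  define i where "i = \<iota> 0"
  have ri: "arr i Y X" "arr r X Y" "r \<cdot> i = ide D Y" using r \<iota> Y0 Y Xo unfolding arr_def i_def Y_def by auto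
  obtain X' where X': "coproduct D [Y, X'] X" "zero_obj D X' \<Longrightarrow> i \<cdot> r = ide D X"
    using coproduct_complement[OF ri] by blast
  have "zero_obj D Y \<or> zero_obj D X'"
    using X' s X unfolding silting_collection_def indecomposable_def by blast
  moreover have "\<not> zero_obj D Y"
    using Y(3) unfolding local_ring_def zero_obj_def End_ring_def by simp
  ultimately have ir: "i \<cdot> r = ide D X" using X' by blast
  have iso: "iso_mor D Y X i" "iso_mor D X Y r" unfolding iso_mor_iff using ri ir by blast+
  \<comment> \<open>Conjugation by the inverse isomorphisms \<open>i\<close> and \<open>r\<close>
    reflects invertibility from \<open>Y\<close> to \<open>X\<close>.\<close>
  have conj: "iso_mor D X X u" if u: "arr u X X" and iu: "iso_mor D Y Y (r \<cdot> (u \<cdot> i))" for u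
  proof -
    have ui: "arr (u \<cdot> i) Y X" using arr_comp[OF ri(1) u] .
    have "i \<cdot> (r \<cdot> (u \<cdot> i)) = u \<cdot> i" using assoc[OF ui ri(2,1)] ir id_left[OF ui] by simp
    then have "(i \<cdot> (r \<cdot> (u \<cdot> i))) \<cdot> r = u" using assoc[OF ri(2,1) u] ir id_right[OF u] by simp
    then show ?thesis using iso_mor_comp[OF iso(2) iso_mor_comp[OF iu iso(1)]] by simp
  qed
  define e' where "e' = r \<cdot> (e \<cdot> i)"
  have ei: "arr (e \<cdot> i) Y X" using arr_comp[OF ri(1) e] .
  have e': "arr e' Y Y" unfolding e'_def using arr_comp[OF ei ri(2)] .
  have d: "arr (diff Y Y (ide D Y) e') Y Y" using arr_diff[OF arr_ide[OF Y(2)] e'] .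
  have c: "f \<in> carrier (End_ring D Y) \<longleftrightarrow> arr f Y Y" for f unfolding End_ring_def arr_def using Y(2) by simp
  have loc_sum: "a \<in> Units (End_ring D Y) \<or> b \<in> Units (End_ring D Y)"
    if "a \<in> carrier (End_ring D Y)" "b \<in> carrier (End_ring D Y)"
      "a \<oplus>\<^bsub>End_ring D Y\<^esub> b \<in> Units (End_ring D Y)" for a b
    using Y(3) that unfolding local_ring_def by blast
  have "e' \<oplus>\<^bsub>End_ring D Y\<^esub> diff Y Y (ide D Y) e' = ide D Y"
    using plus_diff[OF e' arr_ide[OF Y(2)]] unfolding End_ring_def by simp
  then have "e' \<in> Units (End_ring D Y) \<or> diff Y Y (ide D Y) e' \<in> Units (End_ring D Y)"
    using loc_sum[of e' "diff Y Y (ide D Y) e'"] iso_mor_ide[OF Y(2)] Units_End_ring[OF Y(2)] c e' d by metis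
  then show ?thesis
  proof
    assume "e' \<in> Units (End_ring D Y)"
    then show ?thesis using conj[OF e] Units_End_ring[OF Y(2)] unfolding e'_def by blast
  next
    assume u: "diff Y Y (ide D Y) e' \<in> Units (End_ring D Y)"
    let ?d = "diff X X (ide D X) e"
    have "?d \<cdot> i = diff Y X i (e \<cdot> i)"
      using diff_comp[OF ri(1) Xo arr_ide[OF Xo] e] id_left[OF ri(1)] by simp
    then have "r \<cdot> (?d \<cdot> i) = diff Y Y (ide D Y) e'"
      unfolding e'_def using comp_diff[OF ri(2) Y(2) ri(1) ei] ri(3) by simp
    then show ?thesis using conj[OF arr_diff[OF arr_ide[OF Xo] e]] u Units_End_ring[OF Y(2)] by simp
  qed
qed

text \<open>By locality \<open>e\<close> or \<open>1 - e\<close> is invertible, and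
  \<open>1 - e\<close> cannot be, because \<open>f\<close> kills it and is nonzero.\<close>

lemma silting_endo_iso_if_absorbed:
  assumes s: "silting_collection D \<P>" and X: "X \<in> \<P>" and e: "arr e X X"
    and f: "arr f X Z" "f \<noteq> zero_mor X Z" and fe: "f \<cdot> e = f"
  shows "iso_mor D X X e"
proof (rule ccontr)
  have o: "X \<in> Obj D" "Z \<in> Obj D" using f arrD by blast+
  let ?d = "diff X X (ide D X) e"
  assume "\<not> iso_mor D X X e"
  then have d: "iso_mor D X X ?d" using silting_End_local[OF s X e] by blast
  have "f \<cdot> ?d = zero_mor X Z"
    using comp_diff[OF f(1) o(1) arr_ide[OF o(1)] e] id_right[OF f(1)] fe diff_zero_iff[OF f(1) f(1)] by simp
  also have "\<dots> = zero_mor X Z \<cdot> ?d" using zero_comp[OF iso_mor_arr[OF d] o(2)] by simp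
  finally have "f = zero_mor X Z" by (rule iso_mor_cancel_right[OF d f(1) arr_zero[OF o]])
  then show False using f(2) by blast
qed

section \<open>Fibres of morphisms to simple objects\<close>

lemma simple_minded_in_heart:
  assumes "\<L> \<subseteq> Obj D" "L \<in> \<L>"
  shows "L \<in> heart (simple_minded_t_structure D \<L>)"
  unfolding heart_def simple_minded_t_structure_eq[OF assms(1)]
  using filt_shifts_incl0[OF assms, of "{0..}"] filt_shifts_incl0[OF assms, of "{..0}"] by simp

text \<open>This expresses that a nonzero morphism to a simple object is surjective on
  \<open>H\<^sup>0\<close>. It is enough to test \<open>F\<close> against negative shifts of simple
  objects, where the division ring \<open>End(L)\<close> settles the critical degree
  \<open>-1\<close>.\<close>

lemma simple_minded_fiber:
  assumes sm: "simple_minded_collection D \<L>" and t: "t = simple_minded_t_structure D \<L>"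
    and X: "X \<in> fst t" and L: "L \<in> \<L>" and f: "arr f X L" "f \<noteq> zero_mor X L"
  obtains F i g where "(F, X, L, i, f, g) \<in> Tri D" "F \<in> fst t"
proof -
  note LO = simple_minded_Obj[OF sm]
  have ts: "t_structure D t" using t_structure_simple_minded[OF sm] t by simp
  obtain C g0 h0 where T0: "(X, L, C, f, g0, h0) \<in> Tri D" using Tri_cone f(1) unfolding arr_def by blast
  define F where "F = C\<langle>-1\<rangle>"
  obtain i where T: "(F, X, L, i, f, g0) \<in> Tri D" using Tri_rotate_left[OF T0] unfolding F_def by blast
  note a = Tri_arr[OF T]
  note R = Tri_rotate_right[OF T]
  have o: "F \<in> Obj D" "X \<in> Obj D" "L \<in> Obj D" using a arrD by blast+
  have FL: "Hom_zero D F (L'\<langle>m\<rangle>)" if L': "L' \<in> \<L>" and m: "m \<le> -1" for L' m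
  proof -
    have L'o: "L' \<in> Obj D" using L' LO by blast
    have mo: "L'\<langle>m\<rangle> \<in> Obj D" using shift_obj_closed[OF L'o] .
    have "v = zero_mor F (L'\<langle>m\<rangle>)" if v: "arr v F (L'\<langle>m\<rangle>)" for v
    proof -
      have v1: "arr (v\<llangle>1\<rrangle>) (F\<langle>1\<rangle>) (L'\<langle>m + 1\<rangle>)" using arr_shift[OF v, of 1] L'o by (simp add: shift_obj_add)
      \<comment> \<open>The morphism \<open>v\<close> is tested by composing its shift with the
        connecting morphism from \<open>L\<close>. If this composite vanishes, the shift of
        \<open>v\<close> factors through \<open>X[1]\<close>, which has no morphisms to
        \<open>L'[m + 1]\<close>.\<close>
      define u where "u = v\<llangle>1\<rrangle> \<cdot> g0"
      have u: "arr u L (L'\<langle>m + 1\<rangle>)" unfolding u_def using arr_comp[OF a(3) v1] .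
      have uf: "u \<cdot> f = zero_mor X (L'\<langle>m + 1\<rangle>)"
        unfolding u_def using assoc[OF a(2,3) v1] Tri_comp_zero2[OF T] comp_zero[OF v1 o(2)] by simp
      have u0: "u = zero_mor L (L'\<langle>m + 1\<rangle>)"
      proof (cases "m + 1 < 0")
        case True
        then show ?thesis using simple_minded_Hom_zero(1)[OF sm L L'] Hom_zeroD u by blast
      next
        case False
        then have "m + 1 = 0" using m by simp
        then have m1: "L'\<langle>m + 1\<rangle> = L'" using shift_obj_0[OF L'o] by metis
        show ?thesis
        proof (cases "L = L'")
          case False
          then show ?thesis using simple_minded_Hom_zero(2)[OF sm L L'] Hom_zeroD u unfolding m1 by blast
        next
          case True
          have ua: "arr u L L" using u unfolding m1 True .
          have "u = zero_mor L L"
          proof (rule ccontr)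
            \<comment> \<open>A nonzero \<open>u\<close> would be invertible, and then
              \<open>u \<cdot> f = 0\<close> would force \<open>f = 0\<close>.\<close>
            assume "u \<noteq> zero_mor L L"
            then have iu: "iso_mor D L L u" using simple_minded_endo(1)[OF sm L ua] by blast
            have "u \<cdot> f = u \<cdot> zero_mor X L" using uf comp_zero[OF ua o(2)] unfolding m1 True by simp
            then show False using iso_mor_cancel_left[OF iu f(1) arr_zero[OF o(2,3)]] f(2) by blast
          qed
          then show ?thesis unfolding m1 using True by simp
        qed
      qed
      obtain c where c: "arr c (X\<langle>1\<rangle>) (L'\<langle>m + 1\<rangle>)" "c \<cdot> neg (F\<langle>1\<rangle>) (X\<langle>1\<rangle>) (i\<llangle>1\<rrangle>) = v\<llangle>1\<rrangle>"
        using Tri_colift2[OF R v1] u0 unfolding u_def by blast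
      have "L'\<langle>m\<rangle> \<in> t_greater D t"
        unfolding t t_greater_simple_minded[OF LO] using filt_shifts_incl[OF LO L', of m "{..-1}"] m by simp
      then have "Hom_zero D X (L'\<langle>m\<rangle>)" using t_structureD(7)[OF ts X] by blast
      then have "Hom_zero D (X\<langle>1\<rangle>) (L'\<langle>m + 1\<rangle>)" using Hom_zero_shift_iff[OF o(2) L'o, of 1 "m + 1"] by simp
      then have "c = zero_mor (X\<langle>1\<rangle>) (L'\<langle>m + 1\<rangle>)" using Hom_zeroD c(1) by blast
      then have "v\<llangle>1\<rrangle> = zero_mor (F\<langle>1\<rangle>) (L'\<langle>m\<rangle>\<langle>1\<rangle>)"
        using c(2) zero_comp[OF Tri_arr(3)[OF R] arrD(2)[OF v1]] L'o by (simp add: shift_obj_add)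
      then show ?thesis using shift_zero_iff[OF v] by simp
    qed
    then show ?thesis using Hom_zero_iff[OF o(1) mo] by blast
  qed
  have "F \<in> fst t"
  proof (rule t_structure_left_perp[OF ts o(1)])
    fix Y assume "Y \<in> t_greater D t"
    then have "Y \<in> filt_shifts \<L> {..-1}" unfolding t t_greater_simple_minded[OF LO] .
    then show "Hom_zero D F Y" by (rule Hom_zero_filt_right[OF _ LO o(1)]) (use FL in auto)
  qed
  then show ?thesis using that T by blast
qed

text \<open>The obstruction \<open>g \<cdot> u\<close> to lifting lies in
  \<open>Hom(X, F[1])\<close>, which vanishes.\<close>

lemma derived_projective_lift:
  assumes dp: "derived_projective D t X" and T: "(F, A, B, i, f, g) \<in> Tri D" and F: "F \<in> fst t"
    and u: "arr u X B"
  obtains c where "arr c X A" "f \<cdot> c = u"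
proof -
  have "Hom_zero D X (F\<langle>1\<rangle>)" using dp F unfolding derived_projective_def by blast
  then have "g \<cdot> u = zero_mor X (F\<langle>1\<rangle>)" using Hom_zeroD arr_comp[OF u Tri_arr(3)[OF T]] by blast
  then show ?thesis using Tri_lift2[OF T u] that by blast
qed

end

section \<open>The bijection when the two t-structures agree\<close>

locale silting_simple_minded = triangulated_category K D
  for K :: "('k, 'r) ring_scheme" and D :: "('k, 'o, 'm, 'z) tri_cat_scheme" (structure) +
  fixes \<P> \<L> :: "'o set" and t :: "'o set \<times> 'o set"
  assumes silting: "silting_collection D \<P>"
    and simple_minded: "simple_minded_collection D \<L>"
    and t_simple_minded: "t = simple_minded_t_structure D \<L>"
    and t_silting: "t = silting_t_structure D \<P>"
begin

lemma t_structure: "t_structure D t"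
  using t_structure_simple_minded[OF simple_minded] t_simple_minded by simp

lemma silting_ObjI: "P \<in> \<P> \<Longrightarrow> P \<in> Obj D"
  using silting_Obj[OF silting] by blast

lemma simple_ObjI: "L \<in> \<L> \<Longrightarrow> L \<in> Obj D"
  using simple_minded_Obj[OF simple_minded] by blast

lemma simple_heart: "L \<in> \<L> \<Longrightarrow> L \<in> fst t" "L \<in> \<L> \<Longrightarrow> L \<in> snd t"
  using simple_minded_in_heart[OF simple_minded_Obj[OF simple_minded]] unfolding t_simple_minded heart_def by blast+

lemma silting_derived_projective:
  assumes "P \<in> \<P>"
  shows "derived_projective D t P"
  unfolding derived_projective_def t_silting silting_t_structure_def perp_pos_def
  using silting_Hom_zero[OF silting] silting_ObjI assms by simp

lemma silting_le: "P \<in> \<P> \<Longrightarrow> P \<in> fst t"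
  using silting_derived_projective unfolding derived_projective_def by blast

lemma silting_simple_Hom_zero:
  assumes "P \<in> \<P>" "L \<in> \<L>" "m \<noteq> 0"
  shows "Hom_zero D P (L\<langle>m\<rangle>)"
  using simple_heart[OF assms(2)] assms unfolding t_silting silting_t_structure_def perp_pos_def perp_neg_def
  by (cases "m < 0") auto

text \<open>If \<open>g\<close> were nonzero on the fibre \<open>F\<close> of \<open>f\<close>, then
  \<open>g\<close> itself would lift along the restriction of \<open>g\<close> to \<open>F\<close>,
  as \<open>g = g \<cdot> (i \<cdot> c)\<close>. So \<open>i \<cdot> c\<close> would be invertible
  although \<open>f\<close> kills it. Hence \<open>g\<close> vanishes on \<open>F\<close> and
  factors through \<open>f\<close>.\<close>

lemma factor_through_simple:
  assumes P: "P \<in> \<P>" and L: "L \<in> \<L>" "L' \<in> \<L>" and f: "arr f P L" "f \<noteq> zero_mor P L" and g: "arr g P L'"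
  obtains h where "arr h L L'" "h \<cdot> f = g"
proof -
  obtain F i j where T: "(F, P, L, i, f, j) \<in> Tri D" and F: "F \<in> fst t"
    using simple_minded_fiber[OF simple_minded t_simple_minded silting_le[OF P] L(1) f] by blast
  note a = Tri_arr[OF T]
  have o: "F \<in> Obj D" "P \<in> Obj D" "L \<in> Obj D" "L' \<in> Obj D" using a g arrD by blast+
  have gi: "arr (g \<cdot> i) F L'" using arr_comp[OF a(1) g] .
  show ?thesis
  proof (cases "g \<cdot> i = zero_mor F L'")
    case True
    then show ?thesis using Tri_colift[OF T g] that by blast
  next
    case False
    then obtain G k l where T': "(G, F, L', k, g \<cdot> i, l) \<in> Tri D" "G \<in> fst t"
      using simple_minded_fiber[OF simple_minded t_simple_minded F L(2) gi] by blast
    obtain c where c: "arr c P F" "(g \<cdot> i) \<cdot> c = g"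
      using derived_projective_lift[OF silting_derived_projective[OF P] T' g] by blast
    have ic: "arr (i \<cdot> c) P P" using arr_comp[OF c(1) a(1)] .
    have "g \<noteq> zero_mor P L'" using False zero_comp[OF a(1) o(4)] by auto
    moreover have "g \<cdot> (i \<cdot> c) = g" using assoc[OF c(1) a(1) g] c(2) by simp
    ultimately have iso: "iso_mor D P P (i \<cdot> c)"
      using silting_endo_iso_if_absorbed[OF silting P ic g] by blast
    have "f \<cdot> (i \<cdot> c) = zero_mor P L"
      using assoc[OF c(1) a(1,2)] Tri_comp_zero[OF T] zero_comp[OF c(1) o(3)] by simp
    also have "\<dots> = zero_mor P L \<cdot> (i \<cdot> c)" using zero_comp[OF ic o(3)] by simp
    finally have "f = zero_mor P L" by (rule iso_mor_cancel_right[OF iso f(1) arr_zero[OF o(2,3)]])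
    then show ?thesis using f(2) by blast
  qed
qed

text \<open>Otherwise \<open>P\<close> would have no morphisms to any shift of a simple object,
  hence none to itself by devissage.\<close>

lemma ex_simple:
  assumes P: "P \<in> \<P>"
  shows "\<exists>L\<in>\<L>. \<exists>f. arr f P L \<and> f \<noteq> zero_mor P L"
proof (rule ccontr)
  assume none: "\<not> ?thesis"
  have Po: "P \<in> Obj D" using silting_ObjI[OF P] .
  have "Hom_zero D P (L\<langle>m\<rangle>)" if L: "L \<in> \<L>" for L m
  proof (cases "m = 0")
    case True
    then show ?thesis using none Hom_zero_iff[OF Po simple_ObjI[OF L]] L simple_ObjI[OF L]
      by (auto simp: shift_obj_0)
  next
    case False
    then show ?thesis using silting_simple_Hom_zero[OF P L] by blast
  qed
  then have "Hom_zero D P P"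
    using Hom_zero_filt_right[OF simple_minded_generates[OF simple_minded Po] simple_minded_Obj[OF simple_minded] Po]
    by blast
  then show False using Hom_zero_self[OF Po] silting_not_zero[OF silting P] by blast
qed

text \<open>Otherwise \<open>L[-1]\<close> would lie in \<open>perp_pos D \<P>\<close>, that is,
  \<open>L\<close> in \<open>t_less D t\<close>; as \<open>L\<close> is also in the coaisle, its
  identity would vanish.\<close>

lemma ex_silting:
  assumes L: "L \<in> \<L>"
  shows "\<exists>P\<in>\<P>. \<exists>f. arr f P L \<and> f \<noteq> zero_mor P L"
proof (rule ccontr)
  assume none: "\<not> ?thesis"
  have Lo: "L \<in> Obj D" using simple_ObjI[OF L] .
  have *: "Hom_zero D P (L\<langle>m\<rangle>)" if P: "P \<in> \<P>" for P m
  proof (cases "m = 0")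
    case True
    then show ?thesis using none Hom_zero_iff[OF silting_ObjI[OF P] Lo] P Lo by (auto simp: shift_obj_0)
  next
    case False
    then show ?thesis using silting_simple_Hom_zero[OF P L] by blast
  qed
  have "L\<langle>-1\<rangle> \<in> fst t"
    unfolding t_silting silting_t_structure_def perp_pos_def using * Lo by (simp add: shift_obj_add shift_obj_closed)
  then have "L \<in> t_less D t" using t_less_iff[OF t_structure Lo] by simp
  then have "Hom_zero D L L" using t_less_Hom_zero[OF t_structure _ simple_heart(2)[OF L]] by blast
  then show False using Hom_zero_self[OF Lo] simple_minded_endo(2)[OF simple_minded L] by blast
qed

text \<open>The bijection of (IV) and (V). The choice is unambiguous by
  \<open>simple_top_unique\<close>.\<close>

definition simple_top :: "'o \<Rightarrow> 'o" where
  "simple_top P = (SOME L. L \<in> \<L> \<and> (\<exists>f. arr f P L \<and> f \<noteq> zero_mor P L))"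

lemma simple_top:
  assumes "P \<in> \<P>"
  shows "simple_top P \<in> \<L>" "\<exists>f. arr f P (simple_top P) \<and> f \<noteq> zero_mor P (simple_top P)"
proof -
  have "\<exists>L. L \<in> \<L> \<and> (\<exists>f. arr f P L \<and> f \<noteq> zero_mor P L)" using ex_simple[OF assms] by blast
  from someI_ex[OF this] show "simple_top P \<in> \<L>" "\<exists>f. arr f P (simple_top P) \<and> f \<noteq> zero_mor P (simple_top P)"
    unfolding simple_top_def by blast+
qed

lemma simple_top_unique:
  assumes P: "P \<in> \<P>" and L: "L \<in> \<L>" and g: "arr g P L" "g \<noteq> zero_mor P L"
  shows "L = simple_top P"
proof (rule ccontr)
  assume ne: "L \<noteq> simple_top P"
  obtain f where f: "arr f P (simple_top P)" "f \<noteq> zero_mor P (simple_top P)" using simple_top[OF P] by blast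
  obtain h where h: "arr h (simple_top P) L" "h \<cdot> f = g"
    using factor_through_simple[OF P simple_top(1)[OF P] L f g(1)] by blast
  have "h = zero_mor (simple_top P) L"
    using simple_minded_Hom_zero(2)[OF simple_minded simple_top(1)[OF P] L] ne Hom_zeroD h(1) by blast
  then show False using h(2) g(2) zero_comp[OF f(1) simple_ObjI[OF L]] by simp
qed

text \<open>Two nonzero morphisms to the same simple object lift along each other. Both composites
  of the lifts are absorbed by these morphisms, hence invertible, and distinct members of
  \<open>\<P>\<close> are not isomorphic.\<close>

lemma simple_top_inj:
  assumes P: "P \<in> \<P>" "P' \<in> \<P>" and eq: "simple_top P = simple_top P'"
  shows "P = P'"
proof -
  define L where "L = simple_top P"
  have L: "L \<in> \<L>" unfolding L_def using simple_top(1)[OF P(1)] .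
  obtain f where f: "arr f P L" "f \<noteq> zero_mor P L" using simple_top(2)[OF P(1)] unfolding L_def by blast
  obtain f' where f': "arr f' P' L" "f' \<noteq> zero_mor P' L" using simple_top(2)[OF P(2)] unfolding L_def eq by blast
  have lift: "\<exists>c. arr c Q Q' \<and> q' \<cdot> c = q"
    if Q: "Q \<in> \<P>" "Q' \<in> \<P>" and q: "arr q Q L" and q': "arr q' Q' L" "q' \<noteq> zero_mor Q' L" for Q Q' q q'
    using simple_minded_fiber[OF simple_minded t_simple_minded silting_le[OF Q(2)] L q']
      derived_projective_lift[OF silting_derived_projective[OF Q(1)] _ _ q] by metis
  obtain a where a: "arr a P P'" "f' \<cdot> a = f" using lift[OF P f(1) f'] by blast
  obtain b where b: "arr b P' P" "f \<cdot> b = f'" using lift[OF P(2,1) f'(1) f] by blast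
  have "f \<cdot> (b \<cdot> a) = f" using assoc[OF a(1) b(1) f(1)] a(2) b(2) by simp
  then have "iso_mor D P P (b \<cdot> a)"
    using silting_endo_iso_if_absorbed[OF silting P(1) arr_comp[OF a(1) b(1)] f] by blast
  moreover have "f' \<cdot> (a \<cdot> b) = f'" using assoc[OF b(1) a(1) f'(1)] a(2) b(2) by simp
  then have "iso_mor D P' P' (a \<cdot> b)"
    using silting_endo_iso_if_absorbed[OF silting P(2) arr_comp[OF b(1) a(1)] f'] by blast
  ultimately have "isomorphic D P P'"
    using iso_mor_if_both_comp_iso[OF a(1) b(1)] unfolding isomorphic_def by blast
  then show ?thesis using silting P unfolding silting_collection_def by blast
qed

lemma simple_top_bij: "bij_betw simple_top \<P> \<L>"
  unfolding bij_betw_def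
proof (intro conjI equalityI subsetI)
  show "inj_on simple_top \<P>" using simple_top_inj by (blast intro: inj_onI)
  show "L \<in> \<L>" if "L \<in> simple_top ` \<P>" for L using that simple_top(1) by blast
  show "L \<in> simple_top ` \<P>" if "L \<in> \<L>" for L using ex_silting[OF that] simple_top_unique that by blast
qed

text \<open>Any nonzero \<open>f\<close> is a basis: \<open>u \<mapsto> u \<cdot> f\<close> is
  injective because nonzero endomorphisms of \<open>L\<close> are invertible, and surjective by
  \<open>factor_through_simple\<close>.\<close>

lemma Hom_simple_top_iso:
  assumes P: "P \<in> \<P>"
  shows "\<exists>h. left_module_iso (End_ring D (simple_top P)) (Hom_left_module D P (simple_top P) 0)
    (regular_left_module (End_ring D (simple_top P))) h"
proof -
  define L where "L = simple_top P"
  have L: "L \<in> \<L>" "L \<in> Obj D" unfolding L_def using simple_top(1)[OF P] simple_ObjI by blast+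
  have Po: "P \<in> Obj D" using silting_ObjI[OF P] .
  obtain f where f: "arr f P L" "f \<noteq> zero_mor P L" using simple_top(2)[OF P] unfolding L_def by blast
  define F where "F = (\<lambda>u. u \<cdot> f)"
  have H: "x \<in> Hom D P L \<longleftrightarrow> arr x P L" "x \<in> Hom D L L \<longleftrightarrow> arr x L L" for x
    using Po L unfolding arr_def by auto
  have "inj_on F (Hom D L L)"
  proof (rule inj_onI)
    fix u v assume uv: "u \<in> Hom D L L" "v \<in> Hom D L L" "F u = F v"
    then have a: "arr u L L" "arr v L L" using H by auto
    let ?d = "diff L L u v"
    have d: "arr ?d L L" using arr_diff[OF a] .
    have df: "?d \<cdot> f = zero_mor P L"
      using diff_comp[OF f(1) L(2) a] uv(3) diff_zero_iff[OF arr_comp[OF f(1) a(1)] arr_comp[OF f(1) a(2)]]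
      unfolding F_def by simp
    have "?d = zero_mor L L"
    proof (rule ccontr)
      assume "?d \<noteq> zero_mor L L"
      then have iso: "iso_mor D L L ?d" using simple_minded_endo(1)[OF simple_minded L(1) d] by blast
      have "?d \<cdot> f = ?d \<cdot> zero_mor P L" using df comp_zero[OF d Po] by simp
      then show False using iso_mor_cancel_left[OF iso f(1) arr_zero[OF Po L(2)]] f(2) by blast
    qed
    then show "u = v" using diff_zero_iff[OF a] by simp
  qed
  moreover have "F ` Hom D L L = Hom D P L"
  proof (intro equalityI subsetI)
    show "x \<in> Hom D P L" if "x \<in> F ` Hom D L L" for x using that H arr_comp[OF f(1)] unfolding F_def by auto
    show "x \<in> F ` Hom D L L" if "x \<in> Hom D P L" for x
    proof -
      obtain h where "arr h L L" "h \<cdot> f = x"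
        using factor_through_simple[OF P L(1,1) f, of x] \<open>x \<in> Hom D P L\<close> H by blast
      then show ?thesis using H unfolding F_def by blast
    qed
  qed
  ultimately have bij: "bij_betw F (Hom D L L) (Hom D P L)" unfolding bij_betw_def by blast
  \<comment> \<open>Statement (V) asks for a map out of \<open>Hom(P, L)\<close>, which is the
    inverse of composition with \<open>f\<close>; its linearity is checked by applying
    \<open>F\<close>.\<close>
  define G where "G = inv_into (Hom D L L) F"
  have G: "bij_betw G (Hom D P L) (Hom D L L)" unfolding G_def using bij_betw_inv_into[OF bij] .
  have GF: "G (F u) = u" if "arr u L L" for u
    unfolding G_def using bij_betw_inv_into_left[OF bij] that H by blast
  have FG: "F (G x) = x" "arr (G x) L L" if "arr x P L" for x
    unfolding G_def using bij_betw_inv_into_right[OF bij] that H bij_betw_apply[OF G] unfolding G_def by blast+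
  have add: "G (plus_mor P L x y) = plus_mor L L (G x) (G y)" if x: "arr x P L" and y: "arr y P L" for x y
  proof -
    have "F (plus_mor L L (G x) (G y)) = plus_mor P L x y"
      using plus_comp[OF f(1) FG(2)[OF x] FG(2)[OF y]] FG(1)[OF x] FG(1)[OF y] unfolding F_def by simp
    then show ?thesis using GF[OF arr_plus[OF FG(2)[OF x] FG(2)[OF y]]] by simp
  qed
  have smult: "G (e \<cdot> x) = e \<cdot> G x" if e: "arr e L L" and x: "arr x P L" for e x
  proof -
    have "F (e \<cdot> G x) = e \<cdot> x" using assoc[OF f(1) FG(2)[OF x] e] FG(1)[OF x] unfolding F_def by simp
    then show ?thesis using GF[OF arr_comp[OF FG(2)[OF x] e]] by simp
  qed
  have e0: "e\<llangle>0\<rrangle> = e" if "arr e L L" for e using that shift_mor_0 unfolding arr_def by blast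
  have "left_module_iso (End_ring D L) (Hom_left_module D P L 0) (regular_left_module (End_ring D L)) G"
    unfolding left_module_iso_def Hom_left_module_def regular_left_module_def End_ring_def
    using G add smult e0 L(2) by (simp add: H shift_obj_0)
  then show ?thesis unfolding L_def by blast
qed

end

section \<open>Derived projective covers\<close>

context triangulated_category
begin

section \<open>Triangles that compute truncations\<close>

lemma ex_trunc_ge:
  assumes t: "t_structure D t" and X: "X \<in> Obj D"
  shows "\<exists>N\<in>t_less D t. \<exists>B\<in>snd t. tri N X B"
proof -
  obtain A B where AB: "A \<in> fst t" "B \<in> t_greater D t" "tri A (X\<langle>-1\<rangle>) B"
    using t_structureD(8)[OF t shift_obj_closed[OF X]] by blast
  have "tri (A\<langle>1\<rangle>) X (B\<langle>1\<rangle>)" using tri_shift[OF AB(3), of 1] shift_obj_back(2)[OF X, of 1] by simp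
  moreover have "A\<langle>1\<rangle> \<in> t_less D t" unfolding t_less_def shift_set_def using AB by blast
  moreover have "B\<langle>1\<rangle> \<in> snd t" using t_greater_iff[OF t t_greater_Obj[OF t AB(2)]] AB by blast
  ultimately show ?thesis by blast
qed

lemma t_less_shift: "N \<in> fst t \<Longrightarrow> N\<langle>1\<rangle> \<in> t_less D t"
  unfolding t_less_def shift_set_def by blast

lemma t_ge_colift:
  assumes t: "t_structure D t" and T: "(N, A, H, n, b, c) \<in> Tri D" and N: "N \<in> t_less D t"
    and Z: "Z \<in> snd t" and v: "arr v A Z"
  obtains d where "arr d H Z" "d \<cdot> b = v"
proof -
  have "v \<cdot> n = zero_mor N Z"
    using Hom_zeroD[OF t_less_Hom_zero[OF t N Z]] arr_comp[OF Tri_arr(1)[OF T] v] by blast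
  then show ?thesis using Tri_colift[OF T v] that by blast
qed

text \<open>A morphism that vanishes after \<open>b\<close> factors through \<open>N[1]\<close>,
  which lies in \<open>t_less D t\<close>. Assuming only \<open>N \<in> fst t\<close> makes this
  applicable beyond truncation triangles, in particular to the fibres from
  \<open>simple_minded_fiber\<close>.\<close>

lemma t_ge_cancel_zero:
  assumes t: "t_structure D t" and T: "(N, A, H, n, b, c) \<in> Tri D" and N: "N \<in> fst t"
    and Z: "Z \<in> snd t" and x: "arr x H Z" and z: "x \<cdot> b = zero_mor A Z"
  shows "x = zero_mor H Z"
proof -
  obtain d where d: "arr d (N\<langle>1\<rangle>) Z" "d \<cdot> c = x" using Tri_colift2[OF T x z] by blast
  then have "d = zero_mor (N\<langle>1\<rangle>) Z"
    using Hom_zeroD t_less_Hom_zero[OF t t_less_shift[OF N] Z] by blast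
  then show ?thesis using d(2) zero_comp[OF Tri_arr(3)[OF T] arrD(2)[OF x]] by simp
qed

lemma t_ge_cancel:
  assumes t: "t_structure D t" and T: "(N, A, H, n, b, c) \<in> Tri D" and N: "N \<in> fst t"
    and Z: "Z \<in> snd t" and x: "arr x H Z" and y: "arr y H Z" and eq: "x \<cdot> b = y \<cdot> b"
  shows "x = y"
proof -
  note b = Tri_arr(2)[OF T]
  have "diff H Z x y \<cdot> b = zero_mor A Z"
    using diff_comp[OF b arrD(2)[OF x] x y] eq diff_zero_iff[OF arr_comp[OF b x] arr_comp[OF b y]] by simp
  then show ?thesis using t_ge_cancel_zero[OF t T N Z arr_diff[OF x y]] diff_zero_iff[OF x y] by blast
qed

text \<open>As \<open>N\<close> has no morphisms to \<open>A\<close>, its identity factors through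
  \<open>H[-1]\<close>, to which it has none either; so \<open>N\<close> is zero.\<close>

lemma t_triangle_iso_right:
  assumes t: "t_structure D t" and T: "(N, A, H, n, b, c) \<in> Tri D"
    and N: "N \<in> t_less D t" and H: "H \<in> snd t" and A: "A \<in> snd t"
  shows "iso_mor D A H b"
proof -
  note a = Tri_arr[OF T]
  note T' = Tri_rotate_left[OF T]
  have o: "N \<in> Obj D" "A \<in> Obj D" using a arrD by blast+
  have "n \<cdot> ide D N = zero_mor N A"
    using id_right[OF a(1)] Hom_zeroD[OF t_less_Hom_zero[OF t N A] a(1)] by simp
  then obtain d where d: "arr d N (H\<langle>-1\<rangle>)" "neg (H\<langle>-1\<rangle>) N (c\<llangle>-1\<rrangle>) \<cdot> d = ide D N"
    using Tri_lift[OF T' arr_ide[OF o(1)]] by blast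
  then have "d = zero_mor N (H\<langle>-1\<rangle>)"
    using t_less_Hom_zero[OF t N t_structureD(4)[OF t H]] Hom_zeroD by blast
  then have "zero_obj D N" using d(2) comp_zero[OF Tri_arr(1)[OF T'] o(1)] o unfolding zero_obj_def by simp
  then show ?thesis using Tri_iso_if_zero[OF Tri_rotate_right[OF T]] zero_obj_shift by blast
qed

lemma fst_ext:
  assumes t: "t_structure D t" and T: "tri X Y Z" and XZ: "X \<in> fst t" "Z \<in> fst t"
  shows "Y \<in> fst t"
proof -
  have "t_greater D t \<subseteq> Obj D" using t_greater_Obj[OF t] by blast
  from extension_closed_left_perp[OF this]
  have "Y \<in> {X \<in> Obj D. \<forall>Y\<in>t_greater D t. Hom_zero D X Y}"
    using T XZ t_structureD(1,7)[OF t] unfolding extension_closed_iff by blast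
  then show ?thesis using t_structure_left_perp[OF t] by blast
qed

lemma t_ge_in_heart:
  assumes t: "t_structure D t" and T: "tri N A H" and N: "N \<in> fst t" and A: "A \<in> fst t" and H: "H \<in> snd t"
  shows "H \<in> heart t"
  unfolding heart_def
  using fst_ext[OF t tri_rotate(1)[OF T] A t_structureD(3)[OF t N]] H by blast

lemma heart_Obj: "t_structure D t \<Longrightarrow> heart t \<subseteq> Obj D"
  unfolding heart_def using t_structureD(1) by blast

text \<open>The cokernel of \<open>e\<close> in the heart is the truncation \<open>B\<close> of the
  cone \<open>C\<close>. The composite from \<open>Z\<close> to \<open>B\<close> is killed by the
  epimorphism \<open>e\<close>, so \<open>B\<close> is zero and \<open>C\<close> lies in
  \<open>t_less D t\<close>. There the obstruction \<open>g \<cdot> u\<close> vanishes by derived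
  projectivity.\<close>

lemma derived_projective_lift_epi:
  assumes t: "t_structure D t" and dp: "derived_projective D t X"
    and YZ: "Y \<in> heart t" "Z \<in> heart t" and e: "epi (full_subcat D (heart t)) Y Z e"
    and u: "arr u X Z"
  obtains v where "arr v X Y" "e \<cdot> v = u"
proof -
  note ho = heart_Obj[OF t]
  have h: "Y \<in> fst t" "Y \<in> snd t" "Z \<in> fst t" "Z \<in> snd t" using YZ unfolding heart_def by auto
  have ea: "arr e Y Z" using epi_full_subcatD(1)[OF e ho YZ] .
  obtain C g k where T: "(Y, Z, C, e, g, k) \<in> Tri D" using Tri_cone ea unfolding arr_def by blast
  note a = Tri_arr[OF T]
  have Co: "C \<in> Obj D" using a arrD by blast
  have "tri Z C (Y\<langle>1\<rangle>)" using tri_rotate(1) T unfolding tri_def by blast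
  then have C: "C \<in> fst t" using fst_ext[OF t _ h(3) t_structureD(3)[OF t h(1)]] by blast
  obtain N B n p q where N: "N \<in> t_less D t" and B: "B \<in> snd t" and T': "(N, C, B, n, p, q) \<in> Tri D"
    using ex_trunc_ge[OF t Co] unfolding tri_def by blast
  note a' = Tri_arr[OF T']
  have Bo: "B \<in> Obj D" using a' arrD by blast
  have Nf: "N \<in> fst t" using t_less_le[OF t N] .
  have Bh: "B \<in> heart t" using t_ge_in_heart[OF t _ Nf C B] T' unfolding tri_def by blast
  have pg: "arr (p \<cdot> g) Z B" using arr_comp[OF a(2) a'(2)] .
  have "(p \<cdot> g) \<cdot> e = zero_mor Y B"
    using assoc[OF a(1,2) a'(2)] Tri_comp_zero[OF T] comp_zero[OF a'(2) arrD(1)[OF ea]] by simp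
  then have "p \<cdot> g = zero_mor Z B" using epi_full_subcatD(2)[OF e ho YZ Bh pg] by blast
  then have "p = zero_mor C B" using t_ge_cancel_zero[OF t T h(1) B a'(2)] by blast
  then have "ide D B \<cdot> p = zero_mor C B" using id_left[OF a'(2)] by simp
  then have "ide D B = zero_mor B B" using t_ge_cancel_zero[OF t T' Nf B arr_ide[OF Bo]] by blast
  then have "zero_obj D B" using Bo unfolding zero_obj_def by simp
  then have "isomorphic D N C" using Tri_iso_if_zero[OF T'] unfolding isomorphic_def by blast
  then have "isomorphic D (N\<langle>-1\<rangle>) (C\<langle>-1\<rangle>)" using isomorphic_shift by blast
  then have "C\<langle>-1\<rangle> \<in> fst t" using t_structureD(5)[OF t] t_less_iff[OF t t_less_Obj[OF t N]] N by blast
  then have "Hom_zero D X (C\<langle>-1\<rangle>\<langle>1\<rangle>)" using dp unfolding derived_projective_def by blast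
  then have "Hom_zero D X C" using shift_obj_back(2)[OF Co, of 1] by simp
  then have "g \<cdot> u = zero_mor X C" using Hom_zeroD arr_comp[OF u a(2)] by blast
  then show ?thesis using Tri_lift[OF T u] that by blast
qed

section \<open>The chosen truncations and their effect on morphisms\<close>

lemma trunc_le:
  assumes t: "t_structure D t" and X: "X \<in> Obj D"
  obtains B b c where "fst (trunc_le D t X) \<in> fst t" "B \<in> t_greater D t"
    "(fst (trunc_le D t X), X, B, snd (trunc_le D t X), b, c) \<in> Tri D"
proof -
  have "\<exists>p. case p of (A, a) \<Rightarrow> A \<in> fst t \<and> (\<exists>B\<in>t_greater D t. \<exists>b c. (A, X, B, a, b, c) \<in> Tri D)"
    using t_structureD(8)[OF t X] unfolding tri_def by fast
  from someI_ex[OF this, folded trunc_le_def] show ?thesis using that by (auto simp: case_prod_beta)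
qed

lemma trunc_ge:
  assumes t: "t_structure D t" and X: "X \<in> Obj D"
  obtains N n c where "fst (trunc_ge D t X) \<in> snd t" "N \<in> t_less D t"
    "(N, X, fst (trunc_ge D t X), n, snd (trunc_ge D t X), c) \<in> Tri D"
proof -
  have "\<exists>p. case p of (B, b) \<Rightarrow> B \<in> snd t \<and> (\<exists>A\<in>t_less D t. \<exists>a c. (A, X, B, a, b, c) \<in> Tri D)"
    using ex_trunc_ge[OF t X] unfolding tri_def by fast
  from someI_ex[OF this, folded trunc_ge_def] show ?thesis using that by (auto simp: case_prod_beta)
qed

lemma trunc_le_iso:
  assumes t: "t_structure D t" and X: "X \<in> fst t"
  shows "iso_mor D (fst (trunc_le D t X)) X (snd (trunc_le D t X))" "fst (trunc_le D t X) \<in> fst t"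
proof -
  obtain B b c where *: "fst (trunc_le D t X) \<in> fst t" "B \<in> t_greater D t"
    "(fst (trunc_le D t X), X, B, snd (trunc_le D t X), b, c) \<in> Tri D"
    using trunc_le[OF t t_structureD(1)[OF t X]] .
  show "fst (trunc_le D t X) \<in> fst t" by fact
  show "iso_mor D (fst (trunc_le D t X)) X (snd (trunc_le D t X))"
    using t_triangle_iso_left[OF t *(3,1,2)] t_structureD(7)[OF t X *(2)] by blast
qed

text \<open>This removes the choice operators: for \<open>X\<close> in the aisle,
  \<open>H0 D t X\<close> is the third object of a triangle starting with \<open>N\<close> and
  \<open>X\<close>, and \<open>H0_mor\<close> is described by a commuting square over
  \<open>f\<close>.\<close>

lemma H0_mor_eq:
  assumes t: "t_structure D t" and X: "X \<in> fst t" and L: "L \<in> heart t" and f: "arr f X L"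
  obtains N n q c \<theta> where "N \<in> t_less D t" "(N, X, H0 D t X, n, q, c) \<in> Tri D"
    "H0 D t X \<in> heart t" "H0 D t L \<in> heart t" "iso_mor D L (H0 D t L) \<theta>"
    "arr (H0_mor D t X L f) (H0 D t X) (H0 D t L)" "H0_mor D t X L f \<cdot> q = \<theta> \<cdot> f"
proof -
  have Lh: "L \<in> fst t" "L \<in> snd t" using L unfolding heart_def by auto
  have o: "X \<in> Obj D" "L \<in> Obj D" using t_structureD(1)[OF t] X Lh by auto
  define A a where "A = fst (trunc_le D t X)" and "a = snd (trunc_le D t X)"
  define AL aL where "AL = fst (trunc_le D t L)" and "aL = snd (trunc_le D t L)"
  have iA: "iso_mor D A X a" "A \<in> fst t" unfolding A_def a_def using trunc_le_iso[OF t X] .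
  have iL: "iso_mor D AL L aL" "AL \<in> fst t" unfolding AL_def aL_def using trunc_le_iso[OF t Lh(1)] .
  obtain a' where a': "iso_mor D X A a'" "a' \<cdot> a = ide D A" "a \<cdot> a' = ide D X" using iA(1) by (rule iso_mor_inverse)
  obtain aL' where aL': "iso_mor D L AL aL'" "aL' \<cdot> aL = ide D AL" "aL \<cdot> aL' = ide D L" using iL(1) by (rule iso_mor_inverse)
  note aa = iso_mor_arr[OF iA(1)] iso_mor_arr[OF iL(1)] iso_mor_arr[OF a'(1)] iso_mor_arr[OF aL'(1)]
  have Ao: "A \<in> Obj D" "AL \<in> Obj D" using aa arrD by blast+
  have ALs: "AL \<in> snd t" using t_structureD(6)[OF t Lh(2)] aL'(1) unfolding isomorphic_def by blast
  define H b where "H = fst (trunc_ge D t A)" and "b = snd (trunc_ge D t A)"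
  define HL bL where "HL = fst (trunc_ge D t AL)" and "bL = snd (trunc_ge D t AL)"
  obtain N n c where H: "H \<in> snd t" and N: "N \<in> t_less D t" and T: "(N, A, H, n, b, c) \<in> Tri D"
    unfolding H_def b_def using trunc_ge[OF t Ao(1)] by blast
  obtain NL nL cL where HL: "HL \<in> snd t" and NL: "NL \<in> t_less D t" and TL: "(NL, AL, HL, nL, bL, cL) \<in> Tri D"
    unfolding HL_def bL_def using trunc_ge[OF t Ao(2)] by blast
  note Nf = t_less_le[OF t N] and NLf = t_less_le[OF t NL]
  have Hh: "H \<in> heart t" using t_ge_in_heart[OF t _ Nf iA(2) H] T unfolding tri_def by blast
  have HLh: "HL \<in> heart t" using t_ge_in_heart[OF t _ NLf iL(2) HL] TL unfolding tri_def by blast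
  have ibL: "iso_mor D AL HL bL" using t_triangle_iso_right[OF t TL NL HL ALs] .
  have bLa: "arr bL AL HL" using iso_mor_arr[OF ibL] .
  have ba: "arr b A H" using Tri_arr(2)[OF T] .
  have fa: "arr (f \<cdot> a) A L" using arr_comp[OF aa(1) f] .
  define g where "g = aL' \<cdot> (f \<cdot> a)"
  have g: "arr g A AL" unfolding g_def using arr_comp[OF fa aa(4)] .
  have aLg: "aL \<cdot> g = f \<cdot> a" unfolding g_def using assoc[OF fa aa(4,2)] aL'(3) id_left[OF fa] by simp
  \<comment> \<open>Uniqueness, needed for the definite description, holds because \<open>aL\<close>
    is invertible. For the other truncation it will follow from \<open>t_ge_cancel\<close>.\<close>
  have tm: "trunc_le_mor D t X L f = g"
    unfolding trunc_le_mor_def A_def[symmetric] a_def[symmetric] AL_def[symmetric] aL_def[symmetric]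
  proof (rule the_equality)
    show "g \<in> Hom D A AL \<and> aL \<cdot> g = f \<cdot> a" using arrD(3)[OF g] aLg by blast
    fix g' assume *: "g' \<in> Hom D A AL \<and> aL \<cdot> g' = f \<cdot> a"
    then have "arr g' A AL" using Ao unfolding arr_def by blast
    then show "g' = g" using iso_mor_cancel_left[OF iL(1) _ g] * aLg by simp
  qed
  have bg: "arr (bL \<cdot> g) A HL" using arr_comp[OF g bLa] .
  obtain k where k: "arr k H HL" "k \<cdot> b = bL \<cdot> g" using t_ge_colift[OF t T N HL bg] by blast
  have km: "H0_mor D t X L f = k"
    unfolding H0_mor_def tm trunc_ge_mor_def A_def[symmetric] AL_def[symmetric]
      H_def[symmetric] b_def[symmetric] HL_def[symmetric] bL_def[symmetric]
  proof (rule the_equality)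
    show "k \<in> Hom D H HL \<and> k \<cdot> b = bL \<cdot> g" using arrD(3)[OF k(1)] k(2) by blast
    fix k' assume *: "k' \<in> Hom D H HL \<and> k' \<cdot> b = bL \<cdot> g"
    then have "arr k' H HL" using arrD(1,2)[OF k(1)] unfolding arr_def by blast
    then show "k' = k" using t_ge_cancel[OF t T Nf HL _ k(1)] * k(2) by simp
  qed
  have H0: "H0 D t X = H" "H0 D t L = HL" unfolding H0_def H_def HL_def A_def AL_def by simp_all
  \<comment> \<open>Composing with the inverses of the first truncations makes the square start at
    \<open>X\<close> and \<open>L\<close> themselves.\<close>
  define q where "q = b \<cdot> a'"
  define \<theta> where "\<theta> = bL \<cdot> aL'"
  have qa: "arr q X H" unfolding q_def using arr_comp[OF aa(3) ba] .
  note Ta = Tri_arr[OF T]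
  have No: "N \<in> Obj D" "H \<in> Obj D" using Ta arrD by blast+
  have an: "arr (a \<cdot> n) N X" using arr_comp[OF Ta(1) aa(1)] .
  have "a \<cdot> n = (a \<cdot> n) \<cdot> ide D N" using id_right[OF an] by simp
  moreover have "ide D H \<cdot> b = q \<cdot> a" unfolding q_def using id_left[OF ba] assoc[OF aa(1,3) ba] a'(2) id_right[OF ba] by simp
  moreover have "(ide D N)\<llangle>1\<rrangle> \<cdot> c = c \<cdot> ide D H"
    using shift_mor_ide[OF No(1)] id_left[OF Ta(3)] id_right[OF Ta(3)] by simp
  ultimately have T2: "(N, X, H, a \<cdot> n, q, c) \<in> Tri D"
    using Tri_iso[OF T iso_mor_ide[OF No(1)] iA(1) iso_mor_ide[OF No(2)]] an qa Ta(3) unfolding arr_def by blast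
  have "k \<cdot> q = (bL \<cdot> g) \<cdot> a'" unfolding q_def using assoc[OF aa(3) ba k(1)] k(2) by simp
  also have "\<dots> = bL \<cdot> (g \<cdot> a')" using assoc[OF aa(3) g bLa] .
  also have "g \<cdot> a' = aL' \<cdot> f"
    unfolding g_def using assoc[OF aa(3) fa aa(4)] assoc[OF aa(3,1) f] a'(3) id_right[OF f] by simp
  also have "bL \<cdot> (aL' \<cdot> f) = \<theta> \<cdot> f" unfolding \<theta>_def using assoc[OF f aa(4) bLa] by simp
  finally have kq: "k \<cdot> q = \<theta> \<cdot> f" .
  have th: "iso_mor D L HL \<theta>" unfolding \<theta>_def using iso_mor_comp[OF aL'(1) ibL] .
  show ?thesis
    using that[of N "a \<cdot> n" q c \<theta>] N T2 Hh HLh th k(1) kq unfolding H0 km by blast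
qed

end

section \<open>Nonzero morphisms to simple objects as derived projective covers\<close>

context silting_simple_minded
begin

lemma derived_projective_cover_simple_top:
  assumes P: "P \<in> \<P>" and L: "L \<in> \<L>" and f: "arr f P L" "f \<noteq> zero_mor P L"
  shows "derived_projective_cover D t P L f"
proof -
  note ts = t_structure
  note dp = silting_derived_projective[OF P]
  have Lh: "L \<in> heart t" unfolding heart_def using simple_heart[OF L] by blast
  define H HL k where "H = H0 D t P" and "HL = H0 D t L" and "k = H0_mor D t P L f"
  obtain N n q c \<theta> where N: "N \<in> t_less D t" and T: "(N, P, H, n, q, c) \<in> Tri D"
    and Hh: "H \<in> heart t" and HLh: "HL \<in> heart t" and th: "iso_mor D L HL \<theta>"
    and k: "arr k H HL" and kq: "k \<cdot> q = \<theta> \<cdot> f"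
    using H0_mor_eq[OF ts silting_le[OF P] Lh f(1)] unfolding H_def HL_def k_def by blast
  obtain F i j where TF: "(F, P, L, i, f, j) \<in> Tri D" and F: "F \<in> fst t"
    using simple_minded_fiber[OF simple_minded t_simple_minded silting_le[OF P] L f] by blast
  note Nf = t_less_le[OF ts N] and qa = Tri_arr(2)[OF T] and ho = heart_Obj[OF ts] and tha = iso_mor_arr[OF th]
  have snd_heart: "Z \<in> snd t" if "Z \<in> heart t" for Z using that unfolding heart_def by blast
  \<comment> \<open>A lifting problem for \<open>H\<close> is solved after precomposing with
    \<open>q\<close>, where derived projectivity of \<open>P\<close> applies; the solution descends
    because its target lies in the coaisle.\<close>
  have proj: "projective (full_subcat D (heart t)) H"
    unfolding projective_def full_subcat_simps
  proof (intro conjI ballI allI impI)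
    show "H \<in> heart t" by fact
    fix Y Z e u assume YZ: "Y \<in> heart t" "Z \<in> heart t"
      and eu: "epi (full_subcat D (heart t)) Y Z e \<and> u \<in> Hom D H Z"
    then have e: "epi (full_subcat D (heart t)) Y Z e" and u: "arr u H Z"
      using ho Hh unfolding arr_def by auto
    have ea: "arr e Y Z" using epi_full_subcatD(1)[OF e ho YZ] .
    obtain v where v: "arr v P Y" "e \<cdot> v = u \<cdot> q"
      using derived_projective_lift_epi[OF ts dp YZ e arr_comp[OF qa u]] by blast
    obtain v' where v': "arr v' H Y" "v' \<cdot> q = v"
      using t_ge_colift[OF ts T N snd_heart[OF YZ(1)] v(1)] by blast
    have "(e \<cdot> v') \<cdot> q = u \<cdot> q" using assoc[OF qa v'(1) ea] v'(2) v(2) by simp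
    then have "e \<cdot> v' = u" using t_ge_cancel[OF ts T Nf snd_heart[OF YZ(2)] arr_comp[OF v'(1) ea] u] by blast
    then show "\<exists>g\<in>Hom D H Y. e \<cdot> g = u" using arrD(3)[OF v'(1)] by blast
  qed
  \<comment> \<open>A morphism that kills \<open>k\<close> gives, along \<open>\<theta>\<close>, one
    that kills \<open>f\<close>, and \<open>f\<close> can be cancelled since its fibre lies in the
    aisle.\<close>
  have epik: "epi (full_subcat D (heart t)) H HL k"
  proof (rule epi_full_subcatI[OF k ho])
    fix Z x assume Z: "Z \<in> heart t" and x: "arr x HL Z" and xk: "x \<cdot> k = zero_mor H Z"
    have Zo: "Z \<in> Obj D" using Z ho by blast
    have xt: "arr (x \<cdot> \<theta>) L Z" using arr_comp[OF tha x] .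
    have "(x \<cdot> \<theta>) \<cdot> f = (x \<cdot> k) \<cdot> q" using assoc[OF f(1) tha x] assoc[OF qa k x] kq by simp
    then have "(x \<cdot> \<theta>) \<cdot> f = zero_mor P Z" using xk zero_comp[OF qa Zo] by simp
    then have "x \<cdot> \<theta> = zero_mor L Z" using t_ge_cancel_zero[OF ts TF F snd_heart[OF Z] xt] by blast
    also have "\<dots> = zero_mor HL Z \<cdot> \<theta>" using zero_comp[OF tha Zo] by simp
    finally show "x = zero_mor HL Z"
      by (rule iso_mor_cancel_right[OF th x arr_zero[OF arrD(1)[OF x] Zo]])
  qed
  \<comment> \<open>The morphism \<open>k \<cdot> q\<close> lifts along \<open>k \<cdot> g\<close>
    to \<open>v\<close>, and \<open>g \<cdot> v\<close> lifts along \<open>q\<close> to an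
    endomorphism \<open>q'\<close> of \<open>P\<close>. Since \<open>f \<cdot> q' = f\<close>, it is
    invertible, so whatever kills \<open>g\<close> also kills \<open>q\<close> and hence
    vanishes.\<close>
  have ess: "epi (full_subcat D (heart t)) M H g"
    if M: "M \<in> heart t" and g: "g \<in> Hom D M H" and e: "epi (full_subcat D (heart t)) M HL (k \<cdot> g)" for M g
  proof (rule epi_full_subcatI[OF _ ho])
    show ga: "arr g M H" using g M Hh ho unfolding arr_def by blast
    obtain v where v: "arr v P M" "(k \<cdot> g) \<cdot> v = k \<cdot> q"
      using derived_projective_lift_epi[OF ts dp M HLh e arr_comp[OF qa k]] by blast
    have gv: "arr (g \<cdot> v) P H" using arr_comp[OF v(1) ga] .
    obtain q' where q': "arr q' P P" "q \<cdot> q' = g \<cdot> v" using derived_projective_lift[OF dp T Nf gv] by blast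
    have fq: "arr (f \<cdot> q') P L" using arr_comp[OF q'(1) f(1)] .
    have "\<theta> \<cdot> (f \<cdot> q') = (k \<cdot> q) \<cdot> q'" using assoc[OF q'(1) f(1) tha] kq by simp
    also have "\<dots> = k \<cdot> (g \<cdot> v)" using assoc[OF q'(1) qa k] q'(2) by simp
    also have "\<dots> = \<theta> \<cdot> f" using assoc[OF v(1) ga k] v(2) kq by simp
    finally have "f \<cdot> q' = f" by (rule iso_mor_cancel_left[OF th fq f(1)])
    then have iq: "iso_mor D P P q'" using silting_endo_iso_if_absorbed[OF silting P q'(1) f] by blast
    fix Z x assume Z: "Z \<in> heart t" and x: "arr x H Z" and xg: "x \<cdot> g = zero_mor M Z"
    have Zo: "Z \<in> Obj D" using Z ho by blast
    have "(x \<cdot> q) \<cdot> q' = x \<cdot> (g \<cdot> v)" using assoc[OF q'(1) qa x] q'(2) by simp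
    also have "\<dots> = (x \<cdot> g) \<cdot> v" using assoc[OF v(1) ga x] by simp
    also have "\<dots> = zero_mor P Z \<cdot> q'" using xg zero_comp[OF v(1) Zo] zero_comp[OF q'(1) Zo] by simp
    finally have "x \<cdot> q = zero_mor P Z"
      by (rule iso_mor_cancel_right[OF iq arr_comp[OF qa x] arr_zero[OF arrD(1)[OF qa] Zo]])
    then show "x = zero_mor H Z" using t_ge_cancel_zero[OF ts T Nf snd_heart[OF Z] x] by blast
  qed
  have "projective_cover (full_subcat D (heart t)) H HL k"
    unfolding projective_cover_def full_subcat_simps using proj HLh epik ess by blast
  then show ?thesis
    unfolding derived_projective_cover_def H_def HL_def k_def using dp f(1) unfolding arr_def by blast
qed

end

section \<open>The equivalences\<close>

theorem theorem3p18:
  fixes K :: "('k, 'r) ring_scheme" and D :: "('k, 'o, 'm) tri_cat"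
    and \<P> \<L> C :: "'o set" and w t :: "'o set \<times> 'o set"
  assumes "triangulated_category K D"
    and "silting_collection D \<P>"
    and "simple_minded_collection D \<L>"
    and "C = thick D \<P>"
    and "w = silting_weight_structure D \<P>"
    and "t = simple_minded_t_structure D \<L>"
  shows
    "let I = left_orthogonal D w t;
         II = strictly_left_orthogonal D C w t;
         III = (t = silting_t_structure D \<P>);
         IV = (\<exists>\<phi>. bij_betw \<phi> \<P> \<L> \<and>
           (\<forall>P\<in>\<P>. \<exists>p. derived_projective_cover D t P (\<phi> P) p));
         V = (\<exists>\<phi>. bij_betw \<phi> \<P> \<L> \<and>
           (\<forall>P\<in>\<P>. \<forall>L\<in>\<L>. \<forall>m::int.
             if L = \<phi> P \<and> m = 0
             then \<exists>h. left_module_iso (End_ring D L) (Hom_left_module D P L m)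
                        (regular_left_module (End_ring D L)) h
             else Hom_zero D P (shift_obj D L m)))
     in (I \<longleftrightarrow> II) \<and> (I \<longleftrightarrow> III) \<and> (I \<longleftrightarrow> IV) \<and> (I \<longleftrightarrow> V)"
proof -
  interpret triangulated_category K D by fact
  note s = assms(2) and sm = assms(3)
  let ?I = "left_orthogonal D w t"
  let ?II = "strictly_left_orthogonal D C w t"
  let ?III = "t = silting_t_structure D \<P>"
  let ?IV = "\<exists>\<phi>. bij_betw \<phi> \<P> \<L> \<and> (\<forall>P\<in>\<P>. \<exists>p. derived_projective_cover D t P (\<phi> P) p)"
  let ?V = "\<exists>\<phi>. bij_betw \<phi> \<P> \<L> \<and> (\<forall>P\<in>\<P>. \<forall>L\<in>\<L>. \<forall>m::int. if L = \<phi> P \<and> m = 0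
      then \<exists>h. left_module_iso (End_ring D L) (Hom_left_module D P L m) (regular_left_module (End_ring D L)) h
      else Hom_zero D P (shift_obj D L m))"
  have ts: "t_structure D t" using t_structure_simple_minded[OF sm] assms(6) by simp
  have 13: "?I \<longleftrightarrow> ?III" unfolding assms(5) using left_orthogonal_iff_silting[OF s ts] .
  have 32: "?III \<Longrightarrow> ?II" unfolding assms(4,5) using silting_strictly_left_orthogonal[OF s ts] .
  have 21: "?II \<Longrightarrow> ?I" unfolding strictly_left_orthogonal_def by blast
  have 41: "?I" if "?IV"
    unfolding assms(5)
    using left_orthogonal_if_derived_projective[OF silting_Obj[OF s] ts] that
    unfolding derived_projective_cover_def by blast
  have 51: "?I" if V: "?V"
    unfolding assms(5,6)
  proof (rule left_orthogonal_if_Hom_zero[OF s sm])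
    fix P L and m :: int assume "P \<in> \<P>" "L \<in> \<L>" "m \<noteq> 0"
    then show "Hom_zero D P (shift_obj D L m)" using V by metis
  qed
  \<comment> \<open>The same bijection \<open>simple_top\<close> witnesses both statements.\<close>
  have 3: "?IV \<and> ?V" if "?III"
  proof -
    interpret silting_simple_minded K D \<P> \<L> t
      using s sm assms(6) that by unfold_locales
    have "\<exists>p. derived_projective_cover D t P (simple_top P) p" if "P \<in> \<P>" for P
      using simple_top[OF that] derived_projective_cover_simple_top[OF that] by blast
    moreover have "Hom_zero D P (shift_obj D L m)"
      if PL: "P \<in> \<P>" "L \<in> \<L>" and ne: "\<not> (L = simple_top P \<and> m = 0)" for P L m
    proof (cases "m = 0")
      case True
      then have "Hom_zero D P L"
        using Hom_zero_iff[OF silting_ObjI simple_ObjI] simple_top_unique PL ne by blast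
      then show ?thesis using True shift_obj_0[OF simple_ObjI[OF PL(2)]] by simp
    next
      case False
      then show ?thesis using silting_simple_Hom_zero PL by blast
    qed
    ultimately show ?thesis
      using simple_top_bij Hom_simple_top_iso by (intro conjI exI[of _ simple_top]) auto
  qed
  show ?thesis unfolding Let_def using 13 32 21 41 51 3 by blast
qed

end
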